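(* Let $N\ge2$, let $\Omega\subset\mathbb{R}^N$ be an open set and let $u\in L^1_{\mathrm{loc}}(\Omega)$ be such that its distributional Laplacian $\Delta u$ is a locally finite (possibly signed) Borel measure in $\Omega$. If $$|\Delta u|\ge\theta\,\mathrm{d}x,$$ where $\theta$ is a Borel-measurable function in $\Omega$ such that $\theta>0$ almost everywhere in $\Omega$, then the level set $\{u=\alpha\}$ is Lebesgue-negligible for every $\alpha\in\mathbb{R}$.
   Context: "$\Delta u$ is a locally finite Borel measure" means that there is a locally finite, possibly signed, Borel measure $\lambda$ in $\Omega$ with $\int_\Omega u\,\Delta\varphi\,\mathrm{d}x=\int_\Omega\varphi\,\mathrm{d}\lambda$ for every $\varphi\in C_c^\infty(\Omega)$; one identifies $\Delta u$ with $\lambda$. $|\Delta u|$ is its total variation measure, and the inequality $|\Delta u|\ge\theta\,\mathrm{d}x$ is between measures on $\Omega$. *)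

theory Defs
  imports "HOL-Analysis.Analysis"
begin

subsection \<open>Test functions and the Laplacian\<close>

definition partial_deriv :: "'a::euclidean_space \<Rightarrow> ('a \<Rightarrow> real) \<Rightarrow> 'a \<Rightarrow> real" where
  "partial_deriv b f = (\<lambda>x. frechet_derivative f (at x) b)"

definition laplacian :: "('a::euclidean_space \<Rightarrow> real) \<Rightarrow> 'a \<Rightarrow> real" where
  "laplacian f = (\<lambda>x. \<Sum>b\<in>Basis. partial_deriv b (partial_deriv b f) x)"

text \<open>
  Differentiability of all iterated partial derivatives makes each of them continuous, so this is
  \<open>C\<^sup>\<infinity>\<close> in the usual sense.
\<close>

definition smooth :: "('a::euclidean_space \<Rightarrow> real) \<Rightarrow> bool" where
  "smooth f \<longleftrightarrow>
     (\<forall>bs. set bs \<subseteq> Basis \<longrightarrow> (\<forall>x. foldr partial_deriv bs f differentiable at x))"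

text \<open>Elements of \<open>C\<^sub>c\<^sup>\<infinity>(\<Omega>)\<close>, extended by zero to the whole space.\<close>

definition test_function :: "'a::euclidean_space set \<Rightarrow> ('a \<Rightarrow> real) \<Rightarrow> bool" where
  "test_function \<Omega> \<phi> \<longleftrightarrow>
     smooth \<phi> \<and> compact (closure {x. \<phi> x \<noteq> 0}) \<and> closure {x. \<phi> x \<noteq> 0} \<subseteq> \<Omega>"

definition locally_integrable :: "'a::euclidean_space set \<Rightarrow> ('a \<Rightarrow> real) \<Rightarrow> bool" where
  "locally_integrable \<Omega> u \<longleftrightarrow>
     (\<forall>K. compact K \<and> K \<subseteq> \<Omega> \<longrightarrow> set_integrable lebesgue K u)"

subsection \<open>Locally finite signed Borel measures\<close>

text \<open>
  Both the positive and the negative part of a locally finite signed measure may be infinite on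
  sets that are not relatively compact in \<open>\<Omega>\<close>. Such a measure is therefore a real-valued set
  function, of which only the values on the following sets are meaningful.
\<close>

definition relcompact_borel :: "'a::euclidean_space set \<Rightarrow> 'a set set" where
  "relcompact_borel \<Omega> = {A \<in> sets borel. compact (closure A) \<and> closure A \<subseteq> \<Omega>}"

definition locally_finite_signed_measure :: "'a::euclidean_space set \<Rightarrow> ('a set \<Rightarrow> real) \<Rightarrow> bool" where
  "locally_finite_signed_measure \<Omega> \<nu> \<longleftrightarrow>
     (\<forall>A :: nat \<Rightarrow> 'a set. range A \<subseteq> relcompact_borel \<Omega> \<and> disjoint_family A \<and>
        (\<Union>i. A i) \<in> relcompact_borel \<Omega> \<longrightarrow> (\<lambda>i. \<nu> (A i)) sums \<nu> (\<Union>i. A i))"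

text \<open>
  The total variation of an arbitrary Borel subset of \<open>\<Omega>\<close>: the supremum runs over its countable
  Borel partitions into relatively compact pieces.
\<close>

definition total_variation ::
    "'a::euclidean_space set \<Rightarrow> ('a set \<Rightarrow> real) \<Rightarrow> 'a set \<Rightarrow> ennreal" where
  "total_variation \<Omega> \<nu> A =
     (SUP E \<in> {E :: nat \<Rightarrow> 'a set. range E \<subseteq> relcompact_borel \<Omega> \<and> disjoint_family E \<and>
                 (\<Union>i. E i) = A}.
        \<Sum>i. ennreal \<bar>\<nu> (E i)\<bar>)"

text \<open>
  The positive part of the Jordan decomposition; the negative part is the positive part of
  \<open>-\<nu>\<close>. In the supremum \<^const>\<open>ennreal\<close> truncates negative values to zero, which is harmless
  since \<open>B = {}\<close> is admissible.
\<close>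

definition positive_part :: "'a::euclidean_space set \<Rightarrow> ('a set \<Rightarrow> real) \<Rightarrow> 'a measure" where
  "positive_part \<Omega> \<nu> =
     measure_of \<Omega> (sets (restrict_space borel \<Omega>))
       (\<lambda>A. SUP B \<in> {B \<in> relcompact_borel \<Omega>. B \<subseteq> A}. ennreal (\<nu> B))"

definition negative_part :: "'a::euclidean_space set \<Rightarrow> ('a set \<Rightarrow> real) \<Rightarrow> 'a measure" where
  "negative_part \<Omega> \<nu> = positive_part \<Omega> (\<lambda>A. - \<nu> A)"

definition signed_integral ::
    "'a::euclidean_space set \<Rightarrow> ('a set \<Rightarrow> real) \<Rightarrow> ('a \<Rightarrow> real) \<Rightarrow> real" where
  "signed_integral \<Omega> \<nu> \<phi> =
     integral\<^sup>L (positive_part \<Omega> \<nu>) \<phi> - integral\<^sup>L (negative_part \<Omega> \<nu>) \<phi>"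

text \<open>
  The set function in \<^const>\<open>positive_part\<close> is countably additive, so that \<^const>\<open>measure_of\<close> does
  not fall back to the zero measure.
\<close>

lemma relcompact_borel_subset:
  assumes "A \<in> relcompact_borel \<Omega>" "B \<in> sets borel" "B \<subseteq> A"
  shows "B \<in> relcompact_borel \<Omega>"
proof -
  have "closure B \<subseteq> closure A" using assms by (simp add: closure_mono)
  moreover have "compact (closure B)"
    using assms calculation unfolding relcompact_borel_def
    by (metis (no_types, lifting) bounded_subset closed_closure compact_eq_bounded_closed mem_Collect_eq)
  ultimately show ?thesis using assms by (auto simp: relcompact_borel_def)
qed

lemma relcompact_borel_empty [simp]: "{} \<in> relcompact_borel \<Omega>"
  by (simp add: relcompact_borel_def)

lemma relcompact_borel_Un:
  "A \<in> relcompact_borel \<Omega> \<Longrightarrow> B \<in> relcompact_borel \<Omega> \<Longrightarrow> A \<union> B \<in> relcompact_borel \<Omega>"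
  by (auto simp: relcompact_borel_def closure_Un intro: compact_Un)

lemma locally_finite_signed_measure_empty:
  assumes "locally_finite_signed_measure \<Omega> \<nu>" shows "\<nu> {} = 0"
proof -
  have "(\<lambda>i::nat. \<nu> {}) sums \<nu> (\<Union>i::nat. {})"
    using assms unfolding locally_finite_signed_measure_def
    by (elim allE[of _ "\<lambda>i. {}"]) (auto simp: disjoint_family_on_def)
  then show ?thesis
    by (simp add: sums_iff summable_const_iff)
qed

lemma locally_finite_signed_measure_Un:
  assumes l: "locally_finite_signed_measure \<Omega> \<nu>"
    and A: "A \<in> relcompact_borel \<Omega>" and B: "B \<in> relcompact_borel \<Omega>" and d: "A \<inter> B = {}"
  shows "\<nu> (A \<union> B) = \<nu> A + \<nu> B"
proof -
  let ?E = "binaryset A B"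
  have u: "(\<Union>i. ?E i) = A \<union> B" by (rule UN_binaryset_eq)
  have r: "range ?E \<subseteq> relcompact_borel \<Omega>" using A B by (auto simp: range_binaryset_eq)
  have dj: "disjoint_family ?E" using d by (auto simp: disjoint_family_on_def binaryset_def)
  have "(\<lambda>i. \<nu> (?E i)) sums \<nu> (A \<union> B)"
    using l r dj relcompact_borel_Un[OF A B] unfolding locally_finite_signed_measure_def u[symmetric] by blast
  moreover have "(\<lambda>i. \<nu> (?E i)) sums (\<nu> A + \<nu> B)"
    by (rule binaryset_sums) (rule locally_finite_signed_measure_empty[OF l])
  ultimately show ?thesis by (rule sums_unique2)
qed

lemma emeasure_positive_part:
  assumes l: "locally_finite_signed_measure \<Omega> \<nu>" and \<Omega>: "\<Omega> \<in> sets borel"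
    and A: "A \<in> sets borel" "A \<subseteq> \<Omega>"
  shows "emeasure (positive_part \<Omega> \<nu>) A =
    (SUP B \<in> {B \<in> relcompact_borel \<Omega>. B \<subseteq> A}. ennreal (\<nu> B))"
proof -
  define \<mu> where "\<mu> = (\<lambda>A. SUP B \<in> {B \<in> relcompact_borel \<Omega>. B \<subseteq> A}. ennreal (\<nu> B))"
  let ?S = "sets (restrict_space borel \<Omega>)"
  have S: "X \<in> ?S \<longleftrightarrow> X \<in> sets borel \<and> X \<subseteq> \<Omega>" for X
    using \<Omega> by (simp add: sets_restrict_space_iff) blast
  have up: "ennreal (\<nu> B) \<le> \<mu> X" if "B \<in> relcompact_borel \<Omega>" "B \<subseteq> X" for B X
    unfolding \<mu>_def by (rule SUP_upper) (use that in auto)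
  have least: "\<mu> X \<le> c" if "\<And>B. B \<in> relcompact_borel \<Omega> \<Longrightarrow> B \<subseteq> X \<Longrightarrow> ennreal (\<nu> B) \<le> c" for X c
    unfolding \<mu>_def by (rule SUP_least) (use that in auto)
  have empty: "\<mu> {} = 0"
    by (rule antisym[OF least]) (auto simp: locally_finite_signed_measure_empty[OF l])
  have ne: "{B \<in> relcompact_borel \<Omega>. B \<subseteq> X} \<noteq> {}" for X
    using relcompact_borel_empty by blast
  have \<mu>_eq: "\<mu> X = (SUP B \<in> {B \<in> relcompact_borel \<Omega>. B \<subseteq> X}. ennreal (\<nu> B))" for X
    by (simp add: \<mu>_def)
  have super: "\<mu> X + \<mu> Y \<le> \<mu> (X \<union> Y)" if XY: "X \<inter> Y = {}" for X Y
  proof -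
    have 1: "ennreal (\<nu> B) + ennreal (\<nu> C) \<le> \<mu> (X \<union> Y)"
      if B: "B \<in> relcompact_borel \<Omega>" "B \<subseteq> X" and C: "C \<in> relcompact_borel \<Omega>" "C \<subseteq> Y" for B C
    proof (cases "\<nu> B \<ge> 0 \<and> \<nu> C \<ge> 0")
      case True
      have "\<nu> (B \<union> C) = \<nu> B + \<nu> C"
        using B C XY by (intro locally_finite_signed_measure_Un[OF l]) auto
      then have "ennreal (\<nu> B) + ennreal (\<nu> C) = ennreal (\<nu> (B \<union> C))" using True by simp
      also have "\<dots> \<le> \<mu> (X \<union> Y)" using B C by (intro up relcompact_borel_Un) auto
      finally show ?thesis .
    next
      case False
      moreover have "B \<subseteq> X \<union> Y" "C \<subseteq> X \<union> Y" using B C by auto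
      ultimately show ?thesis using up[OF B(1), of "X \<union> Y"] up[OF C(1), of "X \<union> Y"]
        by (auto simp: ennreal_neg not_le)
    qed
    have 2: "ennreal (\<nu> B) + \<mu> Y \<le> \<mu> (X \<union> Y)" if B: "B \<in> relcompact_borel \<Omega>" "B \<subseteq> X" for B
    proof -
      have "ennreal (\<nu> B) + \<mu> Y =
          (SUP C \<in> {C \<in> relcompact_borel \<Omega>. C \<subseteq> Y}. ennreal (\<nu> B) + ennreal (\<nu> C))"
        unfolding \<mu>_def by (rule ennreal_SUP_add_right) (use ne in auto)
      also have "\<dots> \<le> \<mu> (X \<union> Y)" by (rule SUP_least) (use 1[OF B] in auto)
      finally show ?thesis .
    qed
    have "\<mu> X + \<mu> Y = (SUP B \<in> {B \<in> relcompact_borel \<Omega>. B \<subseteq> X}. ennreal (\<nu> B) + \<mu> Y)"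
      unfolding \<mu>_eq[of X] by (rule ennreal_SUP_add_left[symmetric]) (use ne in auto)
    also have "\<dots> \<le> \<mu> (X \<union> Y)" by (rule SUP_least) (use 2 in auto)
    finally show ?thesis .
  qed
  have mono: "\<mu> X \<le> \<mu> Y" if "X \<subseteq> Y" for X Y
    by (rule least, rule up) (use that in auto)
  have ca: "countably_additive ?S \<mu>"
  proof (rule countably_additiveI)
    fix E :: "nat \<Rightarrow> 'a set"
    assume r: "range E \<subseteq> ?S" and d: "disjoint_family E" and "(\<Union>i. E i) \<in> ?S"
    show "(\<Sum>i. \<mu> (E i)) = \<mu> (\<Union>i. E i)"
    proof (rule antisym)
      have "(\<Sum>i<n. \<mu> (E i)) \<le> \<mu> (\<Union>i<n. E i)" for n
      proof (induction n)
        case (Suc n)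
        have "(\<Union>i<n. E i) \<inter> E n = {}"
        proof -
          have "E i \<inter> E n = {}" if "i < n" for i
            using d that by (simp add: disjoint_family_on_def)
          then show ?thesis by blast
        qed
        then have "\<mu> (\<Union>i<n. E i) + \<mu> (E n) \<le> \<mu> ((\<Union>i<n. E i) \<union> E n)" by (rule super)
        then have "(\<Sum>i<n. \<mu> (E i)) + \<mu> (E n) \<le> \<mu> ((\<Union>i<n. E i) \<union> E n)"
          by (rule order_trans[OF add_right_mono[OF Suc]])
        then show ?case by (simp add: lessThan_Suc Un_commute add.commute)
      qed (simp add: empty)
      then have "(\<Sum>i<n. \<mu> (E i)) \<le> \<mu> (\<Union>i. E i)" for n
        by (rule order_trans) (rule mono, blast)
      then show "(\<Sum>i. \<mu> (E i)) \<le> \<mu> (\<Union>i. E i)"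
        by (intro suminf_le_const) auto
    next
      show "\<mu> (\<Union>i. E i) \<le> (\<Sum>i. \<mu> (E i))"
      proof (rule least)
        fix B assume B: "B \<in> relcompact_borel \<Omega>" "B \<subseteq> (\<Union>i. E i)"
        have Bb: "B \<in> sets borel" using B by (simp add: relcompact_borel_def)
        have Eb: "E i \<in> sets borel" for i using r S by blast
        have rc: "B \<inter> E i \<in> relcompact_borel \<Omega>" for i
          by (rule relcompact_borel_subset[OF B(1)]) (use Bb Eb in auto)
        have eq: "(\<Union>i. B \<inter> E i) = B" using B by auto
        have "(\<lambda>i. \<nu> (B \<inter> E i)) sums \<nu> (\<Union>i. B \<inter> E i)"
        proof (rule l[unfolded locally_finite_signed_measure_def, rule_format], intro conjI)
          show "range (\<lambda>i. B \<inter> E i) \<subseteq> relcompact_borel \<Omega>" using rc by blast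
          show "disjoint_family (\<lambda>i. B \<inter> E i)"
            using d by (rule disjoint_family_on_bisimulation) blast
          show "(\<Union>i. B \<inter> E i) \<in> relcompact_borel \<Omega>" using B(1) by (simp only: eq)
        qed
        then have "(\<lambda>n. \<Sum>i<n. \<nu> (B \<inter> E i)) \<longlonglongrightarrow> \<nu> B" by (simp only: sums_def eq)
        then have lim: "(\<lambda>n. ennreal (\<Sum>i<n. \<nu> (B \<inter> E i))) \<longlonglongrightarrow> ennreal (\<nu> B)"
          by (rule tendsto_ennrealI)
        have "ennreal (\<Sum>i<n. \<nu> (B \<inter> E i)) \<le> (\<Sum>i. \<mu> (E i))" for n
        proof -
          have "ennreal (\<Sum>i<n. \<nu> (B \<inter> E i)) \<le> ennreal (\<Sum>i<n. max 0 (\<nu> (B \<inter> E i)))"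
            by (intro ennreal_leI sum_mono) auto
          also have "\<dots> = (\<Sum>i<n. ennreal (\<nu> (B \<inter> E i)))"
            by (subst sum_ennreal[symmetric]) (auto simp: ennreal_max_0)
          also have "\<dots> \<le> (\<Sum>i<n. \<mu> (E i))" by (intro sum_mono up rc) auto
          also have "\<dots> \<le> (\<Sum>i. \<mu> (E i))" by (rule sum_le_suminf) auto
          finally show ?thesis .
        qed
        then show "ennreal (\<nu> B) \<le> (\<Sum>i. \<mu> (E i))" by (intro LIMSEQ_le_const2[OF lim]) auto
      qed
    qed
  qed
  have "emeasure (positive_part \<Omega> \<nu>) A = \<mu> A"
    unfolding positive_part_def \<mu>_def[symmetric]
  proof (rule emeasure_measure_of_sigma)
    have "sigma_algebra (space (restrict_space borel \<Omega>)) ?S" by (rule sets.sigma_algebra_axioms)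
    then show "sigma_algebra \<Omega> ?S" by (simp add: space_restrict_space)
  qed (use empty ca A S in \<open>auto simp: positive_def\<close>)
  then show ?thesis by (simp add: \<mu>_def)
qed

subsection \<open>The distributional Laplacian\<close>

definition has_distributional_laplacian ::
    "('a::euclidean_space \<Rightarrow> real) \<Rightarrow> ('a set \<Rightarrow> real) \<Rightarrow> 'a set \<Rightarrow> bool" where
  "has_distributional_laplacian u \<nu> \<Omega> \<longleftrightarrow>
     (\<forall>\<phi>. test_function \<Omega> \<phi> \<longrightarrow>
        set_lebesgue_integral lebesgue \<Omega> (\<lambda>x. u x * laplacian \<phi> x) = signed_integral \<Omega> \<nu> \<phi>)"

end

theory Submission
  imports Defs "HOL-Real_Asymp.Real_Asymp"
begin

text \<open>The kernel \<chi> replaces the fundamental solution, which is a logarithm for N = 2 and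
  a power for N > 2. Subtracting two dilates of \<rho> of equal mass leaves a compactly supported
  potential, given by one formula in N. The equality of masses also removes constants from the
  tested equation, which is why u may be replaced by u - \<alpha>. The estimate integrated over
  B(x0,r) - {v = 0} does not close by itself: its right side contains the integral of |v| over the
  doubled ball, about whose size relative to r^(N+2) nothing is known beforehand. That integral
  carries the factor |B(x0,r) - {v = 0}| / r^N, which tends to 0. Along dyadic radii the normalised
  integrals therefore satisfy m(k+1) <= e(k) m(k) + q(k) with e and q tending to 0, and this forces
  m to tend to 0. The potential series contributes o(r^(N+2)) because the two powers of s_j give a
  factor 4^(-j), which permits dominated convergence as the volume fraction tends to 0.\<close>

text \<open>
  There are radial test functions \<open>\<chi>\<close> and \<open>\<rho> \<ge> 0\<close> supported in the unit ball with
  \<open>\<Delta>\<chi> = 2\<^sup>N \<rho>(2\<cdot>) - \<rho>\<close>. Testing the equation for \<open>v = u - \<alpha>\<close> with \<open>\<chi>((\<cdot> - x) / t)\<close> compares the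
  averages of \<open>v\<close> against \<open>\<rho>\<close> at the scales \<open>t\<close> and \<open>t/2\<close>, and summing over dyadic scales gives, at
  every Lebesgue point \<open>x\<close>,
  \<open>\<bar>v(x)\<bar> \<le> C t\<^bsup>-N\<^esup> \<integral>\<^bsub>B(x,t)\<^esub> \<bar>v\<bar> + C \<Sum>\<^sub>j s\<^sub>j\<^bsup>2-N\<^esup> \<bar>\<nu>\<bar>(B(x,s\<^sub>j))\<close> with \<open>s\<^sub>j = t/2\<^sup>j\<close>.

  Let \<open>x\<^sub>0\<close> be a density point of \<open>{v = 0}\<close> at which \<open>\<bar>\<nu>\<bar>(B(x\<^sub>0,r)) = O(r\<^sup>N)\<close>. Integrating the
  estimate over \<open>B(x\<^sub>0,r) - {v = 0}\<close>, whose volume is \<open>o(r\<^sup>N)\<close>, yields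
  \<open>\<integral>\<^bsub>B(x\<^sub>0,r)\<^esub> \<bar>v\<bar> = o(r\<^bsup>N+2\<^esup>)\<close>, hence \<open>\<integral> \<chi>((\<cdot> - x\<^sub>0) / r) d\<nu> = o(r\<^sup>N)\<close>. Take a Hahn decomposition
  \<open>P \<union> Q\<close> for \<open>\<nu>\<close>. At almost every \<open>x\<^sub>0 \<in> P\<close> the negative part of \<open>\<nu>\<close> has zero density, whereas the
  positive part, which dominates \<open>\<theta> dx\<close> on \<open>P\<close>, has positive lower density. As \<open>\<chi>\<close> has a sign, this
  is a contradiction unless \<open>P \<inter> {v = 0}\<close> is null; \<open>Q\<close> is symmetric.
\<close>

section \<open>Closure properties of smooth functions\<close>

text \<open>The smooth functions are the largest set of differentiable functions that is stable
  under partial derivatives, so one such set containing \<open>f\<close> suffices. Later smoothness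
  proofs thereby reduce to the choice of a set.\<close>

lemma smooth_coinduct:
  assumes "f \<in> S"
    and d: "\<And>f x. f \<in> S \<Longrightarrow> f differentiable at x"
    and p: "\<And>f b. f \<in> S \<Longrightarrow> b \<in> Basis \<Longrightarrow> partial_deriv b f \<in> S"
  shows "smooth f"
proof -
  have "foldr partial_deriv bs f \<in> S" if "set bs \<subseteq> Basis" for bs
    using that by (induction bs) (auto simp: assms(1) p)
  then show ?thesis by (auto simp: smooth_def d)
qed

lemma smooth_differentiable: "smooth f \<Longrightarrow> f differentiable at x"
  unfolding smooth_def by (drule spec[of _ "[]"]) simp

lemma smooth_partial_deriv:
  assumes "smooth f" "b \<in> Basis" shows "smooth (partial_deriv b f)"
  unfolding smooth_def
proof (intro allI impI)
  fix bs x assume "set bs \<subseteq> (Basis :: 'a set)"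
  then have "foldr partial_deriv (bs @ [b]) f differentiable at x"
    using assms unfolding smooth_def by (metis empty_subsetI insert_subset list.set set_append Un_least)
  then show "foldr partial_deriv bs (partial_deriv b f) differentiable at x" by simp
qed

lemma partial_deriv_eqI: "(f has_derivative f') (at x) \<Longrightarrow> partial_deriv b f x = f' b"
  by (simp add: partial_deriv_def frechet_derivative_at[symmetric])

lemma differentiable_has_derivative_partial:
  "f differentiable at x \<Longrightarrow> \<exists>f'. (f has_derivative f') (at x) \<and> (\<forall>b. partial_deriv b f x = f' b)"
  by (auto simp: differentiable_def partial_deriv_eqI)

text \<open>Derivatives of products, composites and powers are polynomials in known functions. The
  stable set for \<open>smooth_coinduct\<close> is therefore taken to be an algebra, which avoids
  formulas for higher derivatives.\<close>

inductive_set generated_algebra :: "('a::euclidean_space \<Rightarrow> real) set \<Rightarrow> ('a \<Rightarrow> real) set" for G where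
  gen: "g \<in> G \<Longrightarrow> g \<in> generated_algebra G"
| const: "(\<lambda>x. c) \<in> generated_algebra G"
| add: "f \<in> generated_algebra G \<Longrightarrow> g \<in> generated_algebra G \<Longrightarrow> (\<lambda>x. f x + g x) \<in> generated_algebra G"
| mult: "f \<in> generated_algebra G \<Longrightarrow> g \<in> generated_algebra G \<Longrightarrow> (\<lambda>x. f x * g x) \<in> generated_algebra G"

text \<open>By linearity and the Leibniz rule, stability under partial derivatives passes from the
  generators to the whole algebra.\<close>

lemma smooth_generated_algebra:
  assumes f: "f \<in> generated_algebra G"
    and d: "\<And>g x. g \<in> G \<Longrightarrow> g differentiable at x"
    and p: "\<And>g b. g \<in> G \<Longrightarrow> b \<in> Basis \<Longrightarrow> partial_deriv b g \<in> generated_algebra G"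
  shows "smooth f"
proof -
  have *: "(\<forall>x. f differentiable at x) \<and> (\<forall>b\<in>Basis. partial_deriv b f \<in> generated_algebra G)"
    if "f \<in> generated_algebra G" for f
    using that
  proof induction
    case (gen g) then show ?case using d p by auto
  next
    case (const c)
    have "partial_deriv b (\<lambda>x. c) = (\<lambda>x. 0)" for b :: 'a
      by (rule ext) (rule partial_deriv_eqI, auto)
    then show ?case by (auto intro: generated_algebra.const)
  next
    case (add f g)
    have "partial_deriv b (\<lambda>x. f x + g x) = (\<lambda>x. partial_deriv b f x + partial_deriv b g x)" for b
    proof
      fix x
      obtain f' g' where "(f has_derivative f') (at x)" "\<forall>b. partial_deriv b f x = f' b"
        "(g has_derivative g') (at x)" "\<forall>b. partial_deriv b g x = g' b"
        using add.IH differentiable_has_derivative_partial by meson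
      then show "partial_deriv b (\<lambda>x. f x + g x) x = partial_deriv b f x + partial_deriv b g x"
        using partial_deriv_eqI[OF has_derivative_add] by metis
    qed
    then show ?case using add by (auto intro: generated_algebra.add)
  next
    case (mult f g)
    have "partial_deriv b (\<lambda>x. f x * g x) = (\<lambda>x. f x * partial_deriv b g x + partial_deriv b f x * g x)" for b
    proof
      fix x
      obtain f' g' where "(f has_derivative f') (at x)" "\<forall>b. partial_deriv b f x = f' b"
        "(g has_derivative g') (at x)" "\<forall>b. partial_deriv b g x = g' b"
        using mult.IH differentiable_has_derivative_partial by meson
      then show "partial_deriv b (\<lambda>x. f x * g x) x = f x * partial_deriv b g x + partial_deriv b f x * g x"
        using partial_deriv_eqI[OF has_derivative_mult] by metis
    qed
    then show ?case using mult by (auto intro!: generated_algebra.add generated_algebra.mult)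
  qed
  show ?thesis by (rule smooth_coinduct[OF f]) (use * in auto)
qed

lemma smooth_const [simp]: "smooth (\<lambda>x. c)"
  by (rule smooth_generated_algebra[of _ "{}", OF generated_algebra.const]) auto

lemma
  assumes "smooth f" "smooth g"
  shows smooth_add: "smooth (\<lambda>x. f x + g x)" and smooth_mult: "smooth (\<lambda>x. f x * g x)"
proof -
  have G: "g \<in> generated_algebra (Collect smooth)" if "smooth g" for g :: "'a \<Rightarrow> real"
    using that by (simp add: generated_algebra.gen)
  have "smooth f" if "f \<in> generated_algebra (Collect smooth)" for f :: "'a \<Rightarrow> real"
    by (rule smooth_generated_algebra[OF that]) (auto intro: smooth_differentiable smooth_partial_deriv G)
  with assms show "smooth (\<lambda>x. f x + g x)" "smooth (\<lambda>x. f x * g x)"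
    by (blast intro: G generated_algebra.add generated_algebra.mult)+
qed

lemma deriv_eq_partial_deriv: "f differentiable at x \<Longrightarrow> partial_deriv 1 f x = deriv f (x::real)"
proof -
  assume "f differentiable at x"
  then have "(f has_derivative (\<lambda>h. deriv f x * h)) (at x)"
    using DERIV_deriv_iff_real_differentiable has_field_derivative_def by blast
  then show ?thesis using partial_deriv_eqI by fastforce
qed

lemma smooth_deriv:
  assumes "smooth (f :: real \<Rightarrow> real)" shows "smooth (deriv f)"
proof -
  have "partial_deriv 1 f = deriv f"
    using deriv_eq_partial_deriv[OF smooth_differentiable[OF assms]] by auto
  then show ?thesis using smooth_partial_deriv[OF assms, of 1] by simp
qed

lemma smooth_DERIV: "smooth f \<Longrightarrow> (f has_real_derivative deriv f x) (at x)"
  using smooth_differentiable DERIV_deriv_iff_real_differentiable by blast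

lemma smooth_continuous_on: "smooth f \<Longrightarrow> continuous_on S f"
  by (meson continuous_at_imp_continuous_on differentiable_imp_continuous_within smooth_differentiable)

text \<open>The generators are all composites of smooth functions with the fixed \<open>g\<close>,
  together with all smooth functions: the chain rule turns such a composite into a product of two
  generators.\<close>

lemma smooth_compose:
  assumes h: "smooth (h :: real \<Rightarrow> real)" and g: "smooth g"
  shows "smooth (\<lambda>x. h (g x))"
proof (rule smooth_generated_algebra[of _ "{\<lambda>x. h (g x) |h. smooth h} \<union> Collect smooth"])
  show "(\<lambda>x. h (g x)) \<in> generated_algebra ({\<lambda>x. h (g x) |h. smooth h} \<union> Collect smooth)"
    using h by (auto intro!: generated_algebra.gen)
  fix f assume f: "f \<in> {\<lambda>x. h (g x) |h. smooth h} \<union> Collect smooth"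
  have der: "((\<lambda>x. h (g x)) has_derivative (\<lambda>k. deriv h (g x) * g' k)) (at x)"
    if "smooth h" "(g has_derivative g') (at x)" for h x g'
    using has_derivative_compose[OF that(2) smooth_DERIV[OF that(1), THEN has_field_derivative_imp_has_derivative]] .
  show "f differentiable at x" for x
    using f der smooth_differentiable[OF g, of x] smooth_differentiable[of _ x]
    by (auto simp: differentiable_def)
  fix b :: 'a assume b: "b \<in> Basis"
  show "partial_deriv b f \<in> generated_algebra ({\<lambda>x. h (g x) |h. smooth h} \<union> Collect smooth)"
  proof (cases "smooth f")
    case True then show ?thesis using b by (auto intro!: generated_algebra.gen smooth_partial_deriv)
  next
    case False
    then obtain h where h: "f = (\<lambda>x. h (g x))" "smooth h" using f by auto
    have "partial_deriv b f = (\<lambda>x. deriv h (g x) * partial_deriv b g x)"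
    proof
      fix x
      obtain g' where "(g has_derivative g') (at x)" "\<forall>b. partial_deriv b g x = g' b"
        using smooth_differentiable[OF g] differentiable_has_derivative_partial by meson
      then show "partial_deriv b f x = deriv h (g x) * partial_deriv b g x"
        unfolding h(1) using partial_deriv_eqI[OF der[OF h(2)]] by metis
    qed
    moreover have "(\<lambda>x. deriv h (g x)) \<in> generated_algebra ({\<lambda>x. h (g x) |h. smooth h} \<union> Collect smooth)"
      using smooth_deriv[OF h(2)] by (auto intro!: generated_algebra.gen)
    moreover have "partial_deriv b g \<in> generated_algebra ({\<lambda>x. h (g x) |h. smooth h} \<union> Collect smooth)"
      using g b by (auto intro!: generated_algebra.gen smooth_partial_deriv)
    ultimately show ?thesis by (auto intro: generated_algebra.mult)
  qed
qed

lemma smooth_antiderivative: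
  fixes F f :: "real \<Rightarrow> real"
  assumes "smooth f" "\<And>x. (F has_real_derivative f x) (at x)"
  shows "smooth F"
proof (rule smooth_coinduct[of _ "insert F (Collect smooth)"])
  have "partial_deriv 1 F = f"
    using partial_deriv_eqI[OF assms(2)[unfolded has_field_derivative_def], of 1] by auto
  then show "partial_deriv b g \<in> insert F (Collect smooth)"
    if "g \<in> insert F (Collect smooth)" "b \<in> Basis" for g and b :: real
    using that assms(1) smooth_partial_deriv[of g b] by auto
qed (use assms smooth_differentiable in \<open>auto intro: differentiableI simp: has_field_derivative_def\<close>)

lemma DERIV_powr_pos:
  assumes "0 < (x::real)" shows "((\<lambda>x. x powr a) has_real_derivative a * x powr (a - 1)) (at x)"
  using has_real_derivative_powr[OF assms] by simp

text \<open>Differentiation lowers the exponent, so the powers of \<open>g\<close> with every real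
  exponent are generators together. The exponent -1 later gives division by a positive smooth
  function.\<close>

lemma smooth_powr:
  assumes g: "smooth g" and pos: "\<And>x. g x > 0"
  shows "smooth (\<lambda>x. g x powr a)"
proof (rule smooth_generated_algebra[of _ "{\<lambda>x. g x powr a |a. True} \<union> Collect smooth"])
  let ?G = "{\<lambda>x. g x powr a |a. True} \<union> Collect smooth"
  show "(\<lambda>x. g x powr a) \<in> generated_algebra ?G" by (auto intro!: generated_algebra.gen)
  fix f assume f: "f \<in> ?G"
  have der: "((\<lambda>x. g x powr a) has_derivative (\<lambda>k. a * g x powr (a - 1) * g' k)) (at x)"
    if "(g has_derivative g') (at x)" for a x g'
    using has_derivative_compose[OF that DERIV_powr_pos[OF pos, THEN has_field_derivative_imp_has_derivative]] .
  show "f differentiable at x" for x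
    using f der smooth_differentiable[OF g, of x] smooth_differentiable[of _ x]
    by (auto simp: differentiable_def)
  fix b :: 'a assume b: "b \<in> Basis"
  show "partial_deriv b f \<in> generated_algebra ?G"
  proof (cases "smooth f")
    case True then show ?thesis using b by (auto intro!: generated_algebra.gen smooth_partial_deriv)
  next
    case False
    then obtain a where h: "f = (\<lambda>x. g x powr a)" using f by auto
    have "partial_deriv b f = (\<lambda>x. (a * g x powr (a - 1)) * partial_deriv b g x)"
    proof
      fix x
      obtain g' where "(g has_derivative g') (at x)" "\<forall>b. partial_deriv b g x = g' b"
        using smooth_differentiable[OF g] differentiable_has_derivative_partial by meson
      then show "partial_deriv b f x = (a * g x powr (a - 1)) * partial_deriv b g x"
        unfolding h(1) using partial_deriv_eqI[OF der] by metis
    qed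
    moreover have "(\<lambda>x. g x powr (a - 1)) \<in> generated_algebra ?G"
      by (auto intro!: generated_algebra.gen)
    moreover have "partial_deriv b g \<in> generated_algebra ?G"
      using g b by (auto intro!: generated_algebra.gen smooth_partial_deriv)
    ultimately show ?thesis by (auto intro!: generated_algebra.mult generated_algebra.const)
  qed
qed

section \<open>Quadratic functions and the Laplacian of a radial function\<close>

lemma smooth_affine: "smooth (\<lambda>y. c * y + d :: real)"
proof (rule smooth_coinduct[of _ "{\<lambda>y. c * y + d |c d. True}"])
  fix f :: "real \<Rightarrow> real" assume "f \<in> {\<lambda>y. c * y + d |c d. True}"
  then obtain c d where f: "f = (\<lambda>y. c * y + d)" by auto
  have "(f has_derivative (\<lambda>h. c * h)) (at x)" for x unfolding f by (auto intro!: derivative_eq_intros)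
  then have "f differentiable at x" "partial_deriv b f = (\<lambda>y. 0 * y + c * b)" for x b
    using partial_deriv_eqI[of f "\<lambda>h. c * h"] by (auto simp: differentiable_def)
  then show "f differentiable at x" "partial_deriv b f \<in> {\<lambda>y. c * y + d |c d. True}" for x b
    by blast+
qed auto

text \<open>The stable set consists of the polynomials c |y - x|^2 + (y - x) . w + d; a derivative
  keeps this form, with c = 0.\<close>

lemma smooth_norm_square: "smooth (\<lambda>y. c * (norm (y - x))\<^sup>2)"
proof (rule smooth_coinduct[of _ "{\<lambda>y. c * ((y - x) \<bullet> (y - x)) + (y - x) \<bullet> w + d |c w d. True}"])
  let ?S = "{\<lambda>y. c * ((y - x) \<bullet> (y - x)) + (y - x) \<bullet> w + d |c w d. True}"
  fix f assume "f \<in> ?S"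
  then obtain c w d where f: "f = (\<lambda>y. c * ((y - x) \<bullet> (y - x)) + (y - x) \<bullet> w + d)" by auto
  have der: "(f has_derivative (\<lambda>h. (z - x) \<bullet> ((2 * c) *\<^sub>R h) + h \<bullet> w)) (at z)" for z
    unfolding f by (auto intro!: derivative_eq_intros simp: inner_commute algebra_simps fun_eq_iff)
  show "f differentiable at z" for z using der by (auto simp: differentiable_def)
  fix b :: 'a
  have "partial_deriv b f = (\<lambda>y. 0 * ((y - x) \<bullet> (y - x)) + (y - x) \<bullet> ((2 * c) *\<^sub>R b) + b \<bullet> w)"
    using partial_deriv_eqI[OF der] by (simp add: fun_eq_iff)
  then show "partial_deriv b f \<in> ?S" by blast
next
  show "(\<lambda>y. c * (norm (y - x))\<^sup>2) \<in> {\<lambda>y. c * ((y - x) \<bullet> (y - x)) + (y - x) \<bullet> w + d |c w d. True}"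
    unfolding power2_norm_eq_inner by (rule CollectI, rule exI[of _ c], rule exI[of _ 0], rule exI[of _ 0]) simp
qed

text \<open>For s = c |y - x|^2 one has |grad s|^2 = 4 c s, and the Laplacian of s is 2 c N; the
  formula is h''(s) |grad s|^2 plus h'(s) times that Laplacian. Using the squared norm keeps the
  kernel smooth at its centre.\<close>

lemma laplacian_radial:
  fixes h :: "real \<Rightarrow> real" and x :: "'a::euclidean_space"
  assumes h: "smooth h"
  shows "laplacian (\<lambda>y. h (c * (norm (y - x))\<^sup>2)) y =
    c * (4 * (c * (norm (y - x))\<^sup>2) * deriv (deriv h) (c * (norm (y - x))\<^sup>2)
      + 2 * DIM('a) * deriv h (c * (norm (y - x))\<^sup>2))"
proof -
  have g: "((\<lambda>y. c * (norm (y - x))\<^sup>2) has_derivative (\<lambda>k. 2 * c * ((y - x) \<bullet> k))) (at y)" for y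
    unfolding power2_norm_eq_inner
    by (auto intro!: derivative_eq_intros simp: inner_commute algebra_simps fun_eq_iff)
  have 1: "((\<lambda>y. k (c * (norm (y - x))\<^sup>2)) has_derivative
      (\<lambda>v. deriv k (c * (norm (y - x))\<^sup>2) * (2 * c * ((y - x) \<bullet> v)))) (at y)" if "smooth k" for y k
    using has_derivative_compose[OF g smooth_DERIV[OF that, THEN has_field_derivative_imp_has_derivative]] .
  have "partial_deriv b (\<lambda>y. h (c * (norm (y - x))\<^sup>2)) =
      (\<lambda>y. deriv h (c * (norm (y - x))\<^sup>2) * (2 * c * ((y - x) \<bullet> b)))" for b
    using partial_deriv_eqI[OF 1[OF h]] by (simp add: fun_eq_iff)
  moreover have "partial_deriv b (\<lambda>y. deriv h (c * (norm (y - x))\<^sup>2) * (2 * c * ((y - x) \<bullet> b))) y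
    = deriv (deriv h) (c * (norm (y - x))\<^sup>2) * (2 * c * ((y - x) \<bullet> b))\<^sup>2 + deriv h (c * (norm (y - x))\<^sup>2) * (2 * c)"
    if "b \<in> Basis" for b
  proof -
    have "((\<lambda>y. 2 * c * ((y - x) \<bullet> b)) has_derivative (\<lambda>k. 2 * c * (k \<bullet> b))) (at y)"
      by (auto intro!: derivative_eq_intros)
    from partial_deriv_eqI[OF has_derivative_mult[OF 1[OF smooth_deriv[OF h]] this], of b]
    show ?thesis using that by (simp add: power2_eq_square algebra_simps)
  qed
  ultimately have "laplacian (\<lambda>y. h (c * (norm (y - x))\<^sup>2)) y =
     (\<Sum>b\<in>Basis. deriv (deriv h) (c * (norm (y - x))\<^sup>2) * (2 * c * ((y - x) \<bullet> b))\<^sup>2 + deriv h (c * (norm (y - x))\<^sup>2) * (2 * c))"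
    unfolding laplacian_def by simp
  also have "\<dots> = deriv (deriv h) (c * (norm (y - x))\<^sup>2) * (4 * c\<^sup>2 * (\<Sum>b\<in>Basis. ((y - x) \<bullet> b)\<^sup>2))
      + DIM('a) * (deriv h (c * (norm (y - x))\<^sup>2) * (2 * c))"
    by (simp add: sum.distrib sum_distrib_left power_mult_distrib mult_ac)
  also have "(\<Sum>b\<in>Basis. ((y - x) \<bullet> b)\<^sup>2) = (norm (y - x))\<^sup>2"
    unfolding power2_norm_eq_inner by (subst euclidean_inner) (simp add: power2_eq_square)
  finally show ?thesis by (simp add: algebra_simps power2_eq_square)
qed

section \<open>The radial kernels\<close>

text \<open>The flat function exp(-1/s) with a power weight. The weights make the linear span of the
  family stable under differentiation and later absorb the singular factor s^(-N/2).\<close>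

definition flat :: "real \<Rightarrow> real \<Rightarrow> real" where
  "flat a s = (if s > 0 then s powr a * exp (- 1 / s) else 0)"

lemma flat_nonneg: "flat a s \<ge> 0" and flat_pos: "s > 0 \<Longrightarrow> flat a s > 0"
  and flat_zero: "s \<le> 0 \<Longrightarrow> flat a s = 0"
  by (auto simp: flat_def)

lemma flat_tendsto_0: "(flat a \<longlongrightarrow> 0) (at 0)"
proof -
  have "((\<lambda>h. h powr a * exp (- 1 / h)) \<longlongrightarrow> 0) (at_right 0)"
    by real_asymp
  then have "(flat a \<longlongrightarrow> 0) (at_right 0)"
    by (rule Lim_transform_eventually) (auto simp: flat_def eventually_at_filter)
  moreover have "(flat a \<longlongrightarrow> 0) (at_left 0)"
    by (rule Lim_transform_eventually[OF tendsto_const]) (auto simp: flat_def eventually_at_filter)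
  ultimately show ?thesis by (simp add: filterlim_split_at)
qed

lemma flat_divide: "s \<noteq> 0 \<Longrightarrow> flat a s / s = flat (a - 1) s"
  by (simp add: flat_def powr_diff)

lemma DERIV_flat: "(flat a has_real_derivative a * flat (a - 1) s + flat (a - 2) s) (at s)"
proof (cases s "0 :: real" rule: linorder_cases)
  case less
  have "((\<lambda>s. 0) has_real_derivative 0) (at s)" by simp
  from has_field_derivative_transform_within_open[OF this open_lessThan, of 0 "flat a"] less
  show ?thesis by (simp add: flat_zero)
next
  case equal
  \<comment> \<open>Since \<open>flat a 0 = 0\<close>, the difference quotient at 0 is
    \<open>flat (a - 1) h\<close>; the claimed derivative at 0 is 0 as well.\<close>
  have "((\<lambda>h. flat (a - 1) h) \<longlongrightarrow> 0) (at 0)" by (rule flat_tendsto_0)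
  then have "((\<lambda>h. (flat a (0 + h) - flat a 0) / h) \<longlongrightarrow> 0) (at 0)"
    by (rule Lim_transform_eventually)
       (auto simp: eventually_at_filter flat_divide flat_zero[of 0])
  then show ?thesis using equal by (simp add: DERIV_def flat_zero)
next
  case greater
  have "((\<lambda>s. s powr a * exp (- 1 / s)) has_real_derivative
      s powr a * (exp (- 1 / s) * (1 / s\<^sup>2)) + a * s powr (a - 1) * exp (- 1 / s)) (at s)"
    using greater by (auto intro!: derivative_eq_intros DERIV_powr_pos simp: power2_eq_square)
  from has_field_derivative_transform_within_open[OF this open_greaterThan, of 0 "flat a"] greater
  show ?thesis by (simp add: flat_def powr_diff power2_eq_square field_simps)
qed

lemma smooth_flat: "smooth (flat a)"
proof (rule smooth_generated_algebra[of _ "range flat"])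
  fix f and b x :: real assume "f \<in> range flat" 
  then obtain a where f: "f = flat a" by auto
  show "f differentiable at x" using DERIV_flat f real_differentiable_def by blast
  assume "b \<in> Basis"
  then have "partial_deriv b f = (\<lambda>s. a * flat (a - 1) s + flat (a - 2) s)"
    unfolding f using partial_deriv_eqI[OF DERIV_flat[unfolded has_field_derivative_def], of b] by auto
  then show "partial_deriv b f \<in> generated_algebra (range flat)"
    by (auto intro!: generated_algebra.add generated_algebra.mult generated_algebra.const
          generated_algebra.gen[OF rangeI])
qed (auto intro: generated_algebra.gen)

lemma smooth_scale: "smooth f \<Longrightarrow> smooth (\<lambda>s. c * f s)"
  by (intro smooth_mult smooth_const)

lemma smooth_1D_antiderivative:
  fixes q :: "real \<Rightarrow> real" assumes q: "smooth q"
  obtains F where "smooth F" "\<And>x. (F has_real_derivative q x) (at x)"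
proof -
  have "isCont q x" for x
    using differentiable_imp_continuous_within[OF smooth_differentiable[OF q]] .
  then have "\<exists>F. \<forall>x. - \<infinity> < ereal x \<longrightarrow> ereal x < \<infinity> \<longrightarrow> (F has_vector_derivative q x) (at x)"
    by (intro einterval_antiderivative) auto
  then obtain F where F: "\<And>x. (F has_real_derivative q x) (at x)"
    by (auto simp: has_real_derivative_iff_has_vector_derivative)
  then show ?thesis using that smooth_antiderivative[OF q] by blast
qed

text \<open>
  The two profiles come from a function \<open>m\<close> which vanishes on the negative axis and equals
  \<open>s\<^bsup>-N/2\<^esup>\<close> for \<open>s \<ge> 1\<close>: then \<open>h' = (2\<^sup>N m(4s) - m(s)) / 4\<close> and
  \<open>p = s m' + (N/2) m\<close>. As \<open>s = \<bar>x\<bar>\<^sup>2\<close>, the antiderivative of \<open>m\<close> is the fundamental solution away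
  from the unit ball.
\<close>

lemma radial_profiles:
  fixes N :: nat assumes N: "N > 0"
  obtains h p :: "real \<Rightarrow> real" where
    "smooth h" "continuous_on UNIV p"
    "\<And>s. 4 * s * deriv (deriv h) s + 2 * N * deriv h s = 2 ^ N * p (4 * s) - p s"
    "\<And>s. s \<ge> 1 \<Longrightarrow> h s = 0" "\<And>s. h s \<le> 0" "h 0 < 0"
    "\<And>s. s \<ge> 1 \<Longrightarrow> p s = 0" "\<And>s. p s \<ge> 0" "\<And>s. 0 < s \<Longrightarrow> s < 1 \<Longrightarrow> p s > 0"
proof -
  \<comment> \<open>\<open>s\<close> and \<open>1 - s\<close> are never both nonpositive, so
    \<open>D\<close> is positive and \<open>\<sigma>\<close> below is a smooth step, 0 for s <= 0
    and 1 for s >= 1. On the positive axis \<open>m\<close> is s^(-N/2) times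
    \<open>\<sigma>\<close>, the singular factor being hidden in the index of
    \<open>flat\<close>.\<close>
  define D where "D s = flat 0 s + flat 0 (1 - s)" for s
  have D_pos: "D s > 0" for s
    by (cases "s > 0") (auto simp: D_def add_pos_nonneg add_nonneg_pos flat_pos flat_nonneg)
  have D_smooth: "smooth D"
    unfolding D_def using smooth_compose[OF smooth_flat smooth_affine[of "-1" 1], of 0]
    by (intro smooth_add smooth_flat) simp
  define D' where "D' s = flat (-2) s - flat (-2) (1 - s)" for s
  have D_der: "(D has_real_derivative D' s) (at s)" for s
    unfolding D_def D'_def
    by (rule derivative_eq_intros DERIV_flat DERIV_chain'[where g = "flat 0"] refl)+ simp
  define \<sigma> where "\<sigma> s = flat 0 s / D s" for s
  define m where "m s = flat (- N / 2) s / D s" for s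
  define m' where "m' = deriv m"
  have m_smooth: "smooth m"
  proof -
    have "m = (\<lambda>s. flat (- N / 2) s * D s powr (-1))"
      using D_pos by (simp add: fun_eq_iff m_def powr_minus_divide less_imp_le)
    then show ?thesis using smooth_mult[OF smooth_flat smooth_powr[OF D_smooth D_pos, of "-1"]] by simp
  qed
  have m'_smooth: "smooth m'" unfolding m'_def by (rule smooth_deriv[OF m_smooth])
  have m_der: "(m has_real_derivative m' s) (at s)" for s
    unfolding m'_def by (rule smooth_DERIV[OF m_smooth])
  have m'_eq: "m' s = ((- N / 2) * flat (- N / 2 - 1) s + flat (- N / 2 - 2) s) / D s
      - flat (- N / 2) s * D' s / (D s)\<^sup>2" for s
  proof -
    have "(m has_real_derivative ((- N / 2) * flat (- N / 2 - 1) s + flat (- N / 2 - 2) s) / D s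
      - flat (- N / 2) s * D' s / (D s)\<^sup>2) (at s)"
      unfolding m_def using D_pos[of s]
      by (auto intro!: derivative_eq_intros DERIV_flat D_der simp: power2_eq_square field_simps)
    then show ?thesis by (rule DERIV_unique[OF m_der])
  qed
  define p where "p s = s * m' s + N / 2 * m s" for s
  have flat_mult: "s * flat (a - 1) s = flat a s" for a s
    by (cases "s = 0") (auto simp: flat_divide[symmetric] flat_zero)
  \<comment> \<open>On the positive axis this is s^(1 - N/2) times the derivative of
    \<open>\<sigma>\<close>. The terms with the factor N/2 cancel, and what remains shows the
    support, the sign and the positivity of \<open>p\<close> at a glance.\<close>
  have p_eq: "p s = s * (flat (- N / 2 - 2) s * flat 0 (1 - s) + flat (- N / 2) s * flat (-2) (1 - s)) / (D s)\<^sup>2" for s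
  proof -
    have "p s = s * (flat (- N / 2 - 2) s * D s - flat (- N / 2) s * D' s) / (D s)\<^sup>2"
    proof -
      have *: "s * (((- k) * x + y) / d - z * d' / d\<^sup>2) + k * (z / d) = s * (y * d - z * d') / d\<^sup>2"
        if "d > 0" "s * x = z" for k x y z d d' :: real
        using that(1) by (simp add: that(2)[symmetric] divide_simps power2_eq_square) algebra
      show ?thesis
        using *[of "D s" "flat (- N / 2 - 1) s" "flat (- N / 2) s" "N / 2" "flat (- N / 2 - 2) s" "D' s"]
          D_pos[of s] flat_mult[of s "- N / 2"]
        unfolding p_def m'_eq m_def by simp
    qed
    also have "flat (- N / 2 - 2) s * flat 0 s = flat (- N / 2) s * flat (-2) s"
    proof -
      have "flat (a + c) s * flat b s = flat a s * flat (b + c) s" for a b c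
        by (simp add: flat_def powr_add)
      from this[of "- N / 2" "- 2" 0] show ?thesis by simp
    qed
    then have "flat (- N / 2 - 2) s * D s - flat (- N / 2) s * D' s
      = flat (- N / 2 - 2) s * flat 0 (1 - s) + flat (- N / 2) s * flat (-2) (1 - s)"
      by (simp add: D_def D'_def algebra_simps)
    finally show ?thesis .
  qed
  have m_eq: "m s = s powr (- N / 2) * \<sigma> s" if "s > 0" for s
    using that by (simp add: m_def \<sigma>_def flat_def)
  have \<sigma>_mono: "\<sigma> s < \<sigma> t" if "0 < s" "s < 1" "s < t" for s t
  proof -
    have "flat 0 (1 - t) \<le> flat 0 (1 - s)" "flat 0 s < flat 0 t"
      using that by (auto simp: flat_def frac_le divide_strict_left_mono)
    moreover have "flat 0 s > 0" "flat 0 t > 0" "flat 0 (1 - s) > 0" using that by (auto intro: flat_pos)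
    ultimately have "flat 0 s * flat 0 (1 - t) < flat 0 t * flat 0 (1 - s)"
      by (meson flat_nonneg less_imp_le mult_le_less_imp_less order_le_less_trans mult_left_mono mult_strict_right_mono)
    then have "flat 0 s * D t < flat 0 t * D s" by (simp add: D_def algebra_simps)
    then show ?thesis using D_pos[of s] D_pos[of t] by (simp add: \<sigma>_def field_simps)
  qed
  have \<sigma>_1: "\<sigma> s = 1" if "s \<ge> 1" for s
    using that D_pos[of s] by (auto simp: \<sigma>_def D_def flat_def)
  define q where "q s = (2 ^ N * m (4 * s) - m s) / 4" for s
  have q_smooth: "smooth q"
  proof -
    have "smooth (\<lambda>s. m (4 * s))" using smooth_compose[OF m_smooth smooth_affine[of 4 0]] by simp
    then have "smooth (\<lambda>s. (2 ^ N / 4) * m (4 * s) + (- 1 / 4) * m s)"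
      by (intro smooth_add smooth_scale m_smooth)
    then show ?thesis unfolding q_def by (simp add: diff_divide_distrib)
  qed
  \<comment> \<open>The factor 2^N cancels the 4^(-N/2) of the dilation, so \<open>q\<close> is a
    weighted increment of the step \<open>\<sigma>\<close>: positive on (0,1) and zero from 1 on,
    where both values of \<open>\<sigma>\<close> are 1.\<close>
  have q_eq: "q s = s powr (- N / 2) * (\<sigma> (4 * s) - \<sigma> s) / 4" if "s > 0" for s
  proof -
    have "(4::real) powr (- N / 2) = 2 powr (2 * (- N / 2))"
      unfolding powr_powr[symmetric] by simp
    also have "\<dots> = 1 / 2 ^ N" by (simp add: powr_minus_divide powr_realpow)
    finally have "2 ^ N * (4 * s) powr (- N / 2) = s powr (- N / 2)"
      using that by (simp add: powr_mult)
    then have "2 ^ N * m (4 * s) = s powr (- N / 2) * \<sigma> (4 * s)"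
      using that by (simp add: m_eq mult.assoc[symmetric])
    then show ?thesis using that unfolding q_def by (simp add: m_eq right_diff_distrib)
  qed
  have q_pos: "q s > 0" if "0 < s" "s < 1" for s
    using that \<sigma>_mono[of s "4 * s"] by (simp add: q_eq)
  have q_0: "q s = 0" if "s \<ge> 1" for s
    using that by (simp add: q_eq \<sigma>_1)
  have q_neg: "q s = 0" if "s \<le> 0" for s
    using that by (simp add: q_def m_def flat_zero)
  have q_nonneg: "q s \<ge> 0" for s
    using q_pos[of s] q_0[of s] q_neg[of s] by (cases "s \<le> 0"; cases "s \<ge> 1") auto
  obtain F where F: "smooth F" "\<And>x. (F has_real_derivative q x) (at x)"
    using smooth_1D_antiderivative[OF q_smooth] by blast
  \<comment> \<open>The constant makes \<open>h\<close> vanish at 1, and hence beyond 1, where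
    \<open>q\<close> is zero. As \<open>q\<close> is nonnegative, \<open>h\<close> is nondecreasing
    and therefore nonpositive.\<close>
  define h where "h s = F s + - F 1" for s
  have h_smooth: "smooth h" unfolding h_def by (intro smooth_add F smooth_const)
  have h_der: "(h has_real_derivative q x) (at x)" for x
    unfolding h_def using F(2)[of x] by (auto intro!: derivative_eq_intros)
  have h1: "h 1 = 0" by (simp add: h_def)
  have h_mono: "h s \<le> h t" if "s \<le> t" for s t
    using DERIV_nonneg_imp_nondecreasing[OF that] h_der q_nonneg by blast
  have h_ge: "h s = 0" if "s \<ge> 1" for s
  proof (cases "s = 1")
    case False
    then have "1 < s" using that by simp
    then obtain z where "1 < z" "h s - h 1 = (s - 1) * q z"
      using MVT2[OF _ h_der] by metis
    then show ?thesis using q_0[of z] h1 by simp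
  qed (use h1 in simp)
  have h_le: "h s \<le> 0" for s using h_mono[of s 1] h_ge[of s] h1 by (cases "s \<le> 1") auto
  have h_0: "h 0 < 0"
  proof -
    obtain z where "0 < z" "z < 1" "h 1 - h 0 = (1 - 0) * q z"
      using MVT2[OF zero_less_one h_der] by metis
    then show ?thesis using q_pos[of z] h1 by simp
  qed
  have deriv_h: "deriv h = q" using DERIV_imp_deriv[OF h_der] by auto
  have "(q has_real_derivative (2 ^ N * (m' (4 * s) * 4) - m' s) / 4) (at s)" for s
    unfolding q_def
    by (auto intro!: derivative_eq_intros m_der DERIV_chain'[where g = m])
  then have deriv_q: "deriv q s = (2 ^ N * (m' (4 * s) * 4) - m' s) / 4" for s
    using DERIV_imp_deriv by blast
  show ?thesis
  proof (rule that[of h p])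
    show "continuous_on UNIV p" unfolding p_def
      by (intro continuous_intros smooth_continuous_on m_smooth m'_smooth)
    \<comment> \<open>The operator s d/ds + N/2 takes \<open>m\<close> to \<open>p\<close> and turns
      m(4s) into p(4s); here it is applied to 4 q(s) = 2^N m(4s) - m(s).\<close>
    show "4 * s * deriv (deriv h) s + 2 * N * deriv h s = 2 ^ N * p (4 * s) - p s" for s
      unfolding deriv_h deriv_q by (simp add: q_def p_def field_simps)
    show "p s = 0" if "s \<ge> 1" for s using that by (simp add: p_eq flat_zero)
    show "p s \<ge> 0" for s
    proof (cases "s \<le> 0")
      case False
      then show ?thesis unfolding p_eq
        by (intro divide_nonneg_nonneg mult_nonneg_nonneg add_nonneg_nonneg flat_nonneg) auto
    qed (simp add: p_eq flat_zero)
    show "p s > 0" if "0 < s" "s < 1" for s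
      unfolding p_eq using that D_pos[of s]
      by (intro divide_pos_pos mult_pos_pos add_pos_pos flat_pos) auto
  qed (use h_smooth h_ge h_le h_0 in auto)
qed

section \<open>Densities and Lebesgue points\<close>

text \<open>Each point of \<open>A\<close> is the centre of a ball inside \<open>U\<close> of mass
  at least c r^N. Vitali's lemma extracts disjoint balls whose fivefold enlargements cover
  \<open>A\<close>; each enlargement has volume at most the stated constant times the mass of its
  ball, and by disjointness these masses sum to at most that of \<open>U\<close>. The cover
  \<open>T\<close> stands in for \<open>A\<close>, which may be nonmeasurable.\<close>

lemma Vitali_measure_bound:
  fixes M :: "'a::euclidean_space measure"
  assumes M: "sets M = sets borel" "finite_measure M"
    and U: "open U" "A \<subseteq> U" and c: "c > 0"
    and A: "\<And>x d. x \<in> A \<Longrightarrow> d > 0 \<Longrightarrow> \<exists>r>0. r < d \<and> c * r ^ DIM('a) \<le> measure M (cball x r)"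
  shows "\<exists>T\<in>lmeasurable. A \<subseteq> T \<and>
    measure lebesgue T \<le> unit_ball_vol DIM('a) * 5 ^ DIM('a) / c * measure M U"
proof -
  interpret finite_measure M by (rule M)
  have "\<exists>r. 0 < r \<and> r \<le> 1 \<and> cball x r \<subseteq> U \<and> c * r ^ DIM('a) \<le> measure M (cball x r)" if "x \<in> A" for x
  proof -
    obtain e where e: "e > 0" "cball x e \<subseteq> U"
      using U \<open>x \<in> A\<close> open_contains_cball by blast
    obtain r where "r > 0" "r < min e 1" "c * r ^ DIM('a) \<le> measure M (cball x r)"
      using A[OF \<open>x \<in> A\<close>, of "min e 1"] e by auto
    moreover have "cball x r \<subseteq> cball x e" using calculation by (intro subset_cball) auto
    ultimately show ?thesis using e by (intro exI[of _ r]) auto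
  qed
  then obtain r where r: "\<And>x. x \<in> A \<Longrightarrow> 0 < r x \<and> r x \<le> 1"
    "\<And>x. x \<in> A \<Longrightarrow> cball x (r x) \<subseteq> U"
    "\<And>x. x \<in> A \<Longrightarrow> c * r x ^ DIM('a) \<le> measure M (cball x (r x))"
    by metis
  have "A \<subseteq> (\<Union>i\<in>A. cball i (r i))" using r(1) by (auto intro!: bexI simp: less_imp_le)
  from Vitali_covering_lemma_cballs[OF this r(1)] obtain C where C: "countable C" "C \<subseteq> A"
    "pairwise (\<lambda>i j. disjnt (cball i (r i)) (cball j (r j))) C" "A \<subseteq> (\<Union>i\<in>C. cball i (5 * r i))"
    by blast
  let ?k = "unit_ball_vol DIM('a) * 5 ^ DIM('a) / c"
  have k: "?k \<ge> 0" using c by simp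
  have bound: "measure lebesgue (\<Union>i\<in>I. cball i (5 * r i)) \<le> ?k * measure M U" if I: "I \<subseteq> C" "finite I" for I
  proof -
    have rp: "r i > 0" if "i \<in> I" for i using r(1) that I C(2) by blast
    have "measure lebesgue (\<Union>i\<in>I. cball i (5 * r i)) \<le> (\<Sum>i\<in>I. measure lebesgue (cball i (5 * r i)))"
      by (rule measure_UNION_le) (use I in auto)
    also have "\<dots> = (\<Sum>i\<in>I. ?k * (c * r i ^ DIM('a)))"
      using rp c by (intro sum.cong refl) (auto simp: content_cball power_mult_distrib less_imp_le)
    also have "\<dots> \<le> (\<Sum>i\<in>I. ?k * measure M (cball i (r i)))"
      using r(3) I C(2) k by (intro sum_mono mult_left_mono) auto
    also have "\<dots> = ?k * measure M (\<Union>i\<in>I. cball i (r i))"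
    proof -
      have "disjoint_family_on (\<lambda>i. cball i (r i)) I"
        using I C(3) by (fastforce simp: disjoint_family_on_def pairwise_def disjnt_def simp del: mem_cball)
      then have "measure M (\<Union>i\<in>I. cball i (r i)) = (\<Sum>i\<in>I. measure M (cball i (r i)))"
        using I M(1) by (intro finite_measure_finite_Union) auto
      then show ?thesis by (simp add: sum_distrib_left)
    qed
    also have "\<dots> \<le> ?k * measure M U"
      using r(2) I C(2) k M(1) U(1) by (intro mult_left_mono finite_measure_mono) auto
    finally show ?thesis .
  qed
  show ?thesis
  proof (intro bexI conjI)
    show "measure lebesgue (\<Union>i\<in>C. cball i (5 * r i)) \<le> ?k * measure M U"
      by (rule measure_UN_bound[OF C(1) _ bound]) auto
    show "(\<Union>i\<in>C. cball i (5 * r i)) \<in> lmeasurable"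
      by (rule fmeasurable_UN_bound[OF C(1) _ bound]) auto
  qed (rule C(4))
qed

text \<open>Where the ratio reaches 1/(n+1) at arbitrarily small radii, the Vitali bound gives outer
  volume at most a multiple of \<open>measure M U\<close> for any open U containing
  \<open>A\<close>, and outer regularity makes this arbitrarily small. Applied to Lebesgue measure
  off a set, the lemma yields density points of that set.\<close>

lemma negligible_upper_density:
  fixes M :: "'a::euclidean_space measure"
  assumes M: "sets M = sets borel" "finite_measure M"
    and A: "A \<in> sets borel" "measure M A = 0"
  shows "negligible {x \<in> A. \<not> ((\<lambda>r. measure M (cball x r) / r ^ DIM('a)) \<longlongrightarrow> 0) (at_right 0)}"
proof -
  interpret finite_measure M by (rule M)
  define B where "B n = {x \<in> A. \<forall>d>0. \<exists>r>0. r < d \<and> 1 / Suc n * r ^ DIM('a) \<le> measure M (cball x r)}" for n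
  have "negligible (B n)" for n
    unfolding negligible_outer_le
  proof (intro allI impI)
    fix e :: real assume e: "e > 0"
    define k where "k = unit_ball_vol DIM('a) * 5 ^ DIM('a) / (1 / Suc n)"
    have k: "k > 0" by (simp add: k_def)
    have "emeasure M A = (INF U \<in> {U. A \<subseteq> U \<and> open U}. emeasure M U)"
      by (rule outer_regular) (use M(1) A emeasure_finite in auto)
    moreover have "emeasure M A < ennreal (e / k)"
      using A e k by (simp add: emeasure_eq_measure)
    ultimately obtain U where U: "A \<subseteq> U" "open U" "emeasure M U < ennreal (e / k)"
      by (auto simp: INF_less_iff)
    then have "measure M U < e / k" using e k by (simp add: emeasure_eq_measure ennreal_less_iff)
    then have "k * measure M U \<le> e" using k by (simp add: field_simps)
    moreover have "\<exists>T\<in>lmeasurable. B n \<subseteq> T \<and> measure lebesgue T \<le> k * measure M U"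
      unfolding k_def by (rule Vitali_measure_bound[OF M U(2)]) (use U(1) in \<open>auto simp: B_def\<close>)
    ultimately show "\<exists>T. B n \<subseteq> T \<and> T \<in> lmeasurable \<and> measure lebesgue T \<le> e"
      by (meson order_trans)
  qed
  then have "negligible (\<Union>n. B n)" by (intro negligible_countable_Union) auto
  moreover have "{x \<in> A. \<not> ((\<lambda>r. measure M (cball x r) / r ^ DIM('a)) \<longlongrightarrow> 0) (at_right 0)} \<subseteq> (\<Union>n. B n)"
  proof clarify
    fix x assume x: "x \<in> A" "\<not> ((\<lambda>r. measure M (cball x r) / r ^ DIM('a)) \<longlongrightarrow> 0) (at_right 0)"
    then obtain e where e: "e > 0" "\<not> (\<forall>\<^sub>F r in at_right 0. measure M (cball x r) / r ^ DIM('a) < e)"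
      unfolding tendsto_iff by (force simp: eventually_at_filter elim: eventually_mono)
    obtain n where n: "1 / Suc n < e" using e(1) nat_approx_posE by metis
    have "\<exists>r>0. r < d \<and> 1 / Suc n * r ^ DIM('a) \<le> measure M (cball x r)" if "d > 0" for d
    proof (rule ccontr)
      assume "\<not> ?thesis"
      then have "measure M (cball x r) < e * r ^ DIM('a)" if "0 < r" "r < d" for r
        using that n by (smt (verit) mult_strict_right_mono zero_less_power)
      then have "\<forall>\<^sub>F r in at_right 0. measure M (cball x r) / r ^ DIM('a) < e"
        using \<open>d > 0\<close> by (auto simp: eventually_at_right_field divide_less_eq intro!: exI[of _ d])
      with e(2) show False by blast
    qed
    then show "x \<in> (\<Union>n. B n)" using x by (auto simp: B_def)
  qed
  ultimately show ?thesis by (rule negligible_subset)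
qed

lemma negligible_infinite_density:
  fixes M :: "'a::euclidean_space measure"
  assumes M: "sets M = sets borel" "finite_measure M"
  shows "negligible {x. \<nexists>C. \<forall>\<^sub>F r in at_right 0. measure M (cball x r) \<le> C * r ^ DIM('a)}" (is "negligible ?B")
  unfolding negligible_outer_le
proof (intro allI impI)
  fix e :: real assume e: "e > 0"
  \<comment> \<open>Chosen so that the Vitali bound with U = \<open>UNIV\<close> is at most
    \<open>e\<close>; the summand 1 keeps \<open>k\<close> positive when \<open>M\<close> is
    zero.\<close>
  define k where "k = unit_ball_vol DIM('a) * 5 ^ DIM('a) * measure M UNIV / e + 1"
  have k: "k > 0" using e by (simp add: k_def add_nonneg_pos)
  have "\<exists>T\<in>lmeasurable. ?B \<subseteq> T \<and> measure lebesgue T \<le> unit_ball_vol DIM('a) * 5 ^ DIM('a) / k * measure M UNIV"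
  proof (rule Vitali_measure_bound[OF M open_UNIV _ k])
    fix x and d :: real assume x: "x \<in> ?B" and d: "d > 0"
    show "\<exists>r>0. r < d \<and> k * r ^ DIM('a) \<le> measure M (cball x r)"
    proof (rule ccontr)
      assume "\<not> ?thesis"
      then have "\<forall>\<^sub>F r in at_right 0. measure M (cball x r) \<le> k * r ^ DIM('a)"
        using d by (auto simp: eventually_at_right_field not_le intro!: exI[of _ d] less_imp_le)
      with x show False by blast
    qed
  qed simp
  moreover have "unit_ball_vol DIM('a) * 5 ^ DIM('a) / k * measure M UNIV \<le> e"
    using k e by (simp add: divide_le_eq) (simp add: k_def field_simps)
  ultimately show "\<exists>T. ?B \<subseteq> T \<and> T \<in> lmeasurable \<and> measure lebesgue T \<le> e"
    by (meson order_trans)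
qed

text \<open>The measure with density max(0, v - a) on the ball gives no mass to {v <= a}, so
  \<open>negligible_upper_density\<close> applies to it. This is one side of Lebesgue
  differentiation at a fixed level.\<close>

lemma negligible_excess:
  fixes v :: "'a::euclidean_space \<Rightarrow> real"
  assumes v: "integrable lborel v"
  shows "negligible {x \<in> ball z R. v x \<le> a \<and>
    \<not> ((\<lambda>r. (LINT y:cball x r|lborel. max 0 (v y - a)) / r ^ DIM('a)) \<longlongrightarrow> 0) (at_right 0)}"
proof -
  have [measurable]: "v \<in> borel_measurable borel" using borel_measurable_integrable[OF v] by simp
  \<comment> \<open>The cut-off to the ball keeps \<open>w\<close> integrable when \<open>a\<close>
    is negative.\<close>
  define w where "w y = indicator (ball z R) y * max 0 (v y - a)" for y
  have [measurable]: "w \<in> borel_measurable borel"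
    unfolding w_def
    by (intro borel_measurable_times borel_measurable_indicator borel_measurable_max
        borel_measurable_diff borel_measurable_const) auto
  have w_int: "integrable lborel w"
  proof (rule Bochner_Integration.integrable_bound)
    show "integrable lborel (\<lambda>y. \<bar>v y\<bar> + indicator (ball z R) y * \<bar>a\<bar>)"
      using v by (intro Bochner_Integration.integrable_add integrable_abs integrable_mult_left
          integrable_real_indicator emeasure_lborel_ball_finite) auto
  qed (auto simp: w_def split: split_indicator)
  have w0: "w y \<ge> 0" for y by (simp add: w_def)
  define M where "M = density lborel (\<lambda>y. ennreal (w y))"
  have em: "emeasure M S = ennreal (LINT y:S|lborel. w y)" if "S \<in> sets borel" for S
  proof -
    have "emeasure M S = (\<integral>\<^sup>+y. ennreal (w y * indicator S y) \<partial>lborel)"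
      using that unfolding M_def by (subst emeasure_density) (auto intro!: nn_integral_cong split: split_indicator)
    also have "\<dots> = ennreal (\<integral>y. w y * indicator S y \<partial>lborel)"
      using integrable_mult_indicator[OF _ w_int, of S] that w0
      by (intro nn_integral_eq_integral) (auto simp: mult.commute)
    finally show ?thesis by (simp add: set_lebesgue_integral_def mult.commute)
  qed
  have S0: "(LINT y:S|lborel. w y) \<ge> 0" for S
    by (auto simp: set_lebesgue_integral_def w0 intro!: integral_nonneg_AE)
  have meas: "measure M S = (LINT y:S|lborel. w y)" if "S \<in> sets borel" for S
    using em[OF that] S0 by (simp add: measure_def)
  have M: "sets M = sets borel" "finite_measure M"
    using em[of UNIV] by (auto simp: M_def intro!: finite_measureI)
  let ?A = "{x \<in> ball z R. v x \<le> a}"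
  have "measure M ?A = 0"
    by (subst meas) (auto simp: set_lebesgue_integral_def w_def intro!: integral_eq_zero_AE split: split_indicator)
  then have "negligible {x \<in> ?A. \<not> ((\<lambda>r. measure M (cball x r) / r ^ DIM('a)) \<longlongrightarrow> 0) (at_right 0)}"
    by (intro negligible_upper_density[OF M]) auto
  moreover have "((\<lambda>r. (LINT y:cball x r|lborel. max 0 (v y - a)) / r ^ DIM('a)) \<longlongrightarrow> 0) (at_right 0)"
    if x: "x \<in> ball z R" and "((\<lambda>r. measure M (cball x r) / r ^ DIM('a)) \<longlongrightarrow> 0) (at_right 0)" for x
    using that(2)
  proof (rule Lim_transform_eventually)
    obtain e where e: "e > 0" "cball x e \<subseteq> ball z R"
      using x open_contains_cball[of "ball z R"] by (auto simp del: mem_ball)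
    have "measure M (cball x r) = (LINT y:cball x r|lborel. max 0 (v y - a))" if "r < e" for r
    proof -
      have "cball x r \<subseteq> ball z R" using e subset_cball[of r e x] that by auto
      then show ?thesis unfolding meas[OF borel_closed[OF closed_cball]]
        by (intro set_lebesgue_integral_cong) (auto simp: w_def)
    qed
    then show "\<forall>\<^sub>F r in at_right 0. measure M (cball x r) / r ^ DIM('a) =
        (LINT y:cball x r|lborel. max 0 (v y - a)) / r ^ DIM('a)"
      using e(1) by (auto simp: eventually_at_right_field intro!: exI[of _ e])
  qed
  ultimately show ?thesis by (elim negligible_subset) blast
qed

text \<open>For rational levels a < v x < b within d of v x, |v y - v x| is at most max(0, v y - b)
  + max(0, a - v y) + 2 d. Both excess terms are handled by \<open>negligible_excess\<close>, and
  countably many levels leave a null set.\<close>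

lemma negligible_non_Lebesgue_points:
  fixes v :: "'a::euclidean_space \<Rightarrow> real"
  assumes v: "integrable lborel v"
  shows "negligible {x \<in> ball z R.
    \<not> ((\<lambda>r. (LINT y:cball x r|lborel. \<bar>v y - v x\<bar>) / r ^ DIM('a)) \<longlongrightarrow> 0) (at_right 0)}"
proof -
  define X where "X a = {x \<in> ball z R. v x \<le> a \<and>
    \<not> ((\<lambda>r. (LINT y:cball x r|lborel. max 0 (v y - a)) / r ^ DIM('a)) \<longlongrightarrow> 0) (at_right 0)}" for a
  define Y where "Y a = {x \<in> ball z R. - v x \<le> - a \<and>
    \<not> ((\<lambda>r. (LINT y:cball x r|lborel. max 0 (- v y - (- a))) / r ^ DIM('a)) \<longlongrightarrow> 0) (at_right 0)}" for a
  have "negligible (X a)" "negligible (Y a)" for a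
    unfolding X_def Y_def by (rule negligible_excess; simp add: v)+
  then have "negligible (\<Union>a\<in>\<rat>. X a \<union> Y a)"
    by (intro negligible_countable_Union) (auto intro: countable_rat)
  moreover have "((\<lambda>r. (LINT y:cball x r|lborel. \<bar>v y - v x\<bar>) / r ^ DIM('a)) \<longlongrightarrow> 0) (at_right 0)"
    if x: "x \<in> ball z R" "x \<notin> (\<Union>a\<in>\<rat>. X a \<union> Y a)" for x
    unfolding tendsto_iff
  proof (intro allI impI)
    fix e :: real assume e: "e > 0"
    define V where "V = unit_ball_vol DIM('a)"
    have V: "V > 0" by (simp add: V_def)
    \<comment> \<open>Each excess term will contribute at most d r^N and the constant 2 d
      contributes 2 d V r^N; this choice keeps the sum below e r^N.\<close>
    define d where "d = e / (3 + 3 * V)"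
    have d: "d > 0" "3 * d * V + 2 * d < e"
    proof -
      show "d > 0" using e V by (simp add: d_def)
      have "d * (3 + 3 * V) = e" using V by (simp add: d_def)
      with \<open>d > 0\<close> show "3 * d * V + 2 * d < e" by (simp add: algebra_simps)
    qed
    obtain a b where ab: "a \<in> \<rat>" "b \<in> \<rat>" "v x - d < a" "a < v x" "v x < b" "b < v x + d"
      using Rats_dense_in_real[of "v x - d" "v x"] Rats_dense_in_real[of "v x" "v x + d"] d(1) by auto
    have 1: "((\<lambda>r. (LINT y:cball x r|lborel. max 0 (v y - b)) / r ^ DIM('a)) \<longlongrightarrow> 0) (at_right 0)"
      "((\<lambda>r. (LINT y:cball x r|lborel. max 0 (a - v y)) / r ^ DIM('a)) \<longlongrightarrow> 0) (at_right 0)"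
      using x ab by (auto simp: X_def Y_def)
    have "\<forall>\<^sub>F r in at_right 0. (LINT y:cball x r|lborel. max 0 (v y - b)) / r ^ DIM('a) < d"
      "\<forall>\<^sub>F r in at_right 0. (LINT y:cball x r|lborel. max 0 (a - v y)) / r ^ DIM('a) < d"
      using 1 d(1) by (auto intro: order_tendstoD)
    then show "\<forall>\<^sub>F r in at_right 0. dist ((LINT y:cball x r|lborel. \<bar>v y - v x\<bar>) / r ^ DIM('a)) 0 < e"
      using eventually_at_right_less[of 0]
    proof eventually_elim
      case (elim r)
      have [measurable]: "v \<in> borel_measurable borel" using borel_measurable_integrable[OF v] by simp
      have si: "set_integrable lborel (cball x r) (\<lambda>y. v y)"
        unfolding set_integrable_def using v by (intro integrable_mult_indicator) auto
      have sc: "set_integrable lborel (cball x r) (\<lambda>y. c)" for c :: real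
        unfolding set_integrable_def
        by (simp add: integrable_real_indicator[OF _ emeasure_lborel_cball_finite])
      have sd: "set_integrable lborel (cball x r) (\<lambda>y. v y - c)" "set_integrable lborel (cball x r) (\<lambda>y. c - v y)" for c
        using set_integral_diff(1)[OF si sc] set_integral_diff(1)[OF sc si] by auto
      have sm: "set_integrable lborel S (\<lambda>y. max 0 (f y))" if "set_integrable lborel S f" for S :: "'a set" and f :: "'a \<Rightarrow> real"
      proof -
        have "(\<lambda>y. indicator S y *\<^sub>R max 0 (f y)) = (\<lambda>y. max 0 (indicator S y *\<^sub>R f y))"
          by (auto split: split_indicator)
        then show ?thesis using that unfolding set_integrable_def by simp
      qed
      have ss: "set_integrable lborel (cball x r) (\<lambda>y. max 0 (v y - b))"
        "set_integrable lborel (cball x r) (\<lambda>y. max 0 (a - v y))"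
        by (intro sm sd)+
      have sa: "set_integrable lborel (cball x r) (\<lambda>y. \<bar>v y - v x\<bar>)"
        by (rule set_integrable_abs[OF sd(1)])
      have "(LINT y:cball x r|lborel. \<bar>v y - v x\<bar>) \<le>
        (LINT y:cball x r|lborel. (max 0 (v y - b) + max 0 (a - v y)) + 2 * d)"
        using ab by (intro set_integral_mono sa set_integral_add sc ss) auto
      also have "\<dots> = (LINT y:cball x r|lborel. max 0 (v y - b)) + (LINT y:cball x r|lborel. max 0 (a - v y))
          + 2 * d * (V * r ^ DIM('a))"
      proof -
        have "(LINT y:cball x r|lborel. 2 * d) = 2 * d * (V * r ^ DIM('a))"
          using elim(3) by (simp add: set_lebesgue_integral_def content_cball V_def)
        then show ?thesis
          using set_integral_add(2)[OF set_integral_add(1)[OF ss] sc[of "2 * d"]] set_integral_add(2)[OF ss]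
          by simp
      qed
      also have "\<dots> \<le> d * r ^ DIM('a) + d * r ^ DIM('a) + 2 * d * (V * r ^ DIM('a))"
        using elim by (intro add_mono less_imp_le) (auto simp: divide_less_eq)
      also have "\<dots> = (2 * d * V + 2 * d) * r ^ DIM('a)" by (simp add: algebra_simps)
      also have "\<dots> < e * r ^ DIM('a)"
      proof -
        have "d * V > 0" using d V by simp
        then have "2 * d * V + 2 * d < e" using d(2) by linarith
        then show ?thesis using elim by (intro mult_strict_right_mono) auto
      qed
      finally have "(LINT y:cball x r|lborel. \<bar>v y - v x\<bar>) < e * r ^ DIM('a)" .
      moreover have "(LINT y:cball x r|lborel. \<bar>v y - v x\<bar>) \<ge> 0"
        by (auto simp: set_lebesgue_integral_def intro!: integral_nonneg_AE)
      ultimately show ?case using elim by (simp add: dist_real_def divide_less_eq)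
    qed
  qed
  ultimately show ?thesis by (elim negligible_subset) blast
qed

section \<open>Dyadic potential estimates\<close>

lemma lborel_integral_affine:
  fixes f :: "'a::euclidean_space \<Rightarrow> real"
  assumes [measurable]: "f \<in> borel_measurable borel" and t: "t > 0"
  shows "(\<integral>y. f y \<partial>lborel) = t ^ DIM('a) * (\<integral>y. f (x + t *\<^sub>R y) \<partial>lborel)"
proof -
  have "(\<integral>y. f y \<partial>lborel) = (\<integral>y. f y \<partial>density (distr lborel borel (\<lambda>y. x + t *\<^sub>R y)) (\<lambda>_. ennreal (\<bar>t\<bar> ^ DIM('a))))"
    using lborel_affine[of t x] t by (simp add: ennreal_power)
  also have "\<dots> = (\<integral>y. \<bar>t\<bar> ^ DIM('a) *\<^sub>R f y \<partial>distr lborel borel (\<lambda>y. x + t *\<^sub>R y))"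
    by (subst integral_density) auto
  also have "\<dots> = (\<integral>y. \<bar>t\<bar> ^ DIM('a) *\<^sub>R f (x + t *\<^sub>R y) \<partial>lborel)"
    by (subst integral_distr) auto
  finally show ?thesis using t by simp
qed

lemma filterlim_dyadic:
  fixes t :: real assumes "t > 0"
  shows "filterlim (\<lambda>n. t / 2 ^ n) (at_right 0) sequentially"
proof -
  have "(\<lambda>n. t * (1 / 2) ^ n) \<longlonglongrightarrow> t * 0" by (intro tendsto_intros LIMSEQ_power_zero) auto
  then show ?thesis using assms by (auto simp: filterlim_at power_one_over)
qed

lemma telescope_abs_le:
  fixes f :: "nat \<Rightarrow> real"
  assumes "\<And>j. \<bar>f (Suc j) - f j\<bar> \<le> g j"
  shows "\<bar>f n\<bar> \<le> \<bar>f 0\<bar> + (\<Sum>j<n. g j)"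
proof (induction n)
  case (Suc n)
  then show ?case using assms[of n] by simp
qed simp

text \<open>\<open>h\<close> and \<open>p\<close> are profiles in the squared radius: the kernel
  with centre \<open>x\<close> and scale \<open>t\<close> is
  \<open>p ((norm (y - x) / t)\<^sup>2)\<close>, which vanishes outside the closed ball of radius
  \<open>t\<close>.\<close>

locale radial_kernels =
  fixes h p :: "real \<Rightarrow> real" and Ch Cp :: real
  assumes h_cont: "continuous_on UNIV h" and p_cont: "continuous_on UNIV p"
    and h_bound: "\<And>s. s \<ge> 0 \<Longrightarrow> \<bar>h s\<bar> \<le> Ch" and p_bound: "\<And>s. s \<ge> 0 \<Longrightarrow> \<bar>p s\<bar> \<le> Cp"
    and h_supp: "\<And>s. s \<ge> 1 \<Longrightarrow> h s = 0" and p_supp: "\<And>s. s \<ge> 1 \<Longrightarrow> p s = 0"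
    and p_nonneg: "\<And>s. p s \<ge> 0" and p_pos: "\<And>s. 0 < s \<Longrightarrow> s < 1 \<Longrightarrow> p s > 0"
begin

lemma h_meas [measurable]: "h \<in> borel_measurable borel" and p_meas [measurable]: "p \<in> borel_measurable borel"
  using h_cont p_cont by (auto intro: borel_measurable_continuous_onI)

lemma Ch_nonneg: "Ch \<ge> 0" and Cp_nonneg: "Cp \<ge> 0"
  using h_bound[of 0] p_bound[of 0] by auto

lemma supp: "t > 0 \<Longrightarrow> y \<notin> cball x t \<Longrightarrow> (norm (y - x) / t)\<^sup>2 \<ge> 1"
  by (simp add: dist_norm norm_minus_commute one_le_power le_divide_eq)

lemma p_kernel_le: "t > 0 \<Longrightarrow> \<bar>p ((norm (y - x) / t)\<^sup>2)\<bar> \<le> Cp * indicator (cball x t) y"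
  using p_bound[of "(norm (y - x) / t)\<^sup>2"] p_supp[OF supp, of t y x] by (auto split: split_indicator)

lemma h_kernel_le: "t > 0 \<Longrightarrow> \<bar>h ((norm (y - x) / t)\<^sup>2)\<bar> \<le> Ch * indicator (cball x t) y"
  using h_bound[of "(norm (y - x) / t)\<^sup>2"] h_supp[OF supp, of t y x] by (auto split: split_indicator)

lemma integrable_indicator_cball: "integrable lborel (\<lambda>y :: 'a::euclidean_space. c * indicator (cball x t) y :: real)"
  by (intro integrable_mult_right integrable_real_indicator emeasure_lborel_cball_finite) auto

lemma integrable_p_kernel:
  fixes x :: "'a::euclidean_space"
  assumes t: "t > 0" shows "integrable lborel (\<lambda>y. p ((norm (y - x) / t)\<^sup>2))"
  by (rule Bochner_Integration.integrable_bound[OF integrable_indicator_cball[of Cp x t]])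
     (use p_kernel_le[OF t] in \<open>auto simp: Cp_nonneg\<close>)

lemma integrable_h_kernel:
  fixes x :: "'a::euclidean_space"
  assumes M: "sets M = sets borel" "finite_measure M"
  shows "integrable M (\<lambda>y. h ((norm (y - x) / t)\<^sup>2))"
proof (rule finite_measure.integrable_const_bound[OF M(2), of _ Ch])
  show "(\<lambda>y. h ((norm (y - x) / t)\<^sup>2)) \<in> borel_measurable M"
    unfolding measurable_cong_sets[OF M(1) refl] by measurable
qed (auto intro!: h_bound)

lemma integral_h_kernel_le:
  fixes x :: "'a::euclidean_space"
  assumes M: "sets M = sets borel" "finite_measure M" and t: "t > 0"
  shows "\<bar>\<integral>y. h ((norm (y - x) / t)\<^sup>2) \<partial>M\<bar> \<le> Ch * measure M (cball x t)"
proof -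
  interpret finite_measure M by (rule M)
  have "\<bar>\<integral>y. h ((norm (y - x) / t)\<^sup>2) \<partial>M\<bar> \<le> (\<integral>y. \<bar>h ((norm (y - x) / t)\<^sup>2)\<bar> \<partial>M)"
    by (rule integral_abs_bound)
  also have "\<dots> \<le> (\<integral>y. Ch * indicator (cball x t) y \<partial>M)"
    using M(1) h_kernel_le[OF t]
    by (intro integral_mono integrable_abs integrable_h_kernel[OF M] integrable_mult_right integrable_real_indicator)
      (auto simp: emeasure_finite less_top[symmetric])
  also have "\<dots> = Ch * measure M (cball x t)" using M(1) by simp
  finally show ?thesis .
qed

lemma integral_p_kernel:
  fixes x :: "'a::euclidean_space"
  assumes t: "t > 0"
  shows "(\<integral>y. p ((norm (y - x) / t)\<^sup>2) \<partial>lborel) = t ^ DIM('a) * (\<integral>y. p ((norm (y :: 'a))\<^sup>2) \<partial>lborel)"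
  using t by (subst lborel_integral_affine[OF _ t, of _ x]) auto

end

text \<open>\<open>v\<close> stands for u - \<alpha> cut off to the closed ball, \<open>M1\<close>
  and \<open>M2\<close> for the two Hahn parts of \<nu> there, and \<open>laplace\<close> for the
  equation tested with the \<open>h\<close> kernel and multiplied by t^2. The axioms are symmetric
  under v -> -v together with an exchange of \<open>M1\<close> and \<open>M2\<close>.\<close>

locale local_laplacian = radial_kernels h p Ch Cp for h p Ch Cp +
  fixes v :: "'a::euclidean_space \<Rightarrow> real" and M1 M2 :: "'a measure" and z :: 'a and R :: real
  assumes v_int: "integrable lborel v"
    and M1: "sets M1 = sets borel" "finite_measure M1"
    and M2: "sets M2 = sets borel" "finite_measure M2"
    and laplace: "\<And>x t. t > 0 \<Longrightarrow> cball x t \<subseteq> cball z R \<Longrightarrow>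
      (\<integral>y. v y * (2 ^ DIM('a) * p (4 * (norm (y - x) / t)\<^sup>2) - p ((norm (y - x) / t)\<^sup>2)) \<partial>lborel) =
      t\<^sup>2 * ((\<integral>y. h ((norm (y - x) / t)\<^sup>2) \<partial>M1) - (\<integral>y. h ((norm (y - x) / t)\<^sup>2) \<partial>M2))"
begin


sublocale M1: finite_measure M1 by (rule M1)
sublocale M2: finite_measure M2 by (rule M2)

definition mu :: "'a set \<Rightarrow> real" where "mu S = measure M1 S + measure M2 S"

text \<open>With this normalisation \<open>W x t\<close> is \<open>kappa * c\<close> whenever
  \<open>v\<close> equals a constant \<open>c\<close> on the ball of radius \<open>t\<close>,
  whatever the scale.\<close>

definition W :: "'a \<Rightarrow> real \<Rightarrow> real" where
  "W x t = (\<integral>y. v y * p ((norm (y - x) / t)\<^sup>2) \<partial>lborel) / t ^ DIM('a)"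

definition kappa :: real where "kappa = (\<integral>y. p ((norm (y :: 'a))\<^sup>2) \<partial>lborel)"

definition Phi :: "'a \<Rightarrow> real \<Rightarrow> real" where "Phi x t = (LINT y:cball x t|lborel. \<bar>v y\<bar>)"

lemma v_meas [measurable]: "v \<in> borel_measurable borel"
  using borel_measurable_integrable[OF v_int] by simp

lemma integrable_v_p: "integrable lborel (\<lambda>y. v y * p ((norm (y - x) / t)\<^sup>2))"
proof (rule Bochner_Integration.integrable_bound)
  show "integrable lborel (\<lambda>y. v y * Cp)" using v_int by simp
qed (auto simp: abs_mult Cp_nonneg intro!: mult_left_mono p_bound)

lemma laplace_difference:
  assumes t: "t > 0" "cball x t \<subseteq> cball z R"
  shows "2 ^ DIM('a) * (\<integral>y. v y * p ((norm (y - x) / (t / 2))\<^sup>2) \<partial>lborel) - (\<integral>y. v y * p ((norm (y - x) / t)\<^sup>2) \<partial>lborel)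
    = t\<^sup>2 * ((\<integral>y. h ((norm (y - x) / t)\<^sup>2) \<partial>M1) - (\<integral>y. h ((norm (y - x) / t)\<^sup>2) \<partial>M2))"
proof -
  have half: "(norm (y - x) / (t / 2))\<^sup>2 = 4 * (norm (y - x) / t)\<^sup>2" for y
    by (simp add: power_divide power_mult_distrib)
  have i4: "integrable lborel (\<lambda>y. v y * p (4 * (norm (y - x) / t)\<^sup>2))"
    using integrable_v_p[of x "t / 2"] unfolding half .
  have "2 ^ DIM('a) * (\<integral>y. v y * p (4 * (norm (y - x) / t)\<^sup>2) \<partial>lborel) - (\<integral>y. v y * p ((norm (y - x) / t)\<^sup>2) \<partial>lborel)
     = (\<integral>y. 2 ^ DIM('a) * (v y * p (4 * (norm (y - x) / t)\<^sup>2)) - v y * p ((norm (y - x) / t)\<^sup>2) \<partial>lborel)"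
    using i4 integrable_v_p by simp
  also have "\<dots> = (\<integral>y. v y * (2 ^ DIM('a) * p (4 * (norm (y - x) / t)\<^sup>2) - p ((norm (y - x) / t)\<^sup>2)) \<partial>lborel)"
    by (rule Bochner_Integration.integral_cong) (auto simp: algebra_simps)
  also note laplace[OF t]
  finally show ?thesis unfolding half .
qed

text \<open>After division by t^N the factor 2^N becomes the normalisation at scale t/2, so two
  consecutive dyadic averages differ by one tested charge.\<close>

lemma W_half:
  assumes t: "t > 0" "cball x t \<subseteq> cball z R"
  shows "\<bar>W x (t / 2) - W x t\<bar> \<le> Ch * t\<^sup>2 / t ^ DIM('a) * mu (cball x t)"
proof -
  have "W x (t / 2) - W x t =
      (2 ^ DIM('a) * (\<integral>y. v y * p ((norm (y - x) / (t / 2))\<^sup>2) \<partial>lborel) - (\<integral>y. v y * p ((norm (y - x) / t)\<^sup>2) \<partial>lborel)) / t ^ DIM('a)"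
    unfolding W_def power_divide[of t 2] by (simp add: diff_divide_distrib)
  then have eq: "W x (t / 2) - W x t =
      t\<^sup>2 / t ^ DIM('a) * ((\<integral>y. h ((norm (y - x) / t)\<^sup>2) \<partial>M1) - (\<integral>y. h ((norm (y - x) / t)\<^sup>2) \<partial>M2))"
    unfolding laplace_difference[OF t] by simp
  have "\<bar>(\<integral>y. h ((norm (y - x) / t)\<^sup>2) \<partial>M1) - (\<integral>y. h ((norm (y - x) / t)\<^sup>2) \<partial>M2)\<bar> \<le> Ch * mu (cball x t)"
    using integral_h_kernel_le[OF M1 t(1), of x] integral_h_kernel_le[OF M2 t(1), of x]
    unfolding mu_def distrib_left by linarith
  then have "t\<^sup>2 / t ^ DIM('a) * \<bar>(\<integral>y. h ((norm (y - x) / t)\<^sup>2) \<partial>M1) - (\<integral>y. h ((norm (y - x) / t)\<^sup>2) \<partial>M2)\<bar>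
      \<le> t\<^sup>2 / t ^ DIM('a) * (Ch * mu (cball x t))"
    using t by (intro mult_left_mono) auto
  then show ?thesis unfolding eq using t by (simp add: abs_mult mult_ac)
qed

lemma v_p_le:
  assumes t: "t > 0"
  shows "\<bar>\<integral>y. v y * p ((norm (y - x) / t)\<^sup>2) \<partial>lborel\<bar> \<le> Cp * Phi x t"
proof -
  have "\<bar>\<integral>y. v y * p ((norm (y - x) / t)\<^sup>2) \<partial>lborel\<bar> \<le> (\<integral>y. \<bar>v y * p ((norm (y - x) / t)\<^sup>2)\<bar> \<partial>lborel)"
    by (rule integral_abs_bound)
  also have "\<dots> \<le> (\<integral>y. Cp * (indicator (cball x t) y *\<^sub>R \<bar>v y\<bar>) \<partial>lborel)"
  proof (intro integral_mono integrable_abs integrable_v_p integrable_mult_right integrable_mult_indicator v_int)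
    show "\<bar>v y * p ((norm (y - x) / t)\<^sup>2)\<bar> \<le> Cp * (indicator (cball x t) y *\<^sub>R \<bar>v y\<bar>)" for y
      using mult_left_mono[OF p_kernel_le[OF t, of y x], of "\<bar>v y\<bar>"] by (simp add: abs_mult mult_ac)
  qed simp
  also have "\<dots> = Cp * Phi x t" by (simp add: Phi_def set_lebesgue_integral_def)
  finally show ?thesis .
qed

lemma W_le: "t > 0 \<Longrightarrow> \<bar>W x t\<bar> \<le> Cp / t ^ DIM('a) * Phi x t"
  using v_p_le[of t x] by (simp add: W_def divide_right_mono)

lemma kappa_pos: "kappa > 0"
proof -
  have int: "integrable lborel (\<lambda>y. p ((norm (y :: 'a))\<^sup>2))"
    using integrable_p_kernel[of 1 0] by simp
  have "kappa \<ge> 0" unfolding kappa_def by (intro integral_nonneg_AE) (auto simp: p_nonneg)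
  moreover have "kappa \<noteq> 0"
  proof
    assume "kappa = 0"
    then have "AE y :: 'a in lborel. p ((norm y)\<^sup>2) = 0"
      unfolding kappa_def using int by (subst (asm) integral_nonneg_eq_0_iff_AE) (auto simp: p_nonneg)
    then have "AE y :: 'a in lborel. y \<notin> ball 0 1"
      using AE_lborel_singleton[of 0]
    proof eventually_elim
      case (elim y)
      then show ?case using p_pos[of "(norm y)\<^sup>2"] by (auto simp: power_less_one_iff)
    qed
    then have "ball 0 1 \<in> null_sets (lborel :: 'a measure)"
      by (subst (asm) AE_iff_null_sets[symmetric]) auto
    then have "measure lborel (ball 0 1 :: 'a set) = 0" by (simp add: null_sets_def measure_def)
    then show False by (simp del: content_ball_eq_0_iff add: content_ball_eq_0_iff[where 'a='a])
  qed
  ultimately show ?thesis by linarith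
qed

lemma W_tendsto:
  assumes leb: "((\<lambda>r. (LINT y:cball x r|lborel. \<bar>v y - v x\<bar>) / r ^ DIM('a)) \<longlongrightarrow> 0) (at_right 0)"
  shows "((\<lambda>t. W x t) \<longlongrightarrow> kappa * v x) (at_right 0)"
proof -
  have "\<forall>\<^sub>F t in at_right 0. norm (W x t - kappa * v x) \<le> Cp * ((LINT y:cball x t|lborel. \<bar>v y - v x\<bar>) / t ^ DIM('a))"
    using eventually_at_right_less[of 0]
  proof eventually_elim
    case (elim t)
    have "W x t - kappa * v x = ((\<integral>y. v y * p ((norm (y - x) / t)\<^sup>2) \<partial>lborel) - v x * (\<integral>y. p ((norm (y - x) / t)\<^sup>2) \<partial>lborel)) / t ^ DIM('a)"
      using elim by (simp add: W_def integral_p_kernel kappa_def diff_divide_distrib)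
    also have "(\<integral>y. v y * p ((norm (y - x) / t)\<^sup>2) \<partial>lborel) - v x * (\<integral>y. p ((norm (y - x) / t)\<^sup>2) \<partial>lborel)
      = (\<integral>y. v y * p ((norm (y - x) / t)\<^sup>2) - v x * p ((norm (y - x) / t)\<^sup>2) \<partial>lborel)"
      using integrable_v_p integrable_p_kernel[OF elim, of x] by simp
    finally have eq: "\<bar>W x t - kappa * v x\<bar> =
        \<bar>\<integral>y. v y * p ((norm (y - x) / t)\<^sup>2) - v x * p ((norm (y - x) / t)\<^sup>2) \<partial>lborel\<bar> / t ^ DIM('a)"
      using elim by simp
    have "\<bar>\<integral>y. v y * p ((norm (y - x) / t)\<^sup>2) - v x * p ((norm (y - x) / t)\<^sup>2) \<partial>lborel\<bar>
      \<le> (\<integral>y. \<bar>v y * p ((norm (y - x) / t)\<^sup>2) - v x * p ((norm (y - x) / t)\<^sup>2)\<bar> \<partial>lborel)"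
      by (rule integral_abs_bound)
    also have "\<dots> \<le> (\<integral>y. Cp * (indicator (cball x t) y *\<^sub>R \<bar>v y - v x\<bar>) \<partial>lborel)"
    proof (intro integral_mono integrable_abs Bochner_Integration.integrable_diff integrable_v_p integrable_mult_right
        integrable_p_kernel[OF elim])
      have "integrable lborel (\<lambda>y. \<bar>indicator (cball x t) y *\<^sub>R v y - v x * indicator (cball x t) y\<bar>)"
        by (intro integrable_abs Bochner_Integration.integrable_diff integrable_mult_indicator v_int integrable_indicator_cball) auto
      also have "(\<lambda>y. \<bar>indicator (cball x t) y *\<^sub>R v y - v x * indicator (cball x t) y\<bar>) = (\<lambda>y. indicator (cball x t) y *\<^sub>R \<bar>v y - v x\<bar>)"
        by (auto split: split_indicator)
      finally show "integrable lborel (\<lambda>y. indicator (cball x t) y *\<^sub>R \<bar>v y - v x\<bar>)" .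
      show "\<bar>v y * p ((norm (y - x) / t)\<^sup>2) - v x * p ((norm (y - x) / t)\<^sup>2)\<bar> \<le> Cp * (indicator (cball x t) y *\<^sub>R \<bar>v y - v x\<bar>)" for y
        using mult_left_mono[OF p_kernel_le[OF elim, of y x], of "\<bar>v y - v x\<bar>"]
        by (simp add: abs_mult[symmetric] left_diff_distrib mult_ac)
    qed
    also have "\<dots> = Cp * (LINT y:cball x t|lborel. \<bar>v y - v x\<bar>)" by (simp add: set_lebesgue_integral_def)
    finally show ?case unfolding real_norm_def eq using elim by (simp add: divide_right_mono)
  qed
  moreover have "((\<lambda>t. Cp * ((LINT y:cball x t|lborel. \<bar>v y - v x\<bar>) / t ^ DIM('a))) \<longlongrightarrow> 0) (at_right 0)"
    using tendsto_mult_left[OF leb, of Cp] by simp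
  ultimately have "((\<lambda>t. W x t - kappa * v x) \<longlongrightarrow> 0) (at_right 0)" by (rule Lim_null_comparison)
  then show ?thesis by (simp add: LIM_zero_iff)
qed

text \<open>Telescoping \<open>W_half\<close> over the scales t/2^j bounds every
  \<open>W x (t / 2 ^ n)\<close>, and the limit in n is \<open>kappa * v x\<close>. The values are
  in \<open>ennreal\<close> because the series, a dyadic potential of the total variation, may
  diverge at individual points.\<close>

lemma pointwise_estimate:
  assumes leb: "((\<lambda>r. (LINT y:cball x r|lborel. \<bar>v y - v x\<bar>) / r ^ DIM('a)) \<longlongrightarrow> 0) (at_right 0)"
    and t: "t > 0" "cball x t \<subseteq> cball z R"
  shows "ennreal (kappa * \<bar>v x\<bar>) \<le> ennreal (Cp / t ^ DIM('a) * Phi x t) +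
    (\<Sum>j. ennreal (Ch * (t / 2 ^ j)\<^sup>2 / (t / 2 ^ j) ^ DIM('a) * mu (cball x (t / 2 ^ j))))"
proof -
  let ?g = "\<lambda>j. Ch * (t / 2 ^ j)\<^sup>2 / (t / 2 ^ j) ^ DIM('a) * mu (cball x (t / 2 ^ j))"
  have g0: "?g j \<ge> 0" for j using t Ch_nonneg by (simp add: mu_def)
  have "\<bar>W x (t / 2 ^ Suc j) - W x (t / 2 ^ j)\<bar> \<le> ?g j" for j
  proof -
    have "cball x (t / 2 ^ j) \<subseteq> cball z R"
      using t by (intro order_trans[OF subset_cball t(2)]) (simp add: divide_le_eq)
    from W_half[OF _ this] t show ?thesis by (simp add: mult_ac)
  qed
  then have "\<bar>W x (t / 2 ^ n)\<bar> \<le> \<bar>W x t\<bar> + (\<Sum>j<n. ?g j)" for n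
    using telescope_abs_le[of "\<lambda>j. W x (t / 2 ^ j)" ?g n] by simp
  then have *: "ennreal \<bar>W x (t / 2 ^ n)\<bar> \<le> ennreal (Cp / t ^ DIM('a) * Phi x t) + (\<Sum>j. ennreal (?g j))" for n
  proof -
    have "\<bar>W x (t / 2 ^ n)\<bar> \<le> Cp / t ^ DIM('a) * Phi x t + (\<Sum>j<n. ?g j)"
      using \<open>\<bar>W x (t / 2 ^ n)\<bar> \<le> \<bar>W x t\<bar> + (\<Sum>j<n. ?g j)\<close> W_le[OF t(1), of x] by linarith
    then have "ennreal \<bar>W x (t / 2 ^ n)\<bar> \<le> ennreal (Cp / t ^ DIM('a) * Phi x t) + ennreal (\<Sum>j<n. ?g j)"
      using g0 W_le[OF t(1), of x] by (subst ennreal_plus[symmetric]) (auto intro!: sum_nonneg ennreal_leI order_trans[OF abs_ge_zero W_le[OF t(1)]])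
    also have "ennreal (\<Sum>j<n. ?g j) = (\<Sum>j<n. ennreal (?g j))"
      by (subst sum_ennreal) (use g0 in auto)
    also have "\<dots> \<le> (\<Sum>j. ennreal (?g j))" by (rule sum_le_suminf) auto
    finally show ?thesis by (simp add: add_left_mono)
  qed
  from filterlim_compose[OF W_tendsto[OF leb] filterlim_dyadic[OF t(1)]]
  have "(\<lambda>n. ennreal \<bar>W x (t / 2 ^ n)\<bar>) \<longlonglongrightarrow> ennreal \<bar>kappa * v x\<bar>"
    by (intro tendsto_ennrealI tendsto_rabs)
  from LIMSEQ_le_const2[OF this] * have "ennreal \<bar>kappa * v x\<bar> \<le> ennreal (Cp / t ^ DIM('a) * Phi x t) + (\<Sum>j. ennreal (?g j))"
    by blast
  then show ?thesis using kappa_pos by (simp add: abs_mult)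
qed

end

section \<open>Integrating the masses of small balls over a set\<close>

lemma dist_pair_measurable:
  fixes M :: "'a::euclidean_space measure"
  assumes M: "sets M = sets borel" and A: "A \<in> sets borel"
  shows "(\<lambda>(x, y). indicator A x * indicator (cball x s) y :: ennreal) \<in> borel_measurable (lborel \<Otimes>\<^sub>M M)"
proof -
  have sets: "sets (lborel \<Otimes>\<^sub>M M) = sets (borel \<Otimes>\<^sub>M borel)"
    by (rule sets_pair_measure_cong) (simp_all add: M)
  have "(\<lambda>q. indicator A (fst q) * indicator {q. dist (fst q) (snd q) \<le> s} q :: ennreal) \<in> borel_measurable (borel \<Otimes>\<^sub>M borel)"
  proof (intro borel_measurable_times_ennreal)
    show "(\<lambda>q. indicator A (fst q) :: ennreal) \<in> borel_measurable (borel \<Otimes>\<^sub>M borel)"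
      using A by measurable
    have "closed {q :: 'a \<times> 'a. dist (fst q) (snd q) \<le> s}"
      by (intro closed_Collect_le continuous_intros)
    then show "(\<lambda>q. indicator {q. dist (fst q) (snd q) \<le> s} q :: ennreal) \<in> borel_measurable (borel \<Otimes>\<^sub>M (borel :: 'a measure))"
      unfolding borel_prod by (intro borel_measurable_indicator borel_closed)
  qed
  moreover have "(\<lambda>(x, y). indicator A x * indicator (cball x s) y :: ennreal)
      = (\<lambda>q. indicator A (fst q) * indicator {q. dist (fst q) (snd q) \<le> s} q)"
    by (auto simp: fun_eq_iff indicator_def)
  ultimately show ?thesis unfolding measurable_cong_sets[OF sets refl] by simp
qed

lemma measurable_measure_cball:
  fixes M :: "'a::euclidean_space measure"
  assumes M: "sets M = sets borel" "finite_measure M"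
  shows "(\<lambda>x. measure M (cball x s)) \<in> borel_measurable borel"
proof -
  interpret finite_measure M by (rule M)
  have "(\<lambda>x. \<integral>\<^sup>+y. indicator UNIV x * indicator (cball x s) y \<partial>M) \<in> borel_measurable lborel"
    using borel_measurable_nn_integral_fst[OF dist_pair_measurable[OF M(1), of UNIV s]] by simp
  then have "(\<lambda>x. emeasure M (cball x s)) \<in> borel_measurable borel"
    using M(1) by simp
  then show ?thesis unfolding measure_def by measurable
qed

lemma fmeasurable_cball_lborel: "cball x r \<in> fmeasurable lborel"
  using emeasure_lborel_cball_finite by (intro fmeasurableI) auto

lemma fmeasurable_subset_cball: "A \<in> sets borel \<Longrightarrow> A \<subseteq> cball x r \<Longrightarrow> A \<in> fmeasurable lborel"
  by (rule fmeasurableI2[OF fmeasurable_cball_lborel]) auto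

text \<open>By Tonelli the left side is the integral of |A \<inter> B(y,s)| against
  \<open>M\<close>. This volume is at most |A| and at most that of a ball of radius s, and it
  vanishes unless y lies within r + s <= 2 r of x0.\<close>

lemma nn_integral_measure_cball_le:
  fixes M :: "'a::euclidean_space measure"
  assumes M: "sets M = sets borel" "finite_measure M"
    and A: "A \<in> sets borel" "A \<subseteq> cball x0 r" and s: "0 < s" "s \<le> r"
  shows "(\<integral>\<^sup>+x\<in>A. ennreal (measure M (cball x s)) \<partial>lborel) \<le>
    ennreal (min (measure lborel A) (unit_ball_vol DIM('a) * s ^ DIM('a)) * measure M (cball x0 (2 * r)))"
proof -
  interpret finite_measure M by (rule M)
  interpret P: pair_sigma_finite lborel M by standard
  let ?m = "min (measure lborel A) (unit_ball_vol DIM('a) * s ^ DIM('a))"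
  have m0: "?m \<ge> 0" using s by simp
  have Afin: "A \<in> fmeasurable lborel"
    using A by (rule fmeasurable_subset_cball)
  have "(\<integral>\<^sup>+x\<in>A. ennreal (measure M (cball x s)) \<partial>lborel) =
      (\<integral>\<^sup>+x. \<integral>\<^sup>+y. indicator A x * indicator (cball x s) y \<partial>M \<partial>lborel)"
  proof (rule nn_integral_cong)
    fix x
    have "(\<integral>\<^sup>+y. indicator A x * indicator (cball x s) y \<partial>M) = indicator A x * emeasure M (cball x s)"
      using M(1) by (intro nn_integral_cmult_indicator) simp
    then show "ennreal (measure M (cball x s)) * indicator A x = (\<integral>\<^sup>+y. indicator A x * indicator (cball x s) y \<partial>M)"
      by (simp add: emeasure_eq_measure mult.commute)
  qed
  also have "\<dots> = (\<integral>\<^sup>+y. \<integral>\<^sup>+x. indicator A x * indicator (cball x s) y \<partial>lborel \<partial>M)"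
    by (rule P.Fubini'[symmetric, OF dist_pair_measurable[OF M(1) A(1)]])
  also have "\<dots> \<le> (\<integral>\<^sup>+y. ennreal ?m * indicator (cball x0 (2 * r)) y \<partial>M)"
  proof (rule nn_integral_mono)
    fix y
    have "(\<integral>\<^sup>+x. indicator A x * indicator (cball x s) y \<partial>lborel) = (\<integral>\<^sup>+x. indicator (A \<inter> cball y s) x \<partial>lborel)"
      by (intro nn_integral_cong) (auto simp: indicator_def dist_commute)
    also have "\<dots> = ennreal (measure lborel (A \<inter> cball y s))"
      using A Afin by (simp add: emeasure_eq_ennreal_measure fmeasurable_Int_fmeasurable fmeasurableD2)
    also have "\<dots> \<le> ennreal ?m * indicator (cball x0 (2 * r)) y"
    proof (cases "y \<in> cball x0 (2 * r)")
      case True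
      have "measure lborel (A \<inter> cball y s) \<le> measure lborel A"
        using A Afin by (intro measure_mono_fmeasurable) auto
      moreover have "measure lborel (A \<inter> cball y s) \<le> measure lborel (cball y s)"
        using A by (intro measure_mono_fmeasurable fmeasurable_cball_lborel) auto
      ultimately show ?thesis using True s by (auto simp: content_cball intro!: ennreal_leI)
    next
      case False
      have "A \<inter> cball y s = {}"
      proof -
        have "dist x0 y \<le> 2 * r" if "x \<in> A" "dist y x \<le> s" for x
          using that A(2) s dist_triangle[of x0 y x] by (auto simp: dist_commute dest!: subsetD)
        then show ?thesis using False by auto
      qed
      then show ?thesis by simp
    qed
    finally show "(\<integral>\<^sup>+x. indicator A x * indicator (cball x s) y \<partial>lborel) \<le> ennreal ?m * indicator (cball x0 (2 * r)) y" .
  qed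
  also have "\<dots> = ennreal ?m * emeasure M (cball x0 (2 * r))"
    using M(1) by (intro nn_integral_cmult_indicator) simp
  also have "\<dots> = ennreal (?m * measure M (cball x0 (2 * r)))"
    using m0 by (simp add: emeasure_eq_measure ennreal_mult)
  finally show ?thesis .
qed

text \<open>
  In the estimate on a ball of radius \<open>r\<close> below, \<open>d\<close> is the fraction \<open>\<bar>A\<bar> / r\<^sup>n\<close> and \<open>c\<close> the volume
  of the unit ball: a ball of radius \<open>r / 2\<^sup>j\<close> meets \<open>A\<close> in volume at most both \<open>\<bar>A\<bar>\<close> and its own.
\<close>

definition dyadic_sum :: "nat \<Rightarrow> real \<Rightarrow> real \<Rightarrow> real" where
  "dyadic_sum n c d = (\<Sum>j. (1 / 4) ^ j * min ((2 ^ j) ^ n * d) c)"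

lemma summable_dyadic_sum:
  assumes "c \<ge> 0" "d \<ge> 0" shows "summable (\<lambda>j. (1 / 4) ^ j * min ((2 ^ j) ^ n * d) c :: real)"
  by (rule summable_comparison_test'[of "\<lambda>j. (1 / 4) ^ j * c"])
     (use assms in \<open>auto intro!: summable_mult2 summable_geometric mult_left_mono simp: abs_mult\<close>)

text \<open>Each summand tends to 0 with \<open>d\<close>, and the cap \<open>c\<close> supplies the
  summable majorant c (1/4)^j, so Tannery's theorem applies. The factor (1/4)^j comes from the
  square of the dyadic radius.\<close>

lemma dyadic_sum_tendsto:
  fixes d :: "nat \<Rightarrow> real"
  assumes c: "c \<ge> 0" and d: "\<And>k. d k \<ge> 0" "d \<longlonglongrightarrow> 0"
  shows "(\<lambda>k. dyadic_sum n c (d k)) \<longlonglongrightarrow> 0"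
proof -
  have "(\<lambda>k. \<Sum>j. (1 / 4) ^ j * min ((2 ^ j) ^ n * d k) c) \<longlonglongrightarrow> (\<Sum>j::nat. 0 :: real)"
  proof (rule tannerys_theorem[THEN conjunct2, THEN conjunct2])
    show "\<forall>\<^sub>F (j, k) in sequentially \<times>\<^sub>F sequentially. norm ((1 / 4) ^ j * min ((2 ^ j) ^ n * d k) c) \<le> (1 / 4) ^ j * c"
      using c d by (auto intro!: always_eventually mult_left_mono simp: abs_mult)
    show "summable (\<lambda>j. (1 / 4) ^ j * c :: real)"
      by (intro summable_mult2 summable_geometric) auto
    show "((\<lambda>k. (1 / 4) ^ j * min ((2 ^ j) ^ n * d k) c) \<longlongrightarrow> 0) sequentially" for j
    proof -
      have "((\<lambda>k. (1 / 4) ^ j * min ((2 ^ j) ^ n * d k) c) \<longlongrightarrow> (1 / 4) ^ j * min ((2 ^ j) ^ n * 0) c) sequentially"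
        by (intro tendsto_intros d)
      then show ?thesis using c by simp
    qed
  qed simp
  then show ?thesis by (simp add: dyadic_sum_def)
qed

section \<open>The pointwise estimate integrated over a ball\<close>

context local_laplacian begin

lemma AE_Lebesgue: "AE x in lborel. x \<in> ball z R \<longrightarrow>
    ((\<lambda>r. (LINT y:cball x r|lborel. \<bar>v y - v x\<bar>) / r ^ DIM('a)) \<longlongrightarrow> 0) (at_right 0)"
proof -
  have "AE x in lebesgue. x \<in> ball z R \<longrightarrow>
    ((\<lambda>r. (LINT y:cball x r|lborel. \<bar>v y - v x\<bar>) / r ^ DIM('a)) \<longlongrightarrow> 0) (at_right 0)"
    by (rule AE_I'[OF negligible_non_Lebesgue_points[OF v_int, of z R, unfolded negligible_iff_null_sets]]) auto
  then show ?thesis by (simp add: AE_completion_iff)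
qed

lemma set_integrable_abs_v: "set_integrable lborel (cball x t) (\<lambda>y. \<bar>v y\<bar>)"
  unfolding set_integrable_def by (intro integrable_mult_indicator integrable_abs v_int) auto

lemma Phi_nonneg: "Phi x t \<ge> 0"
  by (auto simp: Phi_def set_lebesgue_integral_def intro!: integral_nonneg_AE)

lemma Phi_mono: "cball x s \<subseteq> cball y t \<Longrightarrow> Phi x s \<le> Phi y t"
  unfolding Phi_def set_lebesgue_integral_def
  by (intro integral_mono set_integrable_abs_v[unfolded set_integrable_def]) (auto split: split_indicator)

lemma Phi_eq:
  assumes A: "A \<in> sets borel" "A \<subseteq> cball x r" "\<And>y. y \<in> cball x r - A \<Longrightarrow> v y = 0"
  shows "ennreal (kappa * Phi x r) = (\<integral>\<^sup>+y\<in>A. ennreal (kappa * \<bar>v y\<bar>) \<partial>lborel)"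
proof -
  have "kappa * Phi x r = (\<integral>y. indicator A y * (kappa * \<bar>v y\<bar>) \<partial>lborel)"
    unfolding Phi_def set_lebesgue_integral_def integral_mult_right_zero[symmetric]
    using A(2,3) by (intro Bochner_Integration.integral_cong refl) (auto simp: indicator_def)
  also have "ennreal \<dots> = (\<integral>\<^sup>+y. ennreal (indicator A y * (kappa * \<bar>v y\<bar>)) \<partial>lborel)"
  proof (rule nn_integral_eq_integral[symmetric])
    have "integrable lborel (\<lambda>y. indicator A y *\<^sub>R (kappa * \<bar>v y\<bar>))"
      using A(1) by (intro integrable_mult_indicator integrable_mult_right integrable_abs v_int) simp
    then show "integrable lborel (\<lambda>y. indicator A y * (kappa * \<bar>v y\<bar>))" by simp
  qed (use kappa_pos in auto)
  also have "\<dots> = (\<integral>\<^sup>+y\<in>A. ennreal (kappa * \<bar>v y\<bar>) \<partial>lborel)"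
    by (intro nn_integral_cong) (auto split: split_indicator)
  finally show ?thesis .
qed

lemma mu_nonneg: "mu S \<ge> 0" by (simp add: mu_def)

lemma nn_integral_mu_le:
  assumes A: "A \<in> sets borel" "A \<subseteq> cball x0 r" and s: "0 < s" "s \<le> r" and c: "c \<ge> 0"
  shows "(\<integral>\<^sup>+x\<in>A. ennreal (c * mu (cball x s)) \<partial>lborel) \<le>
    ennreal (c * min (measure lborel A) (unit_ball_vol DIM('a) * s ^ DIM('a)) * mu (cball x0 (2 * r)))"
proof -
  let ?m = "min (measure lborel A) (unit_ball_vol DIM('a) * s ^ DIM('a))"
  have m0: "?m \<ge> 0" using s by simp
  note [measurable] = measurable_measure_cball[OF M1] measurable_measure_cball[OF M2] A(1)
  have "(\<integral>\<^sup>+x\<in>A. ennreal (c * mu (cball x s)) \<partial>lborel) =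
    (\<integral>\<^sup>+x. ennreal c * (ennreal (measure M1 (cball x s)) * indicator A x + ennreal (measure M2 (cball x s)) * indicator A x) \<partial>lborel)"
    using c by (intro nn_integral_cong) (auto simp: mu_def ennreal_mult split: split_indicator)
  also have "\<dots> = ennreal c * ((\<integral>\<^sup>+x\<in>A. ennreal (measure M1 (cball x s)) \<partial>lborel) + (\<integral>\<^sup>+x\<in>A. ennreal (measure M2 (cball x s)) \<partial>lborel))"
    by (subst nn_integral_cmult, measurable) (subst nn_integral_add, auto)
  also have "\<dots> \<le> ennreal c * (ennreal (?m * measure M1 (cball x0 (2 * r))) + ennreal (?m * measure M2 (cball x0 (2 * r))))"
    by (intro mult_left_mono add_mono nn_integral_measure_cball_le M1 M2 A s) auto
  also have "\<dots> = ennreal (c * ?m * mu (cball x0 (2 * r)))"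
    using c m0 by (simp add: mu_def ennreal_mult[symmetric] ennreal_plus[symmetric] algebra_simps del: ennreal_plus)
  finally show ?thesis .
qed

text \<open>\<open>pointwise_estimate\<close> with t = r is integrated over \<open>A\<close>, which
  carries all of |v| on the ball. The first term is bounded uniformly in x through
  \<open>Phi x0 (2 * r)\<close> and so gains the factor |A|; the series is integrated term by term
  with \<open>nn_integral_mu_le\<close>.\<close>

lemma local_estimate:
  assumes r: "r > 0" "cball x0 (2 * r) \<subseteq> cball z R"
    and A: "A \<in> sets borel" "A \<subseteq> cball x0 r" "\<And>y. y \<in> cball x0 r - A \<Longrightarrow> v y = 0"
  defines "d \<equiv> measure lborel A / r ^ DIM('a)"
  shows "kappa * Phi x0 r \<le> Cp * d * Phi x0 (2 * r) +
    Ch * r\<^sup>2 * mu (cball x0 (2 * r)) * dyadic_sum DIM('a) (unit_ball_vol DIM('a)) d"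
proof -
  let ?c = "\<lambda>j. Ch * (r / 2 ^ j)\<^sup>2 / (r / 2 ^ j) ^ DIM('a)"
  let ?V = "unit_ball_vol DIM('a)"
  have d0: "d \<ge> 0" using r by (simp add: d_def)
  have c0: "?c j \<ge> 0" for j using r Ch_nonneg by simp
  have sub: "cball x r \<subseteq> cball x0 (2 * r)" if "x \<in> A" for x
    using that A(2) by (intro cball_subset_cball_iff[THEN iffD2]) (auto simp: dist_commute dest!: subsetD)
  \<comment> \<open>Lebesgue points are provided on the open ball only, so \<open>x\<close> has to
    be placed in the interior of \<open>cball z R\<close>.\<close>
  have sub': "x \<in> ball z R" if "x \<in> A" for x
  proof -
    have "x \<in> ball x0 (2 * r)" using that A(2) r by auto
    also have "\<dots> \<subseteq> interior (cball z R)" using r(2) by (intro interior_maximal) (auto simp: ball_subset_cball order_trans)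
    finally show ?thesis by simp
  qed
  have Afin: "emeasure lborel A = ennreal (measure lborel A)"
    using fmeasurableD2[OF fmeasurable_subset_cball[OF A(1,2)]]
    by (intro emeasure_eq_ennreal_measure) auto
  note [measurable] = measurable_measure_cball[OF M1] measurable_measure_cball[OF M2] A(1)
  have "ennreal (kappa * Phi x0 r) = (\<integral>\<^sup>+x\<in>A. ennreal (kappa * \<bar>v x\<bar>) \<partial>lborel)"
    by (rule Phi_eq[OF A])
  also have "\<dots> \<le> (\<integral>\<^sup>+x. ennreal (Cp / r ^ DIM('a) * Phi x0 (2 * r)) * indicator A x +
      (\<Sum>j. ennreal (?c j * mu (cball x (r / 2 ^ j))) * indicator A x) \<partial>lborel)"
  proof (rule nn_integral_mono_AE)
    show "AE x in lborel. ennreal (kappa * \<bar>v x\<bar>) * indicator A x \<le> ennreal (Cp / r ^ DIM('a) * Phi x0 (2 * r)) * indicator A x +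
      (\<Sum>j. ennreal (?c j * mu (cball x (r / 2 ^ j))) * indicator A x)"
      using AE_Lebesgue
    proof eventually_elim
      case (elim x)
      show ?case
      proof (cases "x \<in> A")
        case True
        have "ennreal (kappa * \<bar>v x\<bar>) \<le> ennreal (Cp / r ^ DIM('a) * Phi x r) + (\<Sum>j. ennreal (?c j * mu (cball x (r / 2 ^ j))))"
          using elim sub'[OF True] sub[OF True] r by (intro pointwise_estimate) auto
        also have "\<dots> \<le> ennreal (Cp / r ^ DIM('a) * Phi x0 (2 * r)) + (\<Sum>j. ennreal (?c j * mu (cball x (r / 2 ^ j))))"
          using sub[OF True] r Cp_nonneg by (intro add_right_mono ennreal_leI mult_left_mono Phi_mono) auto
        finally show ?thesis using True by simp
      qed simp
    qed
  qed
  also have "\<dots> = ennreal (Cp / r ^ DIM('a) * Phi x0 (2 * r)) * ennreal (measure lborel A) +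
      (\<Sum>j. \<integral>\<^sup>+x\<in>A. ennreal (?c j * mu (cball x (r / 2 ^ j))) \<partial>lborel)"
  proof -
    have [measurable]: "(\<lambda>x. ennreal (?c j * mu (cball x (r / 2 ^ j))) * indicator A x) \<in> borel_measurable lborel" for j
      unfolding mu_def by measurable
    have "(\<integral>\<^sup>+x. (\<Sum>j. ennreal (?c j * mu (cball x (r / 2 ^ j))) * indicator A x) \<partial>lborel) =
        (\<Sum>j. \<integral>\<^sup>+x\<in>A. ennreal (?c j * mu (cball x (r / 2 ^ j))) \<partial>lborel)"
      by (rule nn_integral_suminf) measurable
    moreover have "(\<integral>\<^sup>+x. ennreal (Cp / r ^ DIM('a) * Phi x0 (2 * r)) * indicator A x \<partial>lborel) =
        ennreal (Cp / r ^ DIM('a) * Phi x0 (2 * r)) * ennreal (measure lborel A)"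
      using A(1) by (subst nn_integral_cmult_indicator) (auto simp: Afin)
    ultimately show ?thesis by (subst nn_integral_add) measurable
  qed
  also have "\<dots> \<le> ennreal (Cp / r ^ DIM('a) * Phi x0 (2 * r)) * ennreal (measure lborel A) +
      (\<Sum>j. ennreal (?c j * min (measure lborel A) (?V * (r / 2 ^ j) ^ DIM('a)) * mu (cball x0 (2 * r))))"
    using r by (intro add_left_mono suminf_le nn_integral_mu_le[OF A(1,2) _ _ c0]) (auto simp: divide_le_eq)
  \<comment> \<open>The factor 2^(jN) / r^N, named \<open>?q\<close> below, is moved into the
    minimum: |A| becomes 2^(jN) d and the volume of the small ball becomes that of the unit ball.
    The remaining factor is r^2 (1/4)^j.\<close>
  also have "(\<lambda>j. ?c j * min (measure lborel A) (?V * (r / 2 ^ j) ^ DIM('a)) * mu (cball x0 (2 * r)))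
      = (\<lambda>j. Ch * r\<^sup>2 * mu (cball x0 (2 * r)) * ((1 / 4) ^ j * min ((2 ^ j) ^ DIM('a) * d) ?V))"
  proof
    fix j
    let ?q = "(2 ^ j) ^ DIM('a) / r ^ DIM('a) :: real"
    have q: "?q > 0" using r by simp
    have "?q * min (measure lborel A) (?V * (r / 2 ^ j) ^ DIM('a)) = min (?q * measure lborel A) (?q * (?V * (r / 2 ^ j) ^ DIM('a)))"
      using q by (simp add: min_mult_distrib_left)
    also have "?q * measure lborel A = (2 ^ j) ^ DIM('a) * d" by (simp add: d_def)
    also have "?q * (?V * (r / 2 ^ j) ^ DIM('a)) = ?V" using r by (simp add: power_divide)
    finally have 1: "?q * min (measure lborel A) (?V * (r / 2 ^ j) ^ DIM('a)) = min ((2 ^ j) ^ DIM('a) * d) ?V" .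
    have "(2 ^ j)\<^sup>2 = (4 :: real) ^ j" by (simp add: power_mult[symmetric] mult.commute[of j] power_mult)
    then have 2: "?c j = Ch * r\<^sup>2 * (1 / 4) ^ j * ?q"
      using r by (simp add: power_divide field_simps)
    show "?c j * min (measure lborel A) (?V * (r / 2 ^ j) ^ DIM('a)) * mu (cball x0 (2 * r))
      = Ch * r\<^sup>2 * mu (cball x0 (2 * r)) * ((1 / 4) ^ j * min ((2 ^ j) ^ DIM('a) * d) ?V)"
      unfolding 2 1[symmetric] by (simp only: mult_ac)
  qed
  also have "ennreal (Cp / r ^ DIM('a) * Phi x0 (2 * r)) * ennreal (measure lborel A) = ennreal (Cp * d * Phi x0 (2 * r))"
    using r Cp_nonneg Phi_nonneg by (subst ennreal_mult[symmetric]) (auto simp: d_def)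
  also have "(\<Sum>j. ennreal (Ch * r\<^sup>2 * mu (cball x0 (2 * r)) * ((1 / 4) ^ j * min ((2 ^ j) ^ DIM('a) * d) ?V))) =
    ennreal (Ch * r\<^sup>2 * mu (cball x0 (2 * r)) * dyadic_sum DIM('a) ?V d)"
  proof -
    note s = summable_dyadic_sum[of ?V d "DIM('a)", OF _ d0]
    have "(\<Sum>j. ennreal (Ch * r\<^sup>2 * mu (cball x0 (2 * r)) * ((1 / 4) ^ j * min ((2 ^ j) ^ DIM('a) * d) ?V))) =
        ennreal (\<Sum>j. Ch * r\<^sup>2 * mu (cball x0 (2 * r)) * ((1 / 4) ^ j * min ((2 ^ j) ^ DIM('a) * d) ?V))"
      using Ch_nonneg mu_nonneg d0
      by (intro suminf_ennreal2 summable_mult s) (auto intro!: mult_nonneg_nonneg)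
    then show ?thesis unfolding dyadic_sum_def by (subst (asm) suminf_mult[OF s]) auto
  qed
  also have "ennreal (Cp * d * Phi x0 (2 * r)) + \<dots> = ennreal (Cp * d * Phi x0 (2 * r) +
    Ch * r\<^sup>2 * mu (cball x0 (2 * r)) * dyadic_sum DIM('a) ?V d)"
    using Cp_nonneg d0 Phi_nonneg Ch_nonneg mu_nonneg summable_dyadic_sum[OF unit_ball_vol_nonneg d0]
    by (subst ennreal_plus) (auto intro!: mult_nonneg_nonneg suminf_nonneg simp: dyadic_sum_def)
  finally show ?thesis
    using Cp_nonneg d0 Phi_nonneg Ch_nonneg mu_nonneg summable_dyadic_sum[OF unit_ball_vol_nonneg d0]
    by (subst (asm) ennreal_le_iff) (auto intro!: add_nonneg_nonneg mult_nonneg_nonneg suminf_nonneg simp: dyadic_sum_def)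
qed

end

section \<open>Level sets at density points\<close>

text \<open>Boundedness comes first: once |e k| < 1/2 and q k < 1, a bound of at least 2 is
  inherited from m k by m (Suc k). With m bounded, the recursion itself gives the limit.\<close>

lemma contraction_tendsto_0:
  fixes m e q :: "nat \<Rightarrow> real"
  assumes m: "\<And>k. m k \<ge> 0" and rec: "\<forall>\<^sub>F k in sequentially. m (Suc k) \<le> e k * m k + q k"
    and e: "e \<longlonglongrightarrow> 0" and q: "q \<longlonglongrightarrow> 0"
  shows "m \<longlonglongrightarrow> 0"
proof -
  have "\<forall>\<^sub>F k in sequentially. \<bar>e k\<bar> < 1 / 2 \<and> q k < 1 \<and> m (Suc k) \<le> e k * m k + q k"
    using order_tendstoD(2)[OF tendsto_rabs_zero[OF e], of "1 / 2"] order_tendstoD(2)[OF q, of 1] rec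
    by (simp add: eventually_conj_iff)
  then obtain K where K: "\<And>k. k \<ge> K \<Longrightarrow> \<bar>e k\<bar> < 1 / 2 \<and> q k < 1 \<and> m (Suc k) \<le> e k * m k + q k"
    by (auto simp: eventually_sequentially)
  \<comment> \<open>The value 2 ensures B / 2 + 1 <= B.\<close>
  define B where "B = max (m K) 2"
  have B: "m k \<le> B" if "k \<ge> K" for k
    using that
  proof (induction rule: dec_induct)
    case (step k)
    have "e k * m k \<le> 1 / 2 * B"
      using K[of k] step m[of k] by (intro mult_mono) (auto simp: B_def)
    then have "m (Suc k) \<le> B / 2 + 1" using K[of k] step by linarith
    then show ?case by (simp add: B_def)
  qed (simp add: B_def)
  have "(\<lambda>k. m (Suc k)) \<longlonglongrightarrow> 0"
  proof (rule Lim_null_comparison)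
    show "\<forall>\<^sub>F k in sequentially. norm (m (Suc k)) \<le> \<bar>e k\<bar> * B + q k"
      unfolding eventually_sequentially
    proof (intro exI allI impI)
      fix k assume k: "k \<ge> K"
      have "e k * m k \<le> \<bar>e k\<bar> * B" using B[OF k] m by (intro mult_mono) auto
      then show "norm (m (Suc k)) \<le> \<bar>e k\<bar> * B + q k" using K[OF k] m[of "Suc k"] by simp
    qed
    have "(\<lambda>k. \<bar>e k\<bar> * B + q k) \<longlonglongrightarrow> 0 * B + 0"
      by (intro tendsto_intros tendsto_rabs_zero e q)
    then show "(\<lambda>k. \<bar>e k\<bar> * B + q k) \<longlonglongrightarrow> 0" by simp
  qed
  then show ?thesis by (simp only: filterlim_sequentially_Suc)
qed

section \<open>Tested charge against mass at a density point\<close>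

context local_laplacian begin

text \<open>The testing identity read in the other direction: the integral of |v| controls the
  charge. If \<open>Phi x t\<close> is o(t^(N+2)), then the charge is o(t^N).\<close>

lemma charge_le:
  assumes t: "t > 0" "cball x t \<subseteq> cball z R"
  shows "t\<^sup>2 * \<bar>(\<integral>y. h ((norm (y - x) / t)\<^sup>2) \<partial>M1) - (\<integral>y. h ((norm (y - x) / t)\<^sup>2) \<partial>M2)\<bar>
    \<le> (2 ^ DIM('a) + 1) * Cp * Phi x t"
proof -
  have "\<bar>\<integral>y. v y * p ((norm (y - x) / (t / 2))\<^sup>2) \<partial>lborel\<bar> \<le> Cp * Phi x (t / 2)"
    using v_p_le[of "t / 2" x] t(1) by simp
  also have "\<dots> \<le> Cp * Phi x t"
    using t Cp_nonneg by (intro mult_left_mono Phi_mono subset_cball) auto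
  finally have "2 ^ DIM('a) * \<bar>\<integral>y. v y * p ((norm (y - x) / (t / 2))\<^sup>2) \<partial>lborel\<bar> \<le> 2 ^ DIM('a) * (Cp * Phi x t)"
    by simp
  moreover have "\<bar>t\<^sup>2 * ((\<integral>y. h ((norm (y - x) / t)\<^sup>2) \<partial>M1) - (\<integral>y. h ((norm (y - x) / t)\<^sup>2) \<partial>M2))\<bar>
    \<le> 2 ^ DIM('a) * \<bar>\<integral>y. v y * p ((norm (y - x) / (t / 2))\<^sup>2) \<partial>lborel\<bar> + \<bar>\<integral>y. v y * p ((norm (y - x) / t)\<^sup>2) \<partial>lborel\<bar>"
    unfolding laplace_difference[OF t, symmetric] using abs_triangle_ineq4[of "2 ^ DIM('a) * (\<integral>y. v y * p ((norm (y - x) / (t / 2))\<^sup>2) \<partial>lborel)"]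
    by (simp add: abs_mult)
  ultimately have "\<bar>t\<^sup>2 * ((\<integral>y. h ((norm (y - x) / t)\<^sup>2) \<partial>M1) - (\<integral>y. h ((norm (y - x) / t)\<^sup>2) \<partial>M2))\<bar>
    \<le> 2 ^ DIM('a) * (Cp * Phi x t) + Cp * Phi x t"
    using v_p_le[OF t(1), of x] by linarith
  then show ?thesis unfolding abs_mult by (simp add: algebra_simps)
qed

text \<open>Since \<open>h\<close> is nonpositive nothing cancels, so the ball of radius a t, where
  the kernel is at most -b, already accounts for the lower bound.\<close>

lemma integral_h_kernel_ge:
  fixes x :: 'a
  assumes M: "sets M = sets borel" "finite_measure M" and t: "t > 0"
    and h_neg: "\<And>s. h s \<le> 0" and a: "a > 0" "\<And>s. 0 \<le> s \<Longrightarrow> s \<le> a\<^sup>2 \<Longrightarrow> h s \<le> - b" and b: "b \<ge> 0"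
  shows "b * measure M (cball x (a * t)) \<le> \<bar>\<integral>y. h ((norm (y - x) / t)\<^sup>2) \<partial>M\<bar>"
proof -
  interpret finite_measure M by (rule M)
  have "b * measure M (cball x (a * t)) = (\<integral>y. b * indicator (cball x (a * t)) y \<partial>M)"
    using M(1) by simp
  also have "\<dots> \<le> (\<integral>y. - h ((norm (y - x) / t)\<^sup>2) \<partial>M)"
  proof (rule integral_mono)
    show "integrable M (\<lambda>y. b * indicator (cball x (a * t)) y)"
      using M(1) by (intro integrable_mult_right integrable_real_indicator) (auto simp: emeasure_finite less_top[symmetric])
    show "integrable M (\<lambda>y. - h ((norm (y - x) / t)\<^sup>2))"
      by (intro Bochner_Integration.integrable_minus integrable_h_kernel M)
    fix y
    show "b * indicator (cball x (a * t)) y \<le> - h ((norm (y - x) / t)\<^sup>2)"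
    proof (cases "y \<in> cball x (a * t)")
      case True
      then have "norm (y - x) / t \<le> a" using t by (simp add: dist_norm norm_minus_commute divide_le_eq)
      then have "(norm (y - x) / t)\<^sup>2 \<le> a\<^sup>2" using t by (intro power_mono) auto
      then show ?thesis using a(2)[of "(norm (y - x) / t)\<^sup>2"] True by simp
    qed (simp add: h_neg)
  qed
  also have "\<dots> \<le> \<bar>\<integral>y. h ((norm (y - x) / t)\<^sup>2) \<partial>M\<bar>" by simp
  finally show ?thesis .
qed

text \<open>The contradiction for one Hahn set: \<open>S\<close> is a piece of the level set on
  which \<open>M1\<close> dominates c dx and \<open>M2\<close> has no mass. At a good point of
  \<open>S\<close> all quantities are divided by r^N and compared along dyadic radii.\<close>

lemma null_if_dominated:
  assumes h_neg: "\<And>s. h s \<le> 0" and a: "0 < a" "a \<le> 1" "\<And>s. 0 \<le> s \<Longrightarrow> s \<le> a\<^sup>2 \<Longrightarrow> h s \<le> - b" and b: "b > 0"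
    and S: "S \<in> sets borel" "S \<subseteq> ball z R" "\<And>y. y \<in> S \<Longrightarrow> v y = 0"
    and c: "c > 0" and dom: "\<And>A. A \<in> sets borel \<Longrightarrow> A \<subseteq> S \<Longrightarrow> c * measure lborel A \<le> measure M1 A"
    and sing: "measure M2 S = 0"
  shows "negligible S"
proof (rule ccontr)
  assume nonneg: "\<not> negligible S"
  let ?N = "DIM('a)" and ?V = "unit_ball_vol DIM('a)"
  \<comment> \<open>\<open>L\<close> below is Lebesgue measure on the complement of \<open>S\<close>
    in the ball; a point of \<open>S\<close> where \<open>L\<close> has zero density is a density
    point of \<open>S\<close>.\<close>
  define E where "E = ball z R - S"
  have E: "E \<in> sets borel" using S(1) by (simp add: E_def)
  define L where "L = density lborel (indicator E :: 'a \<Rightarrow> ennreal)"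
  have L_em: "emeasure L X = emeasure lborel (E \<inter> X)" if "X \<in> sets borel" for X
    unfolding L_def using emeasure_restricted[of E lborel X] E that by simp
  have L: "sets L = sets borel" "finite_measure L"
  proof -
    show "sets L = sets borel" by (simp add: L_def)
    have "emeasure L UNIV \<le> emeasure lborel (ball z R)"
      by (subst L_em) (auto simp: E_def intro!: emeasure_mono)
    also have "\<dots> < \<infinity>" by (rule emeasure_lborel_ball_finite)
    finally show "finite_measure L" by (intro finite_measureI) (auto simp: L_def)
  qed
  have L_meas: "measure L X = measure lborel (E \<inter> X)" if "X \<in> sets borel" for X
    using L_em[OF that] by (simp add: measure_def)
  have "E \<inter> S = {}" by (auto simp: E_def)
  then have "measure L S = 0" using S(1) by (simp add: L_meas)
  from negligible_upper_density[OF L S(1) this] negligible_upper_density[OF M2 S(1) sing]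
    negligible_infinite_density[OF M1] negligible_infinite_density[OF M2]
  have "negligible ({x \<in> S. \<not> ((\<lambda>r. measure L (cball x r) / r ^ ?N) \<longlongrightarrow> 0) (at_right 0)}
    \<union> {x \<in> S. \<not> ((\<lambda>r. measure M2 (cball x r) / r ^ ?N) \<longlongrightarrow> 0) (at_right 0)}
    \<union> {x. \<nexists>C. \<forall>\<^sub>F r in at_right 0. measure M1 (cball x r) \<le> C * r ^ ?N}
    \<union> {x. \<nexists>C. \<forall>\<^sub>F r in at_right 0. measure M2 (cball x r) \<le> C * r ^ ?N})" (is "negligible ?B")
    by (intro negligible_Un)
  then have "\<not> S \<subseteq> ?B" using nonneg negligible_subset by blast
  then obtain x C1 C2 where x: "x \<in> S"
    and dens: "((\<lambda>r. measure L (cball x r) / r ^ ?N) \<longlongrightarrow> 0) (at_right 0)"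
      "((\<lambda>r. measure M2 (cball x r) / r ^ ?N) \<longlongrightarrow> 0) (at_right 0)"
    and C1: "\<forall>\<^sub>F r in at_right 0. measure M1 (cball x r) \<le> C1 * r ^ ?N"
    and C2: "\<forall>\<^sub>F r in at_right 0. measure M2 (cball x r) \<le> C2 * r ^ ?N"
    by auto
  obtain r0 where r0: "r0 > 0" "cball x r0 \<subseteq> ball z R"
    using open_contains_cball[THEN iffD1, OF open_ball, rule_format, OF subsetD[OF S(2) x]] by blast
  define r where "r k = r0 / 2 ^ k" for k
  have r_pos: "r k > 0" for k using r0 by (simp add: r_def)
  have r_Suc: "r k = 2 * r (Suc k)" for k by (simp add: r_def)
  have r_sub: "cball x (r k) \<subseteq> ball z R" for k
    using r0 by (intro order_trans[OF subset_cball r0(2)]) (simp add: r_def divide_le_eq)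
  then have r_sub': "cball x (r k) \<subseteq> cball z R" for k using ball_subset_cball by blast
  have r_lim: "filterlim r (at_right 0) sequentially"
    unfolding r_def[abs_def] by (rule filterlim_dyadic[OF r0(1)])
  define A where "A k = cball x (r k) - S" for k
  have A: "A k \<in> sets borel" "A k \<subseteq> cball x (r k)" for k using S(1) by (auto simp: A_def)
  define d where "d k = measure lborel (A k) / r k ^ ?N" for k
  have A_L: "measure lborel (A k) = measure L (cball x (r k))" for k
  proof -
    have "A k = E \<inter> cball x (r k)" using r_sub[of k] by (auto simp: A_def E_def)
    then show ?thesis by (simp add: L_meas)
  qed
  have d_lim: "d \<longlonglongrightarrow> 0"
    unfolding d_def A_L by (rule filterlim_compose[OF dens(1) r_lim])
  have d0: "d k \<ge> 0" for k using r_pos[of k] by (simp add: d_def)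
  define m where "m k = Phi x (r k) / r k ^ (?N + 2)" for k
  have m0: "m k \<ge> 0" for k using r_pos[of k] Phi_nonneg by (simp add: m_def)
  define C where "C = C1 + C2"
  have mu_C: "\<forall>\<^sub>F k in sequentially. mu (cball x (r k)) \<le> C * r k ^ ?N"
    using filterlim_iff[THEN iffD1, OF r_lim, rule_format, OF C1] filterlim_iff[THEN iffD1, OF r_lim, rule_format, OF C2]
    by eventually_elim (simp add: mu_def C_def distrib_right)
  \<comment> \<open>The dyadic form of \<open>\<integral>\<^bsub>B(x,r)\<^esub> \<bar>v\<bar> = o(r\<^bsup>N+2\<^esup>)\<close>.\<close>
  have m_lim: "m \<longlonglongrightarrow> 0"
  proof (rule contraction_tendsto_0[OF m0])
    \<comment> \<open>The coefficients of \<open>local_estimate\<close> at radius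
      \<open>r (Suc k)\<close>, whose doubled ball has radius \<open>r k\<close>. The powers of 2
      come from \<open>r_Suc\<close>, and \<open>mu_C\<close> bounds the mass of the doubled
      ball.\<close>
    let ?e = "\<lambda>k. Cp * d (Suc k) * 2 ^ (?N + 2) / kappa"
    let ?q = "\<lambda>k. Ch * C * 2 ^ ?N * dyadic_sum ?N ?V (d (Suc k)) / kappa"
    have G: "(\<lambda>k. dyadic_sum ?N ?V (d (Suc k))) \<longlonglongrightarrow> 0"
      by (rule dyadic_sum_tendsto) (use d0 LIMSEQ_Suc[OF d_lim] in auto)
    have "?e \<longlonglongrightarrow> Cp * 0 * 2 ^ (?N + 2) / kappa" "?q \<longlonglongrightarrow> Ch * C * 2 ^ ?N * 0 / kappa"
      using kappa_pos by (intro tendsto_intros LIMSEQ_Suc[OF d_lim] G; simp)+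
    then show "?e \<longlonglongrightarrow> 0" "?q \<longlonglongrightarrow> 0" by auto
    show "\<forall>\<^sub>F k in sequentially. m (Suc k) \<le> ?e k * m k + ?q k"
      using mu_C
    proof eventually_elim
      case (elim k)
      let ?r = "r (Suc k)" and ?G = "dyadic_sum ?N ?V (d (Suc k))"
      have G0: "?G \<ge> 0"
        unfolding dyadic_sum_def using d0 by (intro suminf_nonneg summable_dyadic_sum) auto
      have "kappa * Phi x ?r \<le> Cp * d (Suc k) * Phi x (r k) + Ch * ?r\<^sup>2 * mu (cball x (r k)) * ?G"
        unfolding d_def r_Suc[of k] using A[of "Suc k"] S(3) r_sub'[of k] r_pos
        by (intro local_estimate) (auto simp: A_def r_Suc[of k])
      also have "\<dots> \<le> Cp * d (Suc k) * Phi x (r k) + Ch * ?r\<^sup>2 * (C * r k ^ ?N) * ?G"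
        using elim G0 Ch_nonneg by (intro add_left_mono mult_right_mono mult_left_mono) auto
      also have "\<dots> = Cp * d (Suc k) * (m k * r k ^ (?N + 2)) + Ch * ?r\<^sup>2 * (C * r k ^ ?N) * ?G"
        using r_pos[of k] by (simp add: m_def)
      also have "\<dots> = (Cp * d (Suc k) * 2 ^ (?N + 2) * m k + Ch * C * 2 ^ ?N * ?G) * ?r ^ (?N + 2)"
        unfolding r_Suc[of k] by (simp add: power_mult_distrib power_add power2_eq_square algebra_simps)
      finally have "kappa * Phi x ?r / ?r ^ (?N + 2) \<le> Cp * d (Suc k) * 2 ^ (?N + 2) * m k + Ch * C * 2 ^ ?N * ?G"
        using r_pos[of "Suc k"] by (simp add: divide_le_eq)
      then have "kappa * m (Suc k) \<le> Cp * d (Suc k) * 2 ^ (?N + 2) * m k + Ch * C * 2 ^ ?N * ?G"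
        by (simp add: m_def)
      then have "m (Suc k) \<le> (Cp * d (Suc k) * 2 ^ (?N + 2) * m k + Ch * C * 2 ^ ?N * ?G) / kappa"
        using kappa_pos by (simp add: le_divide_eq mult.commute)
      then show ?case by (simp add: add_divide_distrib)
    qed
  qed
  \<comment> \<open>The kernel sees mass of order \<open>r\<^sup>N\<close> from \<open>M1\<close>, but \<open>m\<close> and the density of \<open>M2\<close> vanish.\<close>
  have ineq: "b * c * (?V * a ^ ?N - d k) \<le> Ch * (measure M2 (cball x (r k)) / r k ^ ?N) + (2 ^ ?N + 1) * Cp * m k" for k
  proof -
    let ?H1 = "\<integral>y. h ((norm (y - x) / r k)\<^sup>2) \<partial>M1" and ?H2 = "\<integral>y. h ((norm (y - x) / r k)\<^sup>2) \<partial>M2"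
    \<comment> \<open>The mass of \<open>M1\<close> is estimated from below: of the ball of radius
      \<open>a * r k\<close>, at most the volume of \<open>A k\<close> lies outside
      \<open>S\<close>, and on \<open>S\<close> the domination by c dx applies.\<close>
    have "?V * (a * r k) ^ ?N = measure lborel (cball x (a * r k))"
      using a r_pos[of k] by (simp add: content_cball)
    also have "\<dots> = measure lborel ((S \<inter> cball x (a * r k)) \<union> ((- S) \<inter> cball x (a * r k)))"
      by (rule arg_cong[where f = "measure lborel"]) auto
    also have "\<dots> \<le> measure lborel (S \<inter> cball x (a * r k)) + measure lborel ((- S) \<inter> cball x (a * r k))"
      using S(1) by (intro measure_Un_le) auto
    also have "measure lborel ((- S) \<inter> cball x (a * r k)) \<le> measure lborel (A k)"
    proof (rule measure_mono_fmeasurable)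
      have "a * r k \<le> r k" using a r_pos[of k] by simp
      then show "- S \<inter> cball x (a * r k) \<subseteq> A k" by (auto simp: A_def)
      show "A k \<in> fmeasurable lborel" using A by (rule fmeasurable_subset_cball)
    qed (use S(1) in auto)
    finally have "?V * (a * r k) ^ ?N - measure lborel (A k) \<le> measure lborel (S \<inter> cball x (a * r k))" by simp
    then have "c * (?V * (a * r k) ^ ?N - measure lborel (A k)) \<le> c * measure lborel (S \<inter> cball x (a * r k))"
      using c by simp
    also have "\<dots> \<le> measure M1 (S \<inter> cball x (a * r k))" using S(1) by (intro dom) auto
    also have "\<dots> \<le> measure M1 (cball x (a * r k))" using M1(1) by (intro M1.finite_measure_mono) auto
    finally have "b * (c * (?V * (a * r k) ^ ?N - measure lborel (A k))) \<le> b * measure M1 (cball x (a * r k))"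
      using b by simp
    also have "\<dots> \<le> \<bar>?H1\<bar>"
      by (rule integral_h_kernel_ge[OF M1 r_pos h_neg a(1,3)]) (use b in auto)
    \<comment> \<open>\<open>?H1 - ?H2\<close> is the tested charge, bounded by
      \<open>charge_le\<close>; \<open>?H2\<close> is bounded by the mass of \<open>M2\<close>,
      whose density at \<open>x\<close> is zero.\<close>
    also have "\<dots> \<le> \<bar>?H2\<bar> + \<bar>?H1 - ?H2\<bar>" by linarith
    also have "\<dots> \<le> Ch * measure M2 (cball x (r k)) + (2 ^ ?N + 1) * Cp * Phi x (r k) / (r k)\<^sup>2"
      using integral_h_kernel_le[OF M2 r_pos[of k], of x] charge_le[OF r_pos[of k] r_sub'[of k]] r_pos[of k]
      by (intro add_mono) (auto simp: le_divide_eq mult.commute)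
    finally have "b * (c * (?V * (a * r k) ^ ?N - measure lborel (A k))) / r k ^ ?N \<le>
      (Ch * measure M2 (cball x (r k)) + (2 ^ ?N + 1) * Cp * Phi x (r k) / (r k)\<^sup>2) / r k ^ ?N"
      using r_pos[of k] by (intro divide_right_mono) auto
    moreover have "b * (c * (?V * (a * r k) ^ ?N - measure lborel (A k))) / r k ^ ?N = b * c * (?V * a ^ ?N - d k)"
      using r_pos[of k] by (simp add: d_def power_mult_distrib field_simps)
    moreover have "(Ch * measure M2 (cball x (r k)) + (2 ^ ?N + 1) * Cp * Phi x (r k) / (r k)\<^sup>2) / r k ^ ?N
      = Ch * (measure M2 (cball x (r k)) / r k ^ ?N) + (2 ^ ?N + 1) * Cp * m k"
      using r_pos[of k] by (simp add: m_def add_divide_distrib power_add mult.commute[of "(r k)\<^sup>2"] power2_eq_square)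
    ultimately show ?thesis by simp
  qed
  have "(\<lambda>k. measure M2 (cball x (r k)) / r k ^ ?N) \<longlonglongrightarrow> 0" by (rule filterlim_compose[OF dens(2) r_lim])
  then have "(\<lambda>k. Ch * (measure M2 (cball x (r k)) / r k ^ ?N) + (2 ^ ?N + 1) * Cp * m k) \<longlonglongrightarrow> Ch * 0 + (2 ^ ?N + 1) * Cp * 0"
    by (intro tendsto_intros m_lim)
  moreover have "(\<lambda>k. b * c * (?V * a ^ ?N - d k)) \<longlonglongrightarrow> b * c * (?V * a ^ ?N - 0)"
    by (intro tendsto_intros d_lim)
  ultimately have "b * c * (?V * a ^ ?N - 0) \<le> Ch * 0 + (2 ^ ?N + 1) * Cp * 0"
    using ineq by (intro LIMSEQ_le) auto
  moreover have "b * c * (?V * a ^ ?N) > 0" using b c a by simp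
  ultimately show False by simp
qed

end

section \<open>The Hahn decomposition of a signed measure\<close>

text \<open>Additivity is asked of families inside \<open>K\<close> only, because the set function
  carries no meaning elsewhere. Being real-valued, it excludes differences of infinities.\<close>

locale finite_signed_measure =
  fixes K :: "'a::topological_space set" and \<nu> :: "'a set \<Rightarrow> real"
  assumes K_borel: "K \<in> sets borel"
    and sums_UN: "\<And>A :: nat \<Rightarrow> 'a set. range A \<subseteq> sets borel \<Longrightarrow> (\<Union>i. A i) \<subseteq> K \<Longrightarrow> disjoint_family A \<Longrightarrow>
      (\<lambda>i. \<nu> (A i)) sums \<nu> (\<Union>i. A i)"
begin

lemma measure_empty [simp]: "\<nu> {} = 0"
proof -
  have "(\<lambda>i::nat. \<nu> {}) sums \<nu> (\<Union>i::nat. {})"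
    using sums_UN[of "\<lambda>_. {}"] by (auto simp: disjoint_family_on_def)
  then show ?thesis by (simp add: sums_iff summable_const_iff)
qed

lemma measure_Un:
  assumes "A \<in> sets borel" "B \<in> sets borel" "A \<union> B \<subseteq> K" "A \<inter> B = {}"
  shows "\<nu> (A \<union> B) = \<nu> A + \<nu> B"
proof -
  have "(\<lambda>i. \<nu> (binaryset A B i)) sums \<nu> (\<Union>i. binaryset A B i)"
    using assms by (intro sums_UN) (auto simp: range_binaryset_eq UN_binaryset_eq disjoint_family_on_def binaryset_def split: if_splits)
  moreover have "(\<lambda>i. \<nu> (binaryset A B i)) sums (\<nu> A + \<nu> B)"
    by (rule binaryset_sums) simp
  ultimately show ?thesis by (simp add: UN_binaryset_eq sums_unique2)
qed

lemma measure_split: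
  assumes "A \<in> sets borel" "B \<in> sets borel" "A \<subseteq> K"
  shows "\<nu> A = \<nu> (A \<inter> B) + \<nu> (A - B)"
proof -
  have "\<nu> ((A \<inter> B) \<union> (A - B)) = \<nu> (A \<inter> B) + \<nu> (A - B)"
    using assms by (intro measure_Un) auto
  moreover have "(A \<inter> B) \<union> (A - B) = A" by auto
  ultimately show ?thesis by simp
qed

definition positive_set :: "'a set \<Rightarrow> bool" where
  "positive_set P \<longleftrightarrow> P \<in> sets borel \<and> P \<subseteq> K \<and> (\<forall>B\<in>sets borel. B \<subseteq> P \<longrightarrow> \<nu> B \<ge> 0)"

text \<open>The greedy choice for the exhaustion in \<open>positive_subset\<close>: \<open>B\<close>
  takes at least half of the most negative value available in \<open>X\<close>. The cap -1 covers
  the case where the infimum is not known to be finite.\<close>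

lemma very_negative_subset:
  assumes X: "X \<subseteq> K"
  shows "\<exists>B\<in>sets borel. B \<subseteq> X \<and> \<nu> B \<le> 0 \<and> (\<forall>C\<in>sets borel. C \<subseteq> X \<longrightarrow> \<nu> B \<le> max (\<nu> C / 2) (- 1))"
proof (cases "\<exists>C\<in>sets borel. C \<subseteq> X \<and> \<nu> C \<le> - 1")
  case True
  then obtain C where "C \<in> sets borel" "C \<subseteq> X" "\<nu> C \<le> - 1" by blast
  then show ?thesis by (intro bexI[of _ C]) (auto simp: le_max_iff_disj)
next
  case False
  let ?V = "\<nu> ` {C \<in> sets borel. C \<subseteq> X}"
  have bdd: "bdd_below ?V" using False by (intro bdd_belowI[of _ "-1"]) (auto simp: not_le less_imp_le)
  have lower: "Inf ?V \<le> \<nu> C" if "C \<in> sets borel" "C \<subseteq> X" for C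
    using that by (intro cInf_lower bdd) auto
  show ?thesis
  proof (cases "Inf ?V < 0")
    case True
    then have "\<exists>y\<in>?V. y < Inf ?V / 2" by (subst cInf_less_iff[symmetric, OF _ bdd]) auto
    then obtain B where "B \<in> sets borel" "B \<subseteq> X" "\<nu> B < Inf ?V / 2" by blast
    with True lower show ?thesis by (intro bexI[of _ B]) (auto simp: le_max_iff_disj intro: order_trans[OF less_imp_le])
  next
    case False
    then have "\<nu> C \<ge> 0" if "C \<in> sets borel" "C \<subseteq> X" for C using lower[OF that] by linarith
    then show ?thesis by (intro bexI[of _ "{}"]) (auto simp: le_max_iff_disj)
  qed
qed

text \<open>Greedily chosen negative sets \<open>B n\<close> are removed from \<open>A\<close>.
  Being disjoint, they have a convergent series of values, which hence tend to 0; a Borel set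
  \<open>C\<close> of negative value in the remainder would keep them all below the negative number
  max (\<nu> C / 2) (-1). Removing sets of nonpositive value does not lower \<nu>.\<close>

lemma positive_subset:
  assumes A: "A \<in> sets borel" "A \<subseteq> K"
  shows "\<exists>P. positive_set P \<and> P \<subseteq> A \<and> \<nu> A \<le> \<nu> P"
proof -
  obtain f where f: "\<And>X. X \<subseteq> K \<Longrightarrow> f X \<in> sets borel \<and> f X \<subseteq> X \<and> \<nu> (f X) \<le> 0 \<and>
      (\<forall>C\<in>sets borel. C \<subseteq> X \<longrightarrow> \<nu> (f X) \<le> max (\<nu> C / 2) (- 1))"
    using very_negative_subset by metis
  define X where "X = rec_nat A (\<lambda>_ Y. Y - f Y)"
  have X_simps: "X 0 = A" "X (Suc n) = X n - f (X n)" for n by (simp_all add: X_def)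
  have X_sub: "X n \<subseteq> A" for n by (induction n) (auto simp: X_simps)
  then have XK: "X n \<subseteq> K" for n using A by blast
  note fX = f[OF XK]
  have X_mono: "X n \<subseteq> X m" if "m \<le> n" for m n
    using that by (induction rule: dec_induct) (auto simp: X_simps)
  define B where "B n = f (X n)" for n
  have B: "B n \<in> sets borel" "B n \<subseteq> X n" "\<nu> (B n) \<le> 0" for n using fX[of n] by (auto simp: B_def)
  have disj: "disjoint_family B"
  proof -
    have "B m \<inter> B n = {}" if "m < n" for m n
      using B(2)[of n] X_mono[of "Suc m" n] that by (auto simp: X_simps B_def)
    then show ?thesis unfolding disjoint_family_on_def by (metis Int_commute linorder_neqE_nat)
  qed
  have UB: "(\<Union>n. B n) \<subseteq> A" using B(2) X_sub by blast
  then have sumsB: "(\<lambda>n. \<nu> (B n)) sums \<nu> (\<Union>n. B n)"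
    using A B(1) disj by (intro sums_UN) auto
  define P where "P = A - (\<Union>n. B n)"
  have P: "P \<in> sets borel" "P \<subseteq> A" using A B(1) by (auto simp: P_def)
  have PX: "P \<subseteq> X n" for n by (induction n) (auto simp: X_simps P_def B_def)
  have "\<nu> A = \<nu> (A \<inter> (\<Union>n. B n)) + \<nu> P"
    unfolding P_def using A B(1) by (intro measure_split) auto
  moreover have "A \<inter> (\<Union>n. B n) = (\<Union>n. B n)" using UB by blast
  moreover have "\<nu> (\<Union>n. B n) \<le> 0"
    by (rule sums_le[OF _ sumsB sums_zero]) (rule B(3))
  ultimately have le: "\<nu> A \<le> \<nu> P" by simp
  have "\<nu> C \<ge> 0" if C: "C \<in> sets borel" "C \<subseteq> P" for C
  proof (rule ccontr)
    assume neg: "\<not> \<nu> C \<ge> 0"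
    have "\<nu> (B n) \<le> max (\<nu> C / 2) (- 1)" for n
      using fX[of n] C PX[of n] by (auto simp: B_def)
    moreover have "(\<lambda>n. \<nu> (B n)) \<longlonglongrightarrow> 0"
      using sums_summable[OF sumsB] by (rule summable_LIMSEQ_zero)
    ultimately have "0 \<le> max (\<nu> C / 2) (- 1)" by (intro LIMSEQ_le_const2) auto
    with neg show False by (auto simp: le_max_iff_disj)
  qed
  then have "positive_set P" using P A by (auto simp: positive_set_def)
  with P le show ?thesis by blast
qed

lemma positive_nonneg: "positive_set P \<Longrightarrow> B \<in> sets borel \<Longrightarrow> B \<subseteq> P \<Longrightarrow> \<nu> B \<ge> 0"
  by (auto simp: positive_set_def)

lemma positive_UN:
  fixes P :: "nat \<Rightarrow> 'a set"
  assumes P: "\<And>n. positive_set (P n)"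
  shows "positive_set (\<Union>n. P n)"
proof -
  have "\<nu> B \<ge> 0" if B: "B \<in> sets borel" "B \<subseteq> (\<Union>n. P n)" for B
  proof -
    have P': "P n \<in> sets borel" "P n \<subseteq> K" for n using P by (auto simp: positive_set_def)
    have Q: "disjointed P n \<in> sets borel" for n
      using sets.range_disjointed_sets[of P borel] P'(1) by auto
    have "(\<lambda>n. \<nu> (B \<inter> disjointed P n)) sums \<nu> (\<Union>n. B \<inter> disjointed P n)"
    proof (rule sums_UN)
      show "(\<Union>n. B \<inter> disjointed P n) \<subseteq> K" using disjointed_subset[of P] P'(2) by blast
      show "disjoint_family (\<lambda>n. B \<inter> disjointed P n)"
        using disjoint_family_disjointed[of P] by (rule disjoint_family_on_bisimulation) blast
    qed (use Q B in auto)
    moreover have "(\<Union>n. B \<inter> disjointed P n) = B" using B(2) UN_disjointed_eq[of P] by blast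
    moreover have "\<nu> (B \<inter> disjointed P n) \<ge> 0" for n
      using Q B(1) disjointed_subset[of P n] by (intro positive_nonneg[OF P[of n]]) auto
    ultimately show ?thesis using sums_le[OF _ sums_zero] by metis
  qed
  then show ?thesis using P unfolding positive_set_def by auto
qed

lemma positive_mono:
  assumes "positive_set P" "A \<in> sets borel" "B \<in> sets borel" "A \<subseteq> B" "B \<subseteq> P"
  shows "\<nu> A \<le> \<nu> B"
proof -
  have "\<nu> B = \<nu> (B \<inter> A) + \<nu> (B - A)" using assms by (intro measure_split) (auto simp: positive_set_def)
  moreover have "\<nu> (B - A) \<ge> 0" using assms by (intro positive_nonneg[OF assms(1)]) auto
  moreover have "B \<inter> A = A" using assms by auto
  ultimately show ?thesis by simp
qed

text \<open>\<open>P\<close> is a positive set of maximal value. A subset of K - P of positive value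
  would contain a positive set of positive value, and adjoining it to \<open>P\<close> would exceed
  the maximum.\<close>

theorem Hahn_decomposition:
  obtains P where "P \<in> sets borel" "P \<subseteq> K"
    "\<And>B. B \<in> sets borel \<Longrightarrow> B \<subseteq> P \<Longrightarrow> \<nu> B \<ge> 0" "\<And>B. B \<in> sets borel \<Longrightarrow> B \<subseteq> K - P \<Longrightarrow> \<nu> B \<le> 0"
proof -
  let ?V = "\<nu> ` Collect positive_set"
  have pos_empty: "positive_set {}" by (simp add: positive_set_def)
  \<comment> \<open>One positive set dominates a whole sequence of bounds. With g n = n this shows
    that the supremum is finite, and with g n = Sup - 1/(n+1) that it is attained.\<close>
  have union: "\<exists>P. positive_set P \<and> (\<forall>n. g n \<le> \<nu> P)" if g: "\<And>n::nat. \<exists>Q. positive_set Q \<and> g n \<le> \<nu> Q" for g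
  proof -
    obtain Q where Q: "\<And>n. positive_set (Q n)" "\<And>n. g n \<le> \<nu> (Q n)" using g by metis
    have U: "positive_set (\<Union>n. Q n)" by (rule positive_UN[OF Q(1)])
    have "\<nu> (Q n) \<le> \<nu> (\<Union>n. Q n)" for n
      using Q(1)[of n] U by (intro positive_mono[OF U]) (auto simp: positive_set_def)
    with U Q(2) show ?thesis by (meson order_trans)
  qed
  have bdd: "bdd_above ?V"
  proof (rule ccontr)
    assume "\<not> bdd_above ?V"
    then have "\<exists>Q. positive_set Q \<and> real n \<le> \<nu> Q" for n
      unfolding bdd_above_def by (metis imageE linear mem_Collect_eq)
    then obtain P where "\<And>n. real n \<le> \<nu> P" using union[of real] by blast
    then show False using reals_Archimedean2[of "\<nu> P"] by (meson not_le)
  qed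
  have "\<exists>Q. positive_set Q \<and> Sup ?V - 1 / Suc n \<le> \<nu> Q" for n
  proof -
    have "\<exists>y\<in>?V. Sup ?V - 1 / Suc n < y"
      using pos_empty by (subst less_cSup_iff[symmetric, OF _ bdd]) auto
    then show ?thesis by (auto intro: less_imp_le)
  qed
  then obtain P where P: "positive_set P" "\<And>n. Sup ?V - 1 / Suc n \<le> \<nu> P"
    using union[of "\<lambda>n. Sup ?V - 1 / Suc n"] by blast
  have "(\<lambda>n. Sup ?V - 1 / Suc n) \<longlonglongrightarrow> Sup ?V - 0"
    by (intro tendsto_intros LIMSEQ_Suc[OF lim_1_over_n])
  then have "Sup ?V \<le> \<nu> P" using P(2) by (intro LIMSEQ_le_const2) auto
  then have max: "\<nu> Q \<le> \<nu> P" if "positive_set Q" for Q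
    using cSup_upper[OF imageI bdd, of Q] that by auto
  have "\<nu> B \<le> 0" if B: "B \<in> sets borel" "B \<subseteq> K - P" for B
  proof -
    obtain Q where Q: "positive_set Q" "Q \<subseteq> B" "\<nu> B \<le> \<nu> Q" using positive_subset[of B] B by auto
    \<comment> \<open>The union of two sets is written as a countable one in order to use
      \<open>positive_UN\<close>.\<close>
    have "positive_set (\<Union>n::nat. if n = 0 then P else Q)" by (rule positive_UN) (use P Q in auto)
    moreover have "(\<Union>n::nat. if n = 0 then P else Q) = P \<union> Q" by (auto split: if_splits)
    ultimately have "\<nu> (P \<union> Q) \<le> \<nu> P" using max by simp
    moreover have "\<nu> (P \<union> Q) = \<nu> P + \<nu> Q"
      using P(1) Q B by (intro measure_Un) (auto simp: positive_set_def)
    ultimately show ?thesis using Q by simp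
  qed
  then show ?thesis using that P(1) by (auto simp: positive_set_def)
qed

text \<open>The restriction of \<nu> to \<open>P\<close>, as a measure on the whole space; the
  truncation in \<open>ennreal\<close> is harmless when \<open>P\<close> is a positive set.\<close>

definition part :: "'a set \<Rightarrow> 'a measure" where
  "part P = measure_of UNIV (sets borel) (\<lambda>A. ennreal (\<nu> (A \<inter> P)))"

lemma sets_part [simp]: "sets (part P) = sets borel" and space_part [simp]: "space (part P) = UNIV"
  unfolding part_def using sets.sigma_sets_eq[of "borel :: 'a measure"]
  by (auto simp: sets_measure_of_conv space_measure_of_conv)

lemma emeasure_part:
  assumes P: "P \<in> sets borel" "P \<subseteq> K" "\<And>B. B \<in> sets borel \<Longrightarrow> B \<subseteq> P \<Longrightarrow> \<nu> B \<ge> 0"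
    and A: "A \<in> sets borel"
  shows "emeasure (part P) A = ennreal (\<nu> (A \<inter> P))"
  unfolding part_def
proof (rule emeasure_measure_of_sigma)
  show "sigma_algebra UNIV (sets (borel :: 'a measure))"
    using sets.sigma_algebra_axioms[of "borel :: 'a measure"] by simp
  show "Sigma_Algebra.positive (sets borel) (\<lambda>A. ennreal (\<nu> (A \<inter> P)))"
    by (simp add: Sigma_Algebra.positive_def)
  show "countably_additive (sets borel) (\<lambda>A. ennreal (\<nu> (A \<inter> P)))"
  proof (rule countably_additiveI)
    fix E :: "nat \<Rightarrow> 'a set" assume E: "range E \<subseteq> sets borel" "disjoint_family E"
    have "(\<lambda>i. \<nu> (E i \<inter> P)) sums \<nu> (\<Union>i. E i \<inter> P)"
    proof (rule sums_UN)
      show "disjoint_family (\<lambda>i. E i \<inter> P)"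
        using E(2) by (rule disjoint_family_on_bisimulation) blast
    qed (use E(1) P in auto)
    then have sm: "(\<lambda>i. \<nu> (E i \<inter> P)) sums \<nu> ((\<Union>i. E i) \<inter> P)" by (simp only: Int_UN_distrib2 UN_extend_simps)
    have "\<nu> (E i \<inter> P) \<ge> 0" for i using E(1) P(1) by (intro P(3)) auto
    from suminf_ennreal2[OF this sums_summable[OF sm]]
    show "(\<Sum>i. ennreal (\<nu> (E i \<inter> P))) = ennreal (\<nu> ((\<Union>i. E i) \<inter> P))"
      by (simp only: sums_unique[OF sm, symmetric])
  qed
qed (rule A)

lemma measure_part:
  assumes P: "P \<in> sets borel" "P \<subseteq> K" "\<And>B. B \<in> sets borel \<Longrightarrow> B \<subseteq> P \<Longrightarrow> \<nu> B \<ge> 0"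
    and A: "A \<in> sets borel"
  shows "measure (part P) A = \<nu> (A \<inter> P)"
  using emeasure_part[OF assms] P A by (simp add: measure_def)

lemma finite_measure_part:
  assumes P: "P \<in> sets borel" "P \<subseteq> K" "\<And>B. B \<in> sets borel \<Longrightarrow> B \<subseteq> P \<Longrightarrow> \<nu> B \<ge> 0"
  shows "finite_measure (part P)"
  by (rule finite_measureI) (simp add: emeasure_part[OF P])

end

lemma finite_signed_measure_uminus:
  "finite_signed_measure K \<nu> \<Longrightarrow> finite_signed_measure K (\<lambda>A. - \<nu> A)"
  unfolding finite_signed_measure_def by (auto intro!: sums_minus)

section \<open>Locally finite signed measures on a compact set\<close>

lemma relcompact_borel_compact:
  assumes "compact K" "K \<subseteq> \<Omega>" "A \<in> sets borel" "A \<subseteq> K"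
  shows "A \<in> relcompact_borel \<Omega>"
proof -
  have "closure A \<subseteq> K" using assms by (simp add: closure_minimal compact_imp_closed)
  moreover have "compact (closure A)"
    using compact_Int_closed[OF assms(1) closed_closure[of A]] calculation by (simp add: Int_absorb1)
  ultimately show ?thesis using assms by (auto simp: relcompact_borel_def)
qed

lemma finite_signed_measure_on_compact:
  assumes l: "locally_finite_signed_measure \<Omega> \<nu>" and K: "compact K" "K \<subseteq> \<Omega>"
  shows "finite_signed_measure K \<nu>"
proof
  show "K \<in> sets borel" using K(1) by (simp add: borel_compact)
  fix A :: "nat \<Rightarrow> 'a set" assume A: "range A \<subseteq> sets borel" "(\<Union>i. A i) \<subseteq> K" "disjoint_family A"
  have "range A \<subseteq> relcompact_borel \<Omega>"
    using A by (auto intro!: relcompact_borel_compact[OF K])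
  moreover have "(\<Union>i. A i) \<in> relcompact_borel \<Omega>"
    using A by (intro relcompact_borel_compact[OF K]) auto
  ultimately show "(\<lambda>i. \<nu> (A i)) sums \<nu> (\<Union>i. A i)"
    using l A(3) unfolding locally_finite_signed_measure_def by blast
qed

text \<open>For Borel A inside \<open>K\<close>, the supremum that defines the positive part is
  attained at A \<inter> P. The two measures thus agree on \<open>K\<close>, and the integrand
  vanishes elsewhere.\<close>

lemma integral_positive_part:
  fixes \<phi> :: "'a::euclidean_space \<Rightarrow> real"
  assumes l: "locally_finite_signed_measure \<Omega> \<nu>" and \<Omega>: "open \<Omega>" and K: "compact K" "K \<subseteq> \<Omega>"
    and P: "P \<in> sets borel" "P \<subseteq> K" "\<And>B. B \<in> sets borel \<Longrightarrow> B \<subseteq> P \<Longrightarrow> \<nu> B \<ge> 0"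
    and N: "\<And>B. B \<in> sets borel \<Longrightarrow> B \<subseteq> K - P \<Longrightarrow> \<nu> B \<le> 0"
    and \<phi>: "\<And>x. x \<notin> K \<Longrightarrow> \<phi> x = 0"
  shows "integral\<^sup>L (positive_part \<Omega> \<nu>) \<phi> = integral\<^sup>L (finite_signed_measure.part \<nu> P) \<phi>"
proof -
  interpret finite_signed_measure K \<nu> by (rule finite_signed_measure_on_compact[OF l K])
  let ?M = "positive_part \<Omega> \<nu>"
  have \<Omega>': "\<Omega> \<in> sets borel" and K': "K \<in> sets borel" using \<Omega> K by (auto simp: borel_compact)
  have posP: "positive_set P" using P by (auto simp: positive_set_def)
  have Pow: "sets (restrict_space borel \<Omega>) \<subseteq> Pow \<Omega>"
    using sets.sets_into_space[of _ "restrict_space borel \<Omega>"] by (auto simp: space_restrict_space)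
  have space: "space ?M = \<Omega>" unfolding positive_part_def using Pow by (rule space_measure_of)
  have sets: "sets ?M = sets (restrict_space borel \<Omega>)"
    unfolding positive_part_def
    using Pow sets.sigma_sets_eq[of "restrict_space borel \<Omega>"] by (simp add: sets_measure_of space_restrict_space)
  have eq: "emeasure ?M A = emeasure (part P) A" if A: "A \<in> sets borel" "A \<subseteq> K" for A
  proof -
    have "emeasure ?M A = (SUP B \<in> {B \<in> relcompact_borel \<Omega>. B \<subseteq> A}. ennreal (\<nu> B))"
      using A K by (intro emeasure_positive_part[OF l \<Omega>']) auto
    also have "\<dots> = ennreal (\<nu> (A \<inter> P))"
    proof (rule antisym)
      show "(SUP B \<in> {B \<in> relcompact_borel \<Omega>. B \<subseteq> A}. ennreal (\<nu> B)) \<le> ennreal (\<nu> (A \<inter> P))"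
      proof (rule SUP_least, rule ennreal_leI)
        fix B assume "B \<in> {B \<in> relcompact_borel \<Omega>. B \<subseteq> A}"
        then have B: "B \<in> sets borel" "B \<subseteq> A" by (auto simp: relcompact_borel_def)
        have "\<nu> B = \<nu> (B \<inter> P) + \<nu> (B - P)" using A B P(1) by (intro measure_split) auto
        also have "\<nu> (B - P) \<le> 0" using A B P(1) by (intro N) auto
        also have "\<nu> (B \<inter> P) \<le> \<nu> (A \<inter> P)" using A B P(1) by (intro positive_mono[OF posP]) auto
        finally show "\<nu> B \<le> \<nu> (A \<inter> P)" by simp
      qed
      show "ennreal (\<nu> (A \<inter> P)) \<le> (SUP B \<in> {B \<in> relcompact_borel \<Omega>. B \<subseteq> A}. ennreal (\<nu> B))"
        using A P by (intro SUP_upper) (auto intro!: relcompact_borel_compact[OF K])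
    qed
    finally show ?thesis by (simp add: emeasure_part[OF P A(1)])
  qed
  \<comment> \<open>The measures live on different spaces, \<Omega> and the whole space, so they can
    be equated only after restriction to \<open>K\<close>.\<close>
  have "restrict_space ?M K = restrict_space (part P) K"
  proof (rule measure_eqI)
    have "sets (restrict_space ?M K) = sets (restrict_space (restrict_space borel \<Omega>) K)"
      by (rule sets_restrict_space_cong[OF sets])
    also have "\<dots> = sets (restrict_space borel (\<Omega> \<inter> K))"
      using \<Omega>' K' by (subst restrict_restrict_space) (auto simp: space_restrict_space sets_restrict_space_iff)
    also have "\<Omega> \<inter> K = K" using K by auto
    also have "sets (restrict_space borel K) = sets (restrict_space (part P) K)"
      by (rule sets_restrict_space_cong) simp
    finally show sets_eq: "sets (restrict_space ?M K) = sets (restrict_space (part P) K)" .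
    fix A assume "A \<in> sets (restrict_space ?M K)"
    then have "A \<in> sets (restrict_space (part P) K)" by (simp only: sets_eq)
    then have A: "A \<in> sets borel" "A \<subseteq> K"
      using K' by (auto simp: sets_restrict_space_iff)
    have "K \<inter> space ?M \<in> sets ?M"
      using K' \<Omega>' K(2) by (auto simp: sets space sets_restrict_space_iff)
    then show "emeasure (restrict_space ?M K) A = emeasure (restrict_space (part P) K) A"
      using eq[OF A] A K' by (simp add: emeasure_restrict_space)
  qed
  moreover have "K \<inter> space ?M \<in> sets ?M"
    using K' \<Omega>' K(2) by (auto simp: sets space sets_restrict_space_iff)
  then have "integral\<^sup>L (restrict_space ?M K) \<phi> = (\<integral>x. indicator K x *\<^sub>R \<phi> x \<partial>?M)"
    by (rule integral_restrict_space)
  moreover have "integral\<^sup>L (restrict_space (part P) K) \<phi> = (\<integral>x. indicator K x *\<^sub>R \<phi> x \<partial>part P)"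
    using K' by (intro integral_restrict_space) simp
  moreover have "(\<lambda>x. indicator K x *\<^sub>R \<phi> x) = \<phi>" using \<phi> by (auto simp: indicator_def fun_eq_iff)
  ultimately show ?thesis by simp
qed

text \<open>Each piece of a partition satisfies |\<nu>(E i)| <= \<nu>(E i \<inter> P) - \<nu>(E i -
  P), and the pieces add up. The lower bound on the total variation is thereby carried over to the
  sum of the two Hahn parts.\<close>

lemma total_variation_le:
  assumes l: "locally_finite_signed_measure \<Omega> \<nu>" and K: "compact K" "K \<subseteq> \<Omega>"
    and P: "P \<in> sets borel" "P \<subseteq> K" "\<And>B. B \<in> sets borel \<Longrightarrow> B \<subseteq> P \<Longrightarrow> \<nu> B \<ge> 0"
    and N: "\<And>B. B \<in> sets borel \<Longrightarrow> B \<subseteq> K - P \<Longrightarrow> \<nu> B \<le> 0"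
    and A: "A \<in> sets borel" "A \<subseteq> K"
  shows "total_variation \<Omega> \<nu> A \<le> emeasure (finite_signed_measure.part \<nu> P) A +
    emeasure (finite_signed_measure.part (\<lambda>B. - \<nu> B) (K - P)) A"
  unfolding total_variation_def
proof (rule SUP_least)
  interpret pos: finite_signed_measure K \<nu> by (rule finite_signed_measure_on_compact[OF l K])
  interpret neg: finite_signed_measure K "\<lambda>B. - \<nu> B"
    by (rule finite_signed_measure_uminus) (rule finite_signed_measure_on_compact[OF l K])
  have K': "K \<in> sets borel" using K by (simp add: borel_compact)
  fix E :: "nat \<Rightarrow> 'a set"
  assume "E \<in> {E. range E \<subseteq> relcompact_borel \<Omega> \<and> disjoint_family E \<and> (\<Union>i. E i) = A}"
  then have E: "range E \<subseteq> sets borel" "disjoint_family E" "(\<Union>i. E i) = A"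
    by (auto simp: relcompact_borel_def)
  have "ennreal \<bar>\<nu> (E i)\<bar> \<le> emeasure (pos.part P) (E i) + emeasure (neg.part (K - P)) (E i)" for i
  proof -
    have Ei: "E i \<in> sets borel" "E i \<subseteq> K" using E A by auto
    have "\<nu> (E i) = \<nu> (E i \<inter> P) + \<nu> (E i - P)" using Ei P by (intro pos.measure_split) auto
    moreover have "E i - P = E i \<inter> (K - P)" using Ei by auto
    moreover have "\<nu> (E i \<inter> P) \<ge> 0" "\<nu> (E i \<inter> (K - P)) \<le> 0" using Ei P K' by (auto intro!: P(3) N)
    ultimately have "ennreal \<bar>\<nu> (E i)\<bar> \<le> ennreal (\<nu> (E i \<inter> P) + (- \<nu> (E i \<inter> (K - P))))"
      by (intro ennreal_leI) auto
    also have "\<dots> = ennreal (\<nu> (E i \<inter> P)) + ennreal (- \<nu> (E i \<inter> (K - P)))"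
      using \<open>\<nu> (E i \<inter> P) \<ge> 0\<close> \<open>\<nu> (E i \<inter> (K - P)) \<le> 0\<close> by (intro ennreal_plus) auto
    also have "ennreal (\<nu> (E i \<inter> P)) = emeasure (pos.part P) (E i)"
      by (rule pos.emeasure_part[OF P Ei(1), symmetric])
    also have "ennreal (- \<nu> (E i \<inter> (K - P))) = emeasure (neg.part (K - P)) (E i)"
      using K' P(1) N Ei(1) by (intro neg.emeasure_part[symmetric]) auto
    finally show ?thesis .
  qed
  then have "(\<Sum>i. ennreal \<bar>\<nu> (E i)\<bar>) \<le> (\<Sum>i. emeasure (pos.part P) (E i) + emeasure (neg.part (K - P)) (E i))"
    by (intro suminf_le) auto
  also have "\<dots> = (\<Sum>i. emeasure (pos.part P) (E i)) + (\<Sum>i. emeasure (neg.part (K - P)) (E i))"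
    by (intro suminf_add[symmetric]) auto
  also have "\<dots> = emeasure (pos.part P) A + emeasure (neg.part (K - P)) A"
    using E by (simp add: suminf_emeasure)
  finally show "(\<Sum>i. ennreal \<bar>\<nu> (E i)\<bar>) \<le> emeasure (pos.part P) A + emeasure (neg.part (K - P)) A" .
qed

section \<open>Level sets\<close>

lemma continuous_bounded_of_support:
  fixes f :: "real \<Rightarrow> real"
  assumes "continuous_on UNIV f" "\<And>s. s \<ge> 1 \<Longrightarrow> f s = 0"
  obtains C where "\<And>s. s \<ge> 0 \<Longrightarrow> \<bar>f s\<bar> \<le> C"
proof -
  have "bounded (f ` {0..1})"
    using assms(1) by (intro compact_imp_bounded compact_continuous_image) (auto intro: continuous_on_subset)
  then obtain C where "\<forall>y \<in> f ` {0..1}. norm y \<le> C" unfolding bounded_iff by blast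
  then have C: "\<bar>f s\<bar> \<le> C" if "s \<in> {0..1}" for s using that by auto
  have "\<bar>f s\<bar> \<le> C" if "s \<ge> 0" for s
    using C[of s] C[of 1] assms(2)[of s] assms(2)[of 1] that by (cases "s \<le> 1") auto
  then show ?thesis by (rule that)
qed

section \<open>The kernels as test functions\<close>

context radial_kernels begin

lemma laplacian_kernel:
  fixes x :: "'a::euclidean_space"
  assumes h: "smooth h"
    and profile: "\<And>s. 4 * s * deriv (deriv h) s + 2 * DIM('a) * deriv h s = 2 ^ DIM('a) * p (4 * s) - p s"
    and t: "t > 0"
  shows "laplacian (\<lambda>y. h ((norm (y - x) / t)\<^sup>2)) y =
    (2 ^ DIM('a) * p (4 * (norm (y - x) / t)\<^sup>2) - p ((norm (y - x) / t)\<^sup>2)) / t\<^sup>2"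
proof -
  have eq: "(norm (y - x) / t)\<^sup>2 = inverse (t\<^sup>2) * (norm (y - x))\<^sup>2" for y
    by (simp add: power_divide divide_inverse power_mult_distrib power_inverse)
  show ?thesis
    unfolding eq laplacian_radial[OF h] profile by (simp add: divide_inverse)
qed

lemma test_function_kernel:
  fixes x :: "'a::euclidean_space"
  assumes h: "smooth h" and t: "t > 0" "cball x t \<subseteq> \<Omega>"
  shows "test_function \<Omega> (\<lambda>y. h ((norm (y - x) / t)\<^sup>2))"
proof -
  have "smooth (\<lambda>y. h (inverse (t\<^sup>2) * (norm (y - x))\<^sup>2))"
    by (rule smooth_compose[OF h smooth_norm_square])
  then have "smooth (\<lambda>y. h ((norm (y - x) / t)\<^sup>2))"
    by (simp add: divide_inverse power_mult_distrib power_inverse mult.commute)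
  moreover have sub: "closure {y. h ((norm (y - x) / t)\<^sup>2) \<noteq> 0} \<subseteq> cball x t"
    using h_supp[OF supp[OF t(1), of _ x]] by (intro closure_minimal) blast+
  moreover have "compact (closure {y. h ((norm (y - x) / t)\<^sup>2) \<noteq> 0})"
    using sub by (simp add: compact_eq_bounded_closed bounded_subset[OF bounded_cball])
  ultimately show ?thesis using t(2) unfolding test_function_def by blast
qed

end

lemma integrable_bounded_mult:
  fixes f g :: "'a \<Rightarrow> real"
  assumes "integrable M f" "g \<in> borel_measurable M" "\<And>x. \<bar>g x\<bar> \<le> C"
  shows "integrable M (\<lambda>x. f x * g x)"
proof (rule Bochner_Integration.integrable_bound)
  show "integrable M (\<lambda>x. C * f x)" using assms(1) by simp
  show "AE x in M. norm (f x * g x) \<le> norm (C * f x)"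
  proof (rule AE_I2)
    fix x
    have "\<bar>g x\<bar> \<le> \<bar>C\<bar>" using assms(3)[of x] by linarith
    then show "norm (f x * g x) \<le> norm (C * f x)"
      using mult_left_mono[of "\<bar>g x\<bar>" "\<bar>C\<bar>" "\<bar>f x\<bar>"] by (simp add: abs_mult mult.commute)
  qed
qed (use assms in auto)

text \<open>The test function is the \<open>h\<close> kernel. Its Laplacian vanishes outside the
  closed ball and has zero integral, so \<open>u\<close> can be cut off, shifted by \<alpha> and
  replaced by the Borel version \<open>v\<close> without changing the tested integral.\<close>

lemma local_laplacian_of_distributional:
  fixes u v :: "'a::euclidean_space \<Rightarrow> real"
  assumes kernels: "radial_kernels h p Ch Cp" and h: "smooth h"
    and profile: "\<And>s. 4 * s * deriv (deriv h) s + 2 * DIM('a) * deriv h s = 2 ^ DIM('a) * p (4 * s) - p s"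
    and \<Omega>: "open \<Omega>" "cball z R \<subseteq> \<Omega>"
    and \<nu>: "locally_finite_signed_measure \<Omega> \<nu>" and lap: "has_distributional_laplacian u \<nu> \<Omega>"
    and u: "set_integrable lebesgue (cball z R) u"
    and v: "integrable lborel v" "AE x in lebesgue. indicator (cball z R) x * (u x - \<alpha>) = v x"
    and P: "P \<in> sets borel" "P \<subseteq> cball z R" "\<And>B. B \<in> sets borel \<Longrightarrow> B \<subseteq> P \<Longrightarrow> \<nu> B \<ge> 0"
    and N: "\<And>B. B \<in> sets borel \<Longrightarrow> B \<subseteq> cball z R - P \<Longrightarrow> \<nu> B \<le> 0"
  shows "local_laplacian h p Ch Cp v (finite_signed_measure.part \<nu> P)
    (finite_signed_measure.part (\<lambda>B. - \<nu> B) (cball z R - P)) z R"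
proof -
  let ?K = "cball z R"
  interpret radial_kernels h p Ch Cp by (rule kernels)
  interpret pos: finite_signed_measure ?K \<nu>
    by (rule finite_signed_measure_on_compact[OF \<nu>]) (use \<Omega> in auto)
  interpret neg: finite_signed_measure ?K "\<lambda>B. - \<nu> B"
    by (rule finite_signed_measure_uminus) (rule pos.finite_signed_measure_axioms)
  have \<nu>': "locally_finite_signed_measure \<Omega> (\<lambda>B. - \<nu> B)"
    using \<nu> unfolding locally_finite_signed_measure_def by (auto intro!: sums_minus)
  have N': "?K - P \<in> sets borel" "?K - P \<subseteq> ?K" "\<And>B. B \<in> sets borel \<Longrightarrow> B \<subseteq> ?K - P \<Longrightarrow> - \<nu> B \<ge> 0"
    using P N by auto
  have [measurable]: "v \<in> borel_measurable borel" using borel_measurable_integrable[OF v(1)] by simp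
  show ?thesis
  proof (intro local_laplacian.intro kernels local_laplacian_axioms.intro)
    show "finite_measure (pos.part P)" by (rule pos.finite_measure_part[OF P])
    show "finite_measure (neg.part (?K - P))" by (rule neg.finite_measure_part[OF N'])
    fix x :: 'a and t :: real assume t: "t > 0" "cball x t \<subseteq> ?K"
    define \<phi> where "\<phi> y = h ((norm (y - x) / t)\<^sup>2)" for y
    define g where "g y = 2 ^ DIM('a) * p (4 * (norm (y - x) / t)\<^sup>2) - p ((norm (y - x) / t)\<^sup>2)" for y
    have \<phi>0: "\<phi> y = 0" if "y \<notin> ?K" for y
      unfolding \<phi>_def using that t by (intro h_supp supp) auto
    have half: "4 * (norm (y - x) / t)\<^sup>2 = (norm (y - x) / (t / 2))\<^sup>2" for y
      by (simp add: power_divide power_mult_distrib)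
    have g0: "g y = 0" if "y \<notin> ?K" for y
    proof -
      have "(norm (y - x) / t)\<^sup>2 \<ge> 1" using that t by (intro supp) auto
      then show ?thesis by (simp add: g_def p_supp)
    qed
    have g_bound: "\<bar>g y\<bar> \<le> 2 ^ DIM('a) * Cp + Cp" for y
    proof -
      have "\<bar>2 ^ DIM('a) * p (4 * (norm (y - x) / t)\<^sup>2)\<bar> \<le> 2 ^ DIM('a) * Cp"
        by (simp add: abs_mult p_bound)
      then show ?thesis
        using p_bound[OF zero_le_power2, of "norm (y - x) / t"] unfolding g_def by linarith
    qed
    have g_meas [measurable]: "g \<in> borel_measurable borel" unfolding g_def by measurable
    have lap_\<phi>: "laplacian \<phi> y = g y / t\<^sup>2" for y
      unfolding \<phi>_def g_def by (rule laplacian_kernel[OF h profile t(1)])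
    have "test_function \<Omega> \<phi>"
      unfolding \<phi>_def using t \<Omega> by (intro test_function_kernel h) auto
    then have "set_lebesgue_integral lebesgue \<Omega> (\<lambda>y. u y * laplacian \<phi> y) = signed_integral \<Omega> \<nu> \<phi>"
      using lap by (simp add: has_distributional_laplacian_def)
    also have "\<dots> = integral\<^sup>L (pos.part P) \<phi> - integral\<^sup>L (neg.part (?K - P)) \<phi>"
    proof -
      have "integral\<^sup>L (positive_part \<Omega> \<nu>) \<phi> = integral\<^sup>L (pos.part P) \<phi>"
        by (rule integral_positive_part[OF \<nu> \<Omega>(1) compact_cball \<Omega>(2) P N \<phi>0])
      moreover have "integral\<^sup>L (positive_part \<Omega> (\<lambda>B. - \<nu> B)) \<phi> = integral\<^sup>L (neg.part (?K - P)) \<phi>"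
        by (rule integral_positive_part[OF \<nu>' \<Omega>(1) compact_cball \<Omega>(2) N' _ \<phi>0]) (use P in auto)
      ultimately show ?thesis by (simp add: signed_integral_def negative_part_def)
    qed
    finally have 1: "t\<^sup>2 * set_lebesgue_integral lebesgue \<Omega> (\<lambda>y. u y * laplacian \<phi> y) =
      t\<^sup>2 * (integral\<^sup>L (pos.part P) \<phi> - integral\<^sup>L (neg.part (?K - P)) \<phi>)" by simp
    \<comment> \<open>The kernels at scales t/2 and t have masses (t/2)^N and t^N times the same
      constant, and the factor 2^N balances them.\<close>
    have int_g: "integrable lborel g" "integral\<^sup>L lborel g = 0"
    proof -
      show "integrable lborel g"
        unfolding g_def half using t by (intro Bochner_Integration.integrable_diff integrable_mult_right integrable_p_kernel) auto
      have "integral\<^sup>L lborel g = 2 ^ DIM('a) * (\<integral>y. p ((norm (y - x) / (t / 2))\<^sup>2) \<partial>lborel) - (\<integral>y. p ((norm (y - x) / t)\<^sup>2) \<partial>lborel)"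
        unfolding g_def half using t integrable_p_kernel[of t x] integrable_p_kernel[of "t / 2" x] by simp
      also have "\<dots> = 0"
        using t(1) integral_p_kernel[of "t / 2" x] integral_p_kernel[of t x] by (simp only: power_divide) simp
      finally show "integral\<^sup>L lborel g = 0" .
    qed
    have g_leb: "integrable lebesgue g" "integral\<^sup>L lebesgue g = 0"
      using int_g by (simp_all add: integrable_completion integral_completion)
    have g_leb_meas: "g \<in> borel_measurable lebesgue"
      using g_meas by (simp add: measurable_completion)
    have uK: "integrable lebesgue (\<lambda>y. indicator ?K y * u y)"
      using u by (simp add: set_integrable_def)
    have ug: "integrable lebesgue (\<lambda>y. (indicator ?K y * u y) * g y)"
      by (rule integrable_bounded_mult[OF uK g_leb_meas g_bound])
    have "t\<^sup>2 * set_lebesgue_integral lebesgue \<Omega> (\<lambda>y. u y * laplacian \<phi> y) =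
        (\<integral>y. t\<^sup>2 * (indicator \<Omega> y * (u y * laplacian \<phi> y)) \<partial>lebesgue)"
      by (simp add: set_lebesgue_integral_def)
    also have "\<dots> = (\<integral>y. (indicator ?K y * u y) * g y \<partial>lebesgue)"
      using t(1) \<Omega>(2) g0 by (intro Bochner_Integration.integral_cong refl) (auto simp: lap_\<phi> indicator_def)
    also have "\<dots> = (\<integral>y. (indicator ?K y * u y) * g y - \<alpha> * g y \<partial>lebesgue)"
      using ug g_leb by simp
    also have "\<dots> = (\<integral>y. v y * g y \<partial>lebesgue)"
    proof (rule integral_cong_AE)
      show "(\<lambda>y. v y * g y) \<in> borel_measurable lebesgue"
        by (rule measurable_completion) measurable
      show "(\<lambda>y. (indicator ?K y * u y) * g y - \<alpha> * g y) \<in> borel_measurable lebesgue"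
        using ug g_leb by (intro borel_measurable_integrable) simp
      show "AE y in lebesgue. (indicator ?K y * u y) * g y - \<alpha> * g y = v y * g y"
        using v(2)
      proof eventually_elim
        case (elim y)
        then show ?case using g0[of y] by (cases "y \<in> ?K") (auto simp: left_diff_distrib[symmetric])
      qed
    qed
    also have "\<dots> = (\<integral>y. v y * g y \<partial>lborel)"
      by (rule integral_completion) measurable
    finally show "(\<integral>y. v y * (2 ^ DIM('a) * p (4 * (norm (y - x) / t)\<^sup>2) - p ((norm (y - x) / t)\<^sup>2)) \<partial>lborel) =
      t\<^sup>2 * ((\<integral>y. h ((norm (y - x) / t)\<^sup>2) \<partial>pos.part P) - (\<integral>y. h ((norm (y - x) / t)\<^sup>2) \<partial>neg.part (?K - P)))"
      using 1 unfolding g_def \<phi>_def[abs_def] by simp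
  qed (auto simp: v(1))
qed

text \<open>Reduces the negative Hahn set to the positive one: -v has the same zero set as
  v.\<close>

lemma local_laplacian_uminus:
  fixes v :: "'a::euclidean_space \<Rightarrow> real"
  assumes "local_laplacian h p Ch Cp v M1 M2 z R"
  shows "local_laplacian h p Ch Cp (\<lambda>x. - v x) M2 M1 z R"
proof -
  interpret local_laplacian h p Ch Cp v M1 M2 z R by (rule assms)
  show ?thesis
  proof (intro local_laplacian.intro local_laplacian_axioms.intro radial_kernels_axioms M1 M2)
    fix x and t :: real assume t: "t > 0" "cball x t \<subseteq> cball z R"
    show "(\<integral>y. - v y * (2 ^ DIM('a) * p (4 * (norm (y - x) / t)\<^sup>2) - p ((norm (y - x) / t)\<^sup>2)) \<partial>lborel) =
        t\<^sup>2 * ((\<integral>y. h ((norm (y - x) / t)\<^sup>2) \<partial>M2) - (\<integral>y. h ((norm (y - x) / t)\<^sup>2) \<partial>M1))"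
      unfolding mult_minus_left integral_minus laplace[OF t] by (simp add: right_diff_distrib)
  qed (use v_int in simp)
qed

lemma scaled_content_le_total_variation:
  fixes \<theta> :: "'a::euclidean_space \<Rightarrow> real"
  assumes dom: "(\<integral>\<^sup>+x\<in>A. ennreal (\<theta> x) \<partial>lborel) \<le> m1 + m2" and A: "A \<in> sets borel"
    and c: "\<And>x. x \<in> A \<Longrightarrow> c < \<theta> x"
  shows "ennreal c * emeasure lborel A \<le> m1 + m2"
proof -
  have "ennreal c * emeasure lborel A = (\<integral>\<^sup>+x. ennreal c * indicator A x \<partial>lborel)"
    using A by (subst nn_integral_cmult_indicator) auto
  also have "\<dots> \<le> (\<integral>\<^sup>+x\<in>A. ennreal (\<theta> x) \<partial>lborel)"
    using c by (intro nn_integral_mono) (auto simp: indicator_def intro!: ennreal_leI dest: less_imp_le)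
  finally show ?thesis using dom by simp
qed

text \<open>Up to null sets, the level set is divided by the Hahn set \<open>P\<close> and exhausted
  by the sets where \<theta> > 1/(n+1). On each piece \<open>null_if_dominated\<close> applies with
  c = 1/(n+1).\<close>

lemma negligible_level_set_in_ball:
  fixes u \<theta> :: "'a::euclidean_space \<Rightarrow> real"
  assumes \<Omega>: "open \<Omega>" "cball z R \<subseteq> \<Omega>"
    and u: "locally_integrable \<Omega> u"
    and \<nu>: "locally_finite_signed_measure \<Omega> \<nu>" and lap: "has_distributional_laplacian u \<nu> \<Omega>"
    and \<theta>: "\<theta> \<in> borel_measurable (restrict_space borel \<Omega>)" "AE x in lborel. x \<in> \<Omega> \<longrightarrow> \<theta> x > 0"
    and dom: "\<And>A. A \<in> sets borel \<Longrightarrow> A \<subseteq> \<Omega> \<Longrightarrow> (\<integral>\<^sup>+x\<in>A. ennreal (\<theta> x) \<partial>lborel) \<le> total_variation \<Omega> \<nu> A"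
  shows "negligible {x \<in> ball z R. u x = \<alpha>}"
proof -
  let ?K = "cball z R"
  have uK: "set_integrable lebesgue ?K u"
    using u \<Omega>(2) by (simp add: locally_integrable_def)
  obtain h p :: "real \<Rightarrow> real" where h: "smooth h" "\<And>s. s \<ge> 1 \<Longrightarrow> h s = 0" "\<And>s. h s \<le> 0" "h 0 < 0"
    and profile: "\<And>s. 4 * s * deriv (deriv h) s + 2 * DIM('a) * deriv h s = 2 ^ DIM('a) * p (4 * s) - p s"
    and p: "continuous_on UNIV p" "\<And>s. s \<ge> 1 \<Longrightarrow> p s = 0" "\<And>s. p s \<ge> 0" "\<And>s. 0 < s \<Longrightarrow> s < 1 \<Longrightarrow> p s > 0"
    using radial_profiles[OF DIM_positive[where 'a='a]] by metis
  have h_cont: "continuous_on UNIV h" by (rule smooth_continuous_on[OF h(1)])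
  obtain Ch where Ch: "\<And>s. s \<ge> 0 \<Longrightarrow> \<bar>h s\<bar> \<le> Ch" using continuous_bounded_of_support[OF h_cont h(2)] by blast
  obtain Cp where Cp: "\<And>s. s \<ge> 0 \<Longrightarrow> \<bar>p s\<bar> \<le> Cp" using continuous_bounded_of_support[OF p(1,2)] by blast
  have kernels: "radial_kernels h p Ch Cp"
    by unfold_locales (use h_cont h(2) p Ch Cp in auto)
  obtain a where a: "0 < a" "a \<le> 1" "\<And>s. 0 \<le> s \<Longrightarrow> s \<le> a\<^sup>2 \<Longrightarrow> h s \<le> - (- h 0 / 2)"
  proof -
    have "\<forall>\<^sub>F s in nhds 0. h s < h 0 / 2"
      using h_cont h(4) by (intro order_tendstoD(2)) (auto simp: continuous_on_eq_continuous_at isCont_def tendsto_at_iff_tendsto_nhds)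
    then obtain d where d: "d > 0" "\<And>s. dist s 0 < d \<Longrightarrow> h s < h 0 / 2"
      by (auto simp: eventually_nhds_metric)
    \<comment> \<open>The profile variable is the squared radius; \<open>a\<close> at most 1 gives
      a^2 <= a < d, so \<open>h\<close> stays below half its value at 0.\<close>
    define a where "a = min 1 (d / 2)"
    have "h s \<le> - (- h 0 / 2)" if "0 \<le> s" "s \<le> a\<^sup>2" for s
    proof -
      have "a\<^sup>2 \<le> a * 1" unfolding power2_eq_square using d by (intro mult_left_mono) (auto simp: a_def)
      then have "dist s 0 < d" using that d by (auto simp: a_def dist_real_def)
      then show ?thesis using d(2)[of s] by simp
    qed
    then show ?thesis using that[of a] d by (auto simp: a_def)
  qed
  define w where "w x = indicator ?K x * (u x - \<alpha>)" for x
  have w_int: "integrable lebesgue w"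
  proof -
    have "integrable lebesgue (\<lambda>x. indicator ?K x *\<^sub>R u x - \<alpha> * indicator ?K x)"
      using uK unfolding set_integrable_def
      by (intro Bochner_Integration.integrable_diff integrable_mult_right integrable_real_indicator)
         (auto simp: emeasure_completion intro: emeasure_lborel_cball_finite[unfolded infinity_ennreal_def])
    also have "(\<lambda>x. indicator ?K x *\<^sub>R u x - \<alpha> * indicator ?K x) = w"
      by (auto simp: w_def fun_eq_iff indicator_def)
    finally show ?thesis .
  qed
  \<comment> \<open>\<open>u\<close> is only Lebesgue measurable on the ball; with the Borel version
    \<open>v\<close> the sets \<open>S n\<close> become Borel, as the Borel measures
    \<open>?M1\<close> and \<open>?M2\<close> require.\<close>
  obtain v where v: "v \<in> borel_measurable lborel" "AE x in lborel. w x = v x"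
    using completion_ex_borel_measurable_real[OF borel_measurable_integrable[OF w_int]] by blast
  have v_leb: "AE x in lebesgue. w x = v x" by (rule AE_completion[OF v(2)])
  have "integrable lebesgue v"
    using w_int v_leb v(1) borel_measurable_integrable[OF w_int]
    by (subst (asm) integrable_cong_AE) (auto intro: measurable_completion)
  then have v_int: "integrable lborel v" using v(1) by (simp add: integrable_completion)
  interpret fs: finite_signed_measure ?K \<nu>
    by (rule finite_signed_measure_on_compact[OF \<nu>]) (use \<Omega> in auto)
  interpret neg: finite_signed_measure ?K "\<lambda>B. - \<nu> B"
    by (rule finite_signed_measure_uminus) (rule fs.finite_signed_measure_axioms)
  obtain P where P: "P \<in> sets borel" "P \<subseteq> ?K" "\<And>B. B \<in> sets borel \<Longrightarrow> B \<subseteq> P \<Longrightarrow> \<nu> B \<ge> 0"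
    and N: "\<And>B. B \<in> sets borel \<Longrightarrow> B \<subseteq> ?K - P \<Longrightarrow> \<nu> B \<le> 0"
    using fs.Hahn_decomposition by blast
  have N': "?K - P \<in> sets borel" "?K - P \<subseteq> ?K" "\<And>B. B \<in> sets borel \<Longrightarrow> B \<subseteq> ?K - P \<Longrightarrow> - \<nu> B \<ge> 0"
    using P N by auto
  let ?M1 = "fs.part P" and ?M2 = "neg.part (?K - P)"
  have L: "local_laplacian h p Ch Cp v ?M1 ?M2 z R"
    using v_leb by (intro local_laplacian_of_distributional[OF kernels h(1) profile \<Omega> \<nu> lap uK v_int _ P N]) (auto simp: w_def)
  define S where "S n = {x \<in> ball z R. v x = 0} \<inter> {x \<in> \<Omega>. \<theta> x > 1 / Suc n}" for n :: nat
  have S: "S n \<in> sets borel" "S n \<subseteq> ball z R" for n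
  proof -
    have "{x \<in> space (restrict_space borel \<Omega>). \<theta> x > 1 / Suc n} \<in> sets (restrict_space borel \<Omega>)"
      using \<theta>(1) by measurable
    then have "{x \<in> \<Omega>. \<theta> x > 1 / Suc n} \<in> sets borel"
      using \<Omega>(1) by (auto simp: space_restrict_space sets_restrict_space_iff)
    moreover have "{x \<in> ball z R. v x = 0} \<in> sets borel" using v(1) by simp
    ultimately show "S n \<in> sets borel" unfolding S_def by blast
  qed (auto simp: S_def)
  have mass: "1 / Suc n * measure lborel A \<le> measure ?M1 A + measure ?M2 A"
    if A: "A \<in> sets borel" "A \<subseteq> S n" for n A
  proof -
    have AK: "A \<subseteq> ?K" using A S(2)[of n] ball_subset_cball by blast
    have fin: "finite_measure ?M1" "finite_measure ?M2"
      using fs.finite_measure_part[OF P] neg.finite_measure_part[OF N'] by blast+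
    have "(\<integral>\<^sup>+x\<in>A. ennreal (\<theta> x) \<partial>lborel) \<le> emeasure ?M1 A + emeasure ?M2 A"
      using dom[OF A(1)] AK \<Omega>(2) total_variation_le[OF \<nu> compact_cball \<Omega>(2) P N A(1) AK]
      by (meson order_trans)
    then have "ennreal (1 / Suc n) * emeasure lborel A \<le> emeasure ?M1 A + emeasure ?M2 A"
      by (rule scaled_content_le_total_variation) (use A in \<open>auto simp: S_def\<close>)
    moreover have "emeasure lborel A = ennreal (measure lborel A)"
      using fmeasurableD2[OF fmeasurable_subset_cball[OF A(1) AK]] by (intro emeasure_eq_ennreal_measure) auto
    ultimately have "ennreal (1 / Suc n * measure lborel A) \<le> ennreal (measure ?M1 A + measure ?M2 A)"
      by (simp add: finite_measure.emeasure_eq_measure[OF fin(1)] finite_measure.emeasure_eq_measure[OF fin(2)]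
          ennreal_mult[symmetric] ennreal_plus[symmetric] del: ennreal_plus)
    then show ?thesis by (subst (asm) ennreal_le_iff) auto
  qed
  have M1_N: "measure ?M1 A = 0" if "A \<in> sets borel" "A \<inter> P = {}" for A
    using that by (simp add: fs.measure_part[OF P])
  have M2_P: "measure ?M2 A = 0" if "A \<in> sets borel" "A \<subseteq> P" for A
  proof -
    have "A \<inter> (?K - P) = {}" using that by auto
    then show ?thesis using that by (simp add: neg.measure_part[OF N'])
  qed
  have b: "- h 0 / 2 > 0" using h(4) by simp
  have null: "negligible (S n \<inter> P)" "negligible (S n - P)" for n
  proof -
    show "negligible (S n \<inter> P)"
    proof (rule local_laplacian.null_if_dominated[OF L h(3) a b])
      show "S n \<inter> P \<in> sets borel" using S P(1) by auto
      \<comment> \<open>Inside \<open>P\<close> the part \<open>?M2\<close> has no mass, so the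
        joint lower bound \<open>mass\<close> falls on \<open>?M1\<close> alone.\<close>
      show "1 / Suc n * measure lborel A \<le> measure ?M1 A" if "A \<in> sets borel" "A \<subseteq> S n \<inter> P" for A
        using mass[of A n] M2_P[of A] that by auto
      show "measure ?M2 (S n \<inter> P) = 0" using S P(1) by (intro M2_P) auto
    qed (use S(2)[of n] in \<open>auto simp: S_def\<close>)
    show "negligible (S n - P)"
    proof (rule local_laplacian.null_if_dominated[OF local_laplacian_uminus[OF L] h(3) a b])
      show "S n - P \<in> sets borel" using S P(1) by auto
      show "1 / Suc n * measure lborel A \<le> measure ?M2 A" if "A \<in> sets borel" "A \<subseteq> S n - P" for A
      proof -
        have "A \<inter> P = {}" "A \<subseteq> S n" using that(2) by auto
        then show ?thesis using mass[of A n] M1_N[of A] that(1) by simp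
      qed
      show "measure ?M1 (S n - P) = 0" using S P(1) by (intro M1_N) auto
    qed (use S(2)[of n] in \<open>auto simp: S_def\<close>)
  qed
  have "negligible (\<Union>n. (S n \<inter> P) \<union> (S n - P))"
    by (intro negligible_countable_Union) (auto intro!: negligible_Un null)
  \<comment> \<open>\<open>Z\<close> and \<open>Z'\<close> are null sets off which \<open>v\<close>
    agrees with the cut-off of u - \<alpha> and \<theta> is positive on \<Omega>.\<close>
  moreover obtain Z where Z: "Z \<in> null_sets lebesgue" "\<And>x. x \<notin> Z \<Longrightarrow> w x = v x"
    by (rule AE_E3[OF v_leb]) simp
  moreover obtain Z' where Z': "Z' \<in> null_sets lebesgue" "\<And>x. x \<notin> Z' \<Longrightarrow> x \<in> \<Omega> \<longrightarrow> \<theta> x > 0"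
    by (rule AE_E3[OF AE_completion[OF \<theta>(2)]]) simp
  ultimately have "negligible ((\<Union>n. (S n \<inter> P) \<union> (S n - P)) \<union> (Z \<union> Z'))"
    by (intro negligible_Un) (auto simp: negligible_iff_null_sets)
  moreover have "{x \<in> ball z R. u x = \<alpha>} \<subseteq> (\<Union>n. (S n \<inter> P) \<union> (S n - P)) \<union> (Z \<union> Z')"
  proof
    fix x assume x: "x \<in> {x \<in> ball z R. u x = \<alpha>}"
    show "x \<in> (\<Union>n. (S n \<inter> P) \<union> (S n - P)) \<union> (Z \<union> Z')"
    proof (cases "x \<in> Z \<union> Z'")
      case False
      then have "w x = v x" by (intro Z(2)) simp
      then have "v x = 0" using x by (simp add: w_def)
      have "x \<in> \<Omega>" using x \<Omega>(2) ball_subset_cball by blast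
      then have "\<theta> x > 0" using False Z'(2) by blast
      then obtain n where "1 / Suc n < \<theta> x" using nat_approx_posE by metis
      then have "x \<in> S n" using \<open>v x = 0\<close> \<open>x \<in> \<Omega>\<close> x by (simp add: S_def)
      then show ?thesis by blast
    qed blast
  qed
  ultimately show ?thesis by (rule negligible_subset)
qed

theorem proposition10p1:
  fixes \<Omega> :: "(real ^ 'n) set"
    and u \<theta> :: "real ^ 'n \<Rightarrow> real"
    and \<nu> :: "(real ^ 'n) set \<Rightarrow> real"
    and \<alpha> :: real
  assumes "CARD('n) \<ge> 2"
    and "open \<Omega>"
    and "locally_integrable \<Omega> u"
    and "locally_finite_signed_measure \<Omega> \<nu>"
    and "has_distributional_laplacian u \<nu> \<Omega>"
    and "\<theta> \<in> borel_measurable (restrict_space borel \<Omega>)"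
    and "AE x in lborel. x \<in> \<Omega> \<longrightarrow> \<theta> x > 0"
    and "\<And>A. A \<in> sets borel \<Longrightarrow> A \<subseteq> \<Omega> \<Longrightarrow>
           (\<integral>\<^sup>+x\<in>A. ennreal (\<theta> x) \<partial>lborel) \<le> total_variation \<Omega> \<nu> A"
  shows "{x \<in> \<Omega>. u x = \<alpha>} \<in> null_sets lebesgue"
proof -
  let ?E = "{x \<in> \<Omega>. u x = \<alpha>}"
  \<comment> \<open>The radius depends on the point, so the local results are assembled through the
    fact that a locally negligible set is negligible.\<close>
  have "\<exists>U. openin (top_of_set ?E) U \<and> z \<in> U \<and> negligible U" if "z \<in> ?E" for z
  proof -
    obtain R where R: "R > 0" "cball z R \<subseteq> \<Omega>"
      using assms(2) \<open>z \<in> ?E\<close> open_contains_cball by blast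
    have "negligible {x \<in> ball z R. u x = \<alpha>}"
      by (rule negligible_level_set_in_ball[OF assms(2) R(2) assms(3-8)])
    then have "negligible (?E \<inter> ball z R)" by (rule negligible_subset) auto
    moreover have "openin (top_of_set ?E) (?E \<inter> ball z R)" by (simp add: openin_open_Int)
    ultimately show ?thesis using \<open>z \<in> ?E\<close> R(1) by (intro exI[of _ "?E \<inter> ball z R"]) auto
  qed
  then have "negligible ?E" by (subst locally_negligible_alt) blast
  then show ?thesis by (simp add: negligible_iff_null_sets)
qed

end
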